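(* There exist $g\in C^1(\mathbb{T}^2)$ (real-valued) and $\alpha_0\ge 1$ such that for every $\alpha\in2\mathbb{N}$ with $\alpha\ge\alpha_0$ and every $N\in\mathbb{N}$, the velocity field $u_{\alpha,N}$ is a perfect dynamo.
   Context: $\mathbb{T}^d=\mathbb{R}^d/\mathbb{Z}^d\cong[0,1)^d$; $C^1(\mathbb{T}^2)$ denotes Lipschitz functions. Velocity field. For $\alpha\in2\mathbb{N}$, $N\in\mathbb{N}$ and $g:\mathbb{T}^2\to\mathbb{R}$, put on $[0,1)^3$: $V_\alpha=(0,\,2\alpha|x-\frac12|,\,0)$, $H_\alpha=(2\alpha|y-\frac12|,\,0,\,0)$, $Z=(0,0,-g(x,y))$, extended periodically. Then $u_{\alpha,N}$ is the time-periodic field of period $N+3$ given by $u_{\alpha,N}=0$ for $t\in[0,N)$; $=V_\alpha$ for $t\in[N,N+\frac12)$; $=H_\alpha$ for $t\in[N+\frac12,N+1)$; $=0$ for $t\in[N+1,N+2)$; $=Z$ for $t\in[N+2,N+3)$. Perfect dynamo. Let $u\in L^\infty_tW^{1,\infty}_x$ be a time-periodic divergence-free field on $\mathbb{T}^3$. For a smooth $\psi:\mathbb{T}^3\to\mathbb{R}^3$ let $$\Gamma(\psi)=\sup_{B_{in}\in L^2(\mathbb{T}^3),\ \nabla\cdot B_{in}=0}\ \limsup_{t\to\infty}\frac1t\log\Big|\int_{\mathbb{T}^3}B(t,x)\cdot\psi(x)\,dx\Big|,$$ where $B$ solves the ideal equation $\partial_tB=\nabla\times(u\times B)$, $\nabla\cdot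 B=0$, with $B(0)=B_{in}$ (vector fields may be complex-valued). $u$ is called a perfect dynamo if $\Gamma(\psi)>0$ for some $\psi\in C^\infty(\mathbb{T}^3;\mathbb{R}^3)$. *)

theory Defs
  imports "HOL-Analysis.Analysis"
begin

text \<open>
  Functions on the torus $T^n = R^n / Z^n$ are represented by functions on $R^n$ of period one
  in each coordinate; integrals over the torus are integrals over the unit cube.
\<close>

definition torus_periodic :: "(real ^ 'n \<Rightarrow> 'b) \<Rightarrow> bool" where
  "torus_periodic f \<longleftrightarrow> (\<forall>x i. f (x + axis i 1) = f x)"

definition torus_integral ::
    "(real ^ 'n \<Rightarrow> 'b) \<Rightarrow> 'b :: {banach, second_countable_topology}" where
  "torus_integral f = (LINT x:cbox 0 1|lborel. f x)"

text \<open>The class $C^1(T^n)$ in the sense of Lipschitz functions.\<close>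

definition torus_lipschitz :: "(real ^ 'n \<Rightarrow> 'b :: metric_space) \<Rightarrow> bool" where
  "torus_lipschitz f \<longleftrightarrow> torus_periodic f \<and> (\<exists>L. L-lipschitz_on UNIV f)"

definition partial :: "'n \<Rightarrow> (real ^ 'n \<Rightarrow> 'b) \<Rightarrow> real ^ 'n \<Rightarrow> 'b :: real_normed_vector" where
  "partial i f x = frechet_derivative f (at x) (axis i 1)"

text \<open>
  Smoothness: every iterated partial derivative exists and is again (Frechet) differentiable
  everywhere; in particular all of them are continuous.
\<close>

definition torus_smooth :: "(real ^ 'n \<Rightarrow> 'b :: real_normed_vector) \<Rightarrow> bool" where
  "torus_smooth f \<longleftrightarrow>
     torus_periodic f \<and> (\<forall>is :: 'n list. \<forall>x. fold partial is f differentiable (at x))"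

definition curl :: "(real ^ 3 \<Rightarrow> real ^ 3) \<Rightarrow> real ^ 3 \<Rightarrow> real ^ 3" where
  "curl \<psi> x = vector
     [partial 2 \<psi> x $ 3 - partial 3 \<psi> x $ 2,
      partial 3 \<psi> x $ 1 - partial 1 \<psi> x $ 3,
      partial 1 \<psi> x $ 2 - partial 2 \<psi> x $ 1]"

text \<open>
  Bilinear dot and cross product of a real vector with a real or complex vector
  (no complex conjugation).
\<close>

definition vdot :: "real ^ 'n \<Rightarrow> 'a ^ 'n \<Rightarrow> 'a :: real_vector" where
  "vdot a b = (\<Sum>i\<in>UNIV. (a $ i) *\<^sub>R (b $ i))"

definition vcross :: "real ^ 3 \<Rightarrow> 'a ^ 3 \<Rightarrow> ('a :: real_vector) ^ 3" where
  "vcross a b = vector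
     [(a $ 2) *\<^sub>R (b $ 3) - (a $ 3) *\<^sub>R (b $ 2),
      (a $ 3) *\<^sub>R (b $ 1) - (a $ 1) *\<^sub>R (b $ 3),
      (a $ 1) *\<^sub>R (b $ 2) - (a $ 2) *\<^sub>R (b $ 1)]"

text \<open>Divergence-free fields on the torus, in the sense of distributions.\<close>

definition div_free ::
    "(real ^ 'n \<Rightarrow> ('a :: {banach, second_countable_topology}) ^ 'n) \<Rightarrow> bool" where
  "div_free F \<longleftrightarrow>
     (\<forall>\<phi> :: real ^ 'n \<Rightarrow> real. torus_smooth \<phi> \<longrightarrow>
        torus_integral (\<lambda>x. vdot (\<chi> i. partial i \<phi> x) (F x)) = 0)"

definition torus_L2 :: "(real ^ 'n \<Rightarrow> 'b :: euclidean_space) \<Rightarrow> bool" where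
  "torus_L2 F \<longleftrightarrow> torus_periodic F \<and> F \<in> borel_measurable lborel \<and>
     set_integrable lborel (cbox 0 1) (\<lambda>x. (norm (F x))\<^sup>2)"

text \<open>
  Real, time-periodic, divergence-free fields in $L^\infty_t W^{1,\infty}_x$. The space
  $W^{1,\infty}$ of the torus consists of the (bounded) Lipschitz functions.
\<close>

definition admissible_velocity :: "(real \<Rightarrow> real ^ 3 \<Rightarrow> real ^ 3) \<Rightarrow> bool" where
  "admissible_velocity u \<longleftrightarrow>
     (\<exists>T>0. \<forall>t x. u (t + T) x = u t x) \<and>
     (\<forall>t. torus_periodic (u t)) \<and>
     (\<lambda>(t, x). u t x) \<in> borel_measurable (lborel \<Otimes>\<^sub>M lborel) \<and>
     (\<exists>M. AE t in lborel. (\<forall>x. norm (u t x) \<le> M) \<and> M-lipschitz_on UNIV (u t)) \<and>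
     (AE t in lborel. div_free (u t))"

text \<open>
  \<open>B\<close> is a distributional solution in $L^\infty_{loc}([0,\infty); L^2)$ of
  $\partial_t B = \nabla\times(u\times B)$, $\nabla\cdot B = 0$, $B(0) = B_{in}$. The equation is
  tested against smooth real fields $\psi$, using
  $\int (\nabla\times F)\cdot\psi = \int F\cdot(\nabla\times\psi)$, and is integrated in time.
  This forces $t \mapsto \int B(t)\cdot\psi$ to be continuous, so that its value at each single
  time is meaningful; for admissible \<open>u\<close> the solution is determined by \<open>B_in\<close> up to null sets.
\<close>

definition ideal_solution ::
    "(real \<Rightarrow> real ^ 3 \<Rightarrow> real ^ 3) \<Rightarrow> (real ^ 3 \<Rightarrow> complex ^ 3) \<Rightarrow>
     (real \<Rightarrow> real ^ 3 \<Rightarrow> complex ^ 3) \<Rightarrow> bool" where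
  "ideal_solution u B_in B \<longleftrightarrow>
     (\<forall>t\<ge>0. torus_L2 (B t) \<and> div_free (B t)) \<and>
     (\<forall>T. \<exists>C. \<forall>t\<in>{0..T}. torus_integral (\<lambda>x. (norm (B t x))\<^sup>2) \<le> C) \<and>
     (AE x in lborel. B 0 x = B_in x) \<and>
     (\<forall>\<psi>. torus_smooth \<psi> \<longrightarrow> (\<forall>t\<ge>0.
        set_integrable lborel {0..t}
          (\<lambda>s. torus_integral (\<lambda>x. vdot (curl \<psi> x) (vcross (u s x) (B s x)))) \<and>
        torus_integral (\<lambda>x. vdot (\<psi> x) (B t x)) =
          torus_integral (\<lambda>x. vdot (\<psi> x) (B_in x)) +
          (LINT s:{0..t}|lborel.
             torus_integral (\<lambda>x. vdot (curl \<psi> x) (vcross (u s x) (B s x))))))"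

text \<open>The logarithm on $[0,\infty)$ with $\log 0 = -\infty$ (whereas \<open>ln 0 = 0\<close> in the library).\<close>

definition elog :: "real \<Rightarrow> ereal" where
  "elog r = (if r > 0 then ereal (ln r) else - \<infinity>)"

definition growth_rate ::
    "(real \<Rightarrow> real ^ 3 \<Rightarrow> real ^ 3) \<Rightarrow> (real ^ 3 \<Rightarrow> real ^ 3) \<Rightarrow> ereal" where
  "growth_rate u \<psi> =
     Sup {Limsup at_top (\<lambda>t. ereal (1 / t) * elog (cmod (torus_integral (\<lambda>x. vdot (\<psi> x) (B t x)))))
          | B_in B. torus_L2 B_in \<and> div_free B_in \<and> ideal_solution u B_in B}"

definition perfect_dynamo :: "(real \<Rightarrow> real ^ 3 \<Rightarrow> real ^ 3) \<Rightarrow> bool" where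
  "perfect_dynamo u \<longleftrightarrow>
     admissible_velocity u \<and> (\<exists>\<psi>. torus_smooth \<psi> \<and> growth_rate u \<psi> > 0)"

text \<open>The building blocks, extended periodically from the unit cube by means of \<open>frac\<close>.\<close>

definition V_field :: "real \<Rightarrow> real ^ 3 \<Rightarrow> real ^ 3" where
  "V_field \<alpha> x = vector [0, 2 * \<alpha> * \<bar>frac (x $ 1) - 1/2\<bar>, 0]"

definition H_field :: "real \<Rightarrow> real ^ 3 \<Rightarrow> real ^ 3" where
  "H_field \<alpha> x = vector [2 * \<alpha> * \<bar>frac (x $ 2) - 1/2\<bar>, 0, 0]"

definition Z_field :: "(real ^ 2 \<Rightarrow> real) \<Rightarrow> real ^ 3 \<Rightarrow> real ^ 3" where
  "Z_field g x = vector [0, 0, - g (vector [x $ 1, x $ 2])]"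

text \<open>In \<open>velocity\<close>, \<open>s\<close> is the representative of \<open>t\<close> modulo the period in $[0, N+3)$.\<close>

definition velocity ::
    "real \<Rightarrow> nat \<Rightarrow> (real ^ 2 \<Rightarrow> real) \<Rightarrow> real \<Rightarrow> real ^ 3 \<Rightarrow> real ^ 3" where
  "velocity \<alpha> N g t x =
     (let n = real N; T = n + 3; s = t - T * of_int \<lfloor>t / T\<rfloor> in
      if s < n then 0
      else if s < n + 1/2 then V_field \<alpha> x
      else if s < n + 1 then H_field \<alpha> x
      else if s < n + 2 then 0
      else Z_field g x)"

end

theory Submission
  imports Defs
begin

text \<open>
  The vertical structure of the field separates. The shears $V_\alpha$ and $H_\alpha$ do not act
  on $z$, and $Z$ translates in $z$ only, so a field whose $z$-dependence is $e^{2\pi iz}$ keeps it,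
  its horizontal components evolve among themselves, and $Z$ multiplies them by $e^{2\pi ig}$.
  The choice is $g(x,y) = \gamma(x) + \gamma(y)$ with $2\pi\gamma(t) = \sin 2\pi t$. Over one period
  the horizontal components are pushed forward by two folded shears of slope $\pm\alpha$ and
  multiplied by \<open>twist x * twist y\<close>, where \<open>twist\<close> is $t \mapsto e^{i\sin 2\pi t}$.

  Without the twist the folds turn half of the stretched field back and the contributions of size
  $\alpha$ cancel. The twist prevents this because it is correlated with the sign of the slope:
  \<open>twist_bias\<close>, the integral of the slope sign times the twist, does not vanish. To exploit
  this the evolution is dualised. The mean of a horizontal component after $n$ periods is the integral
  of a pulled-back one-form, \<open>pulled_form\<close>, along vertical lines. One half-step maps a nearly
  vertical unit line to about $\alpha$ unit lines that are again nearly vertical once the coordinates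
  are exchanged, so its integral becomes a sum of about $\alpha$ integrals of the previous form,
  weighted by twist and orientation. If all these integrals agree up to a small relative error, the
  sum is $\alpha$ times the bias times their common value, \<open>mean_integral\<close>.

  That they agree is an induction over the number of half-steps (\<open>line_bounds_Suc\<close>), for two
  estimates that are Hoelder continuous of order $1/2$, in the length of the line and in the distance of
  two lines. A half-step contracts the distance of neighbouring lines by $1/\alpha$ while
  it produces $\alpha$ pieces; with the exponent $1/2$ the differences grow like $\sqrt\alpha$ only,
  and so do the integrals over the short pieces cut off at the folds. Both are negligible against
  the growth $\alpha$ of the mean once $\alpha$ is large (\<open>mean_integral_growth\<close>).

  On the side of the equation, the solution is explicit: every phase is a shear flow, under which a
  field is transported by \<open>push\<close>. Divergence-freeness in the sense of distributions survives
  because it can be tested with functions that are merely Lipschitz and almost everywhere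
  differentiable, a class that is stable under composition with the flow (\<open>regular_field_push\<close>);
  the weak equation of a single phase follows by differentiating along the flow
  (\<open>weak_equation_push\<close>), and the phases are glued in time. All invariance properties of torus
  integrals come from translations, by averaging over them.

  Finally the solution started from $(0, e^{2\pi iz}, 0)$ is paired with $(\cos 2\pi z, 0, 0)$
  after each full period. The pairing is half a mean line integral up to a small relative error
  (\<open>weak_pairing_seed\<close>), so it grows exponentially along these times.
\<close>

section \<open>Bounded Borel functions\<close>

text \<open>
  All functions that occur are of this kind. On bounded sets this gives integrability and Fubini's
  theorem without further work, and the class is stable under the operations used below.
\<close>

definition bounded_borel :: "('a::topological_space \<Rightarrow> 'b::real_normed_vector) \<Rightarrow> bool" where
  "bounded_borel f \<longleftrightarrow> f \<in> borel_measurable borel \<and> bounded (range f)"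

lemma bounded_borelI:
  assumes "f \<in> borel_measurable borel" "\<And>x. norm (f x) \<le> K"
  shows "bounded_borel f"
  using assms unfolding bounded_borel_def bounded_iff by auto

lemma bounded_borel_measurable: "bounded_borel f \<Longrightarrow> f \<in> borel_measurable borel"
  by (simp add: bounded_borel_def)

lemma bounded_borel_bound:
  assumes "bounded_borel f"
  obtains K where "K \<ge> 0" "\<And>x. norm (f x) \<le> K"
proof -
  obtain K where "\<And>x. norm (f x) \<le> K"
    using assms unfolding bounded_borel_def bounded_iff by auto
  then show ?thesis
    by (intro that[of "max K 0"]) (auto simp: le_max_iff_disj)
qed

lemma bounded_borel_set_integrable:
  fixes f :: "'a::euclidean_space \<Rightarrow> 'b::{banach,second_countable_topology}"
  assumes "bounded_borel f" and "A \<in> sets borel" "bounded A"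
  shows "set_integrable lborel A f"
proof -
  obtain K where K: "\<And>x. norm (f x) \<le> K"
    using bounded_borel_bound[OF assms(1)] by metis
  have "emeasure lborel A < \<infinity>"
    using assms(3) emeasure_bounded_finite by blast
  then show ?thesis
    unfolding set_integrable_def using assms K
    by (intro integrableI_bounded_set[where A=A and B=K])
       (auto simp: bounded_borel_def indicator_def)
qed

lemma bounded_borel_integrable_on:
  fixes f :: "real \<Rightarrow> complex"
  assumes "bounded_borel f"
  shows "f integrable_on {a..b}"
  using set_borel_integral_eq_integral(1)[OF bounded_borel_set_integrable[OF assms]] by simp

lemma set_lebesgue_eq_integral:
  fixes f :: "real \<Rightarrow> complex"
  assumes "bounded_borel f"
  shows "(LINT x:{a..b}|lborel. f x) = integral {a..b} f"
  using set_borel_integral_eq_integral(2)[OF bounded_borel_set_integrable[OF assms]] by simp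

lemma Fubini_bounded_borel:
  fixes f :: "'a::euclidean_space \<Rightarrow> 'b::euclidean_space \<Rightarrow> 'c::{banach,second_countable_topology}"
  assumes f: "bounded_borel (\<lambda>(x, y). f x y)"
    and A: "A \<in> sets borel" "bounded A" and B: "B \<in> sets borel" "bounded B"
  shows "(LINT x:A|lborel. (LINT y:B|lborel. f x y)) = (LINT y:B|lborel. (LINT x:A|lborel. f x y))"
    and "set_integrable lborel A (\<lambda>x. LINT y:B|lborel. f x y)"
proof -
  have [measurable]: "A \<in> sets borel" "B \<in> sets borel" by fact+
  have "set_integrable lborel (A \<times> B) (\<lambda>(x, y). f x y)"
    by (rule bounded_borel_set_integrable[OF f]) (use A B in \<open>auto intro: bounded_Times borel_Times\<close>)
  then have int: "integrable (lborel \<Otimes>\<^sub>M lborel)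
      (case_prod (\<lambda>x y. indicator A x *\<^sub>R indicator B y *\<^sub>R f x y))"
    unfolding set_integrable_def lborel_prod
    by (rule Bochner_Integration.integrable_cong[THEN iffD1, rotated -1])
       (auto simp: indicator_def split: prod.splits)
  show "(LINT x:A|lborel. (LINT y:B|lborel. f x y)) = (LINT y:B|lborel. (LINT x:A|lborel. f x y))"
  proof -
    have "(LINT y|lborel. LINT x|lborel. indicator A x *\<^sub>R indicator B y *\<^sub>R f x y)
        = (LINT y|lborel. indicator B y *\<^sub>R (LINT x|lborel. indicator A x *\<^sub>R f x y))"
      by (simp only: scaleR_left_commute[of "indicat_real A _" "indicat_real B _"] integral_scaleR_right)
    moreover have "(LINT x|lborel. LINT y|lborel. indicator A x *\<^sub>R indicator B y *\<^sub>R f x y)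
        = (LINT x|lborel. indicator A x *\<^sub>R (LINT y|lborel. indicator B y *\<^sub>R f x y))"
      by (simp only: integral_scaleR_right)
    ultimately show ?thesis
      using lborel_pair.Fubini_integral[OF int] by (simp only: set_lebesgue_integral_def)
  qed
  show "set_integrable lborel A (\<lambda>x. LINT y:B|lborel. f x y)"
    using lborel_pair.integrable_fst'[OF int]
    by (simp only: set_lebesgue_integral_def set_integrable_def split integral_scaleR_right)
qed

lemma bounded_borel_const: "bounded_borel (\<lambda>x. c)"
  by (rule bounded_borelI[where K="norm c"]) auto

lemma bounded_borel_mult:
  fixes f g :: "'a::topological_space \<Rightarrow> complex"
  assumes "bounded_borel f" "bounded_borel g"
  shows "bounded_borel (\<lambda>x. f x * g x)"
proof -
  obtain K where K: "K \<ge> 0" "\<And>x. norm (f x) \<le> K" using bounded_borel_bound[OF assms(1)] by blast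
  obtain L where L: "L \<ge> 0" "\<And>x. norm (g x) \<le> L" using bounded_borel_bound[OF assms(2)] by blast
  show ?thesis
    using bounded_borel_measurable[OF assms(1)] bounded_borel_measurable[OF assms(2)] K L
    by (intro bounded_borelI[where K="K * L"]) (auto simp: norm_mult intro!: mult_mono)
qed

lemma bounded_borel_diff:
  fixes f g :: "'a::topological_space \<Rightarrow> complex"
  assumes "bounded_borel f" "bounded_borel g"
  shows "bounded_borel (\<lambda>x. f x - g x)"
proof -
  obtain K where K: "K \<ge> 0" "\<And>x. norm (f x) \<le> K" using bounded_borel_bound[OF assms(1)] by blast
  obtain L where L: "L \<ge> 0" "\<And>x. norm (g x) \<le> L" using bounded_borel_bound[OF assms(2)] by blast
  show ?thesis
    using bounded_borel_measurable[OF assms(1)] bounded_borel_measurable[OF assms(2)] K L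
    by (intro bounded_borelI[where K="K + L"])
       (auto intro!: order_trans[OF norm_triangle_ineq4] add_mono)
qed

lemma bounded_borel_compose:
  assumes "bounded_borel f" "g \<in> borel_measurable borel"
  shows "bounded_borel (\<lambda>x. f (g x))"
proof -
  obtain K where "\<And>x. norm (f x) \<le> K" using bounded_borel_bound[OF assms(1)] by blast
  then show ?thesis
    using measurable_compose[OF assms(2) bounded_borel_measurable[OF assms(1)]]
    by (intro bounded_borelI[where K=K]) auto
qed

lemma bounded_borel_scaleR:
  fixes g :: "'a::topological_space \<Rightarrow> 'b::{real_normed_vector,second_countable_topology}"
  assumes "bounded_borel f" "bounded_borel g"
  shows "bounded_borel (\<lambda>x. f x *\<^sub>R g x)"
proof -
  obtain K where K: "K \<ge> 0" "\<And>x. norm (f x) \<le> K" using bounded_borel_bound[OF assms(1)] by blast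
  obtain L where L: "L \<ge> 0" "\<And>x. norm (g x) \<le> L" using bounded_borel_bound[OF assms(2)] by blast
  have "\<bar>f x\<bar> * norm (g x) \<le> K * L" for x
    using K L K(2)[of x] by (intro mult_mono) auto
  then show ?thesis
    using bounded_borel_measurable[OF assms(1)] bounded_borel_measurable[OF assms(2)]
    by (intro bounded_borelI[where K="K * L"]) auto
qed

lemma bounded_borel_add:
  fixes g :: "'a::topological_space \<Rightarrow> 'b::{real_normed_vector,second_countable_topology}"
  assumes "bounded_borel f" "bounded_borel g"
  shows "bounded_borel (\<lambda>x. f x + g x)"
proof -
  obtain K where K: "\<And>x. norm (f x) \<le> K" using bounded_borel_bound[OF assms(1)] by blast
  obtain L where L: "\<And>x. norm (g x) \<le> L" using bounded_borel_bound[OF assms(2)] by blast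
  show ?thesis
    using bounded_borel_measurable[OF assms(1)] bounded_borel_measurable[OF assms(2)] K L
    by (intro bounded_borelI[where K="K + L"]) (auto intro!: order_trans[OF norm_triangle_ineq] add_mono)
qed

lemma bounded_borel_sum:
  fixes g :: "'i \<Rightarrow> 'a::topological_space \<Rightarrow> 'b::{real_normed_vector,second_countable_topology}"
  assumes "\<And>i. i \<in> I \<Longrightarrow> bounded_borel (g i)"
  shows "bounded_borel (\<lambda>x. \<Sum>i\<in>I. g i x)"
  using assms
  by (induction I rule: infinite_finite_induct) (auto intro: bounded_borel_add bounded_borel_const)

lemma bounded_borel_linear:
  assumes "bounded_linear T" "bounded_borel f"
  shows "bounded_borel (\<lambda>x. T (f x))"
proof -
  obtain K where K: "K \<ge> 0" "\<And>x. norm (f x) \<le> K" using bounded_borel_bound[OF assms(2)] by blast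
  obtain L where L: "L \<ge> 0" "\<And>y. norm (T y) \<le> norm y * L"
    using bounded_linear.nonneg_bounded[OF assms(1)] by blast
  have "norm (T (f x)) \<le> K * L" for x
    by (rule order_trans[OF L(2)]) (intro mult_right_mono K L)
  moreover have "T \<in> borel_measurable borel"
    by (intro borel_measurable_continuous_onI linear_continuous_on assms)
  ultimately show ?thesis
    using measurable_compose[OF bounded_borel_measurable[OF assms(2)]]
    by (intro bounded_borelI[where K="K * L"]) auto
qed

lemma bounded_borel_nth: "bounded_borel f \<Longrightarrow> bounded_borel (\<lambda>x. f x $ i)"
  by (rule bounded_borel_linear[OF bounded_linear_vec_nth])

lemma norm_axis_eq: "norm (axis i c :: 'a::real_normed_vector ^ 'n) = norm c"
  by (simp add: axis_def norm_vec_def L2_set_def if_distrib[of norm]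
       if_distrib[of "\<lambda>x. x\<^sup>2"] cong: if_cong)

lemma bounded_linear_axis: "bounded_linear (axis i :: 'a::real_normed_vector \<Rightarrow> 'a ^ 'n)"
  by (rule bounded_linear_intro[where K=1])
     (auto simp: norm_axis_eq, auto simp: vec_eq_iff axis_def)

lemma bounded_borel_axis:
  fixes f :: "'b::topological_space \<Rightarrow> 'a::real_normed_vector"
  shows "bounded_borel f \<Longrightarrow> bounded_borel (\<lambda>x. axis i (f x) :: 'a ^ 'n)"
  by (rule bounded_borel_linear[OF bounded_linear_axis])

lemma bounded_borel_vdot:
  fixes a :: "'x::topological_space \<Rightarrow> real ^ 'n"
    and b :: "'x \<Rightarrow> ('a::{real_normed_vector,second_countable_topology}) ^ 'n"
  assumes "bounded_borel a" "bounded_borel b"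
  shows "bounded_borel (\<lambda>x. vdot (a x) (b x))"
  unfolding vdot_def by (intro bounded_borel_sum bounded_borel_scaleR bounded_borel_nth assms)

section \<open>Integrals over intervals\<close>

text \<open>
  Integration by parts against the primitive of \<open>f\<close>, which need not be differentiable
  everywhere: writing $\varphi(x) = \varphi(b) - \int_x^b \varphi'$, it is an exchange of integrals.
  What matters below is that an oscillating \<open>f\<close> enters only through its primitive.
\<close>

lemma norm_integral_product_le:
  fixes f \<phi> \<phi>' :: "real \<Rightarrow> complex"
  assumes f: "bounded_borel f" and ab: "a \<le> b"
    and \<phi>: "\<And>x. (\<phi> has_vector_derivative \<phi>' x) (at x)"
    and \<phi>'_cont: "continuous_on UNIV \<phi>'"
    and K: "\<And>x. x \<in> {a..b} \<Longrightarrow> norm (\<phi>' x) \<le> K"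
    and S: "\<And>t. t \<in> {a..b} \<Longrightarrow> norm (integral {a..t} f) \<le> S"
  shows "norm (integral {a..b} (\<lambda>x. \<phi> x * f x)) \<le> (norm (\<phi> b) + (b - a) * K) * S"
proof -
  define h where "h t = (if t \<in> {a..b} then \<phi>' t else 0)" for t
  have f_m [measurable]: "f \<in> borel_measurable borel" using f by (rule bounded_borel_measurable)
  have \<phi>'_m [measurable]: "\<phi>' \<in> borel_measurable borel"
    using \<phi>'_cont by (rule borel_measurable_continuous_onI)
  have \<phi>_cont: "continuous_on A \<phi>" for A
    by (rule continuous_on_vector_derivative) (use \<phi> has_vector_derivative_at_within in blast)
  have \<phi>_m [measurable]: "\<phi> \<in> borel_measurable borel"
    using \<phi>_cont by (rule borel_measurable_continuous_onI)
  have h_m [measurable]: "h \<in> borel_measurable borel"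
  proof -
    have "h = (\<lambda>t. indicator {a..b} t *\<^sub>R \<phi>' t)" by (auto simp: h_def indicator_def)
    then show ?thesis by simp
  qed
  have K0: "K \<ge> 0" using order_trans[OF norm_ge_zero K[of a]] ab by simp
  have S0: "S \<ge> 0" using order_trans[OF norm_ge_zero S[of a]] ab by simp
  have hK: "norm (h t) \<le> K" for t using K K0 by (auto simp: h_def)
  obtain F where F: "F \<ge> 0" "\<And>x. norm (f x) \<le> F" using bounded_borel_bound[OF f] by blast
  have bb: "bounded_borel (\<lambda>(y, t). indicator {..t} y *\<^sub>R (h t * f y))"
  proof (rule bounded_borelI[where K="K * F"])
    have [measurable]: "(\<lambda>p::real \<times> real. h (snd p)) \<in> borel_measurable borel"
      "(\<lambda>p::real \<times> real. f (fst p)) \<in> borel_measurable borel"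
      by (rule measurable_compose[OF _ h_m] measurable_compose[OF _ f_m],
          rule borel_measurable_continuous_onI, intro continuous_intros)+
    have "closed {p::real \<times> real. fst p \<le> snd p}"
      by (intro closed_Collect_le continuous_intros)
    then have [measurable]: "{p::real \<times> real. fst p \<le> snd p} \<in> sets borel" by auto
    have "(\<lambda>p. indicator {p::real \<times> real. fst p \<le> snd p} p *\<^sub>R (h (snd p) * f (fst p)))
        \<in> borel_measurable borel" by measurable
    then show "(\<lambda>(y, t). indicator {..t} y *\<^sub>R (h t * f y)) \<in> borel_measurable borel"
      by (rule measurable_cong[THEN iffD1, rotated]) (auto simp: indicator_def)
  qed (use hK F K0 in \<open>auto simp: norm_mult indicator_def intro!: mult_mono\<close>)
  have bbh: "bounded_borel h" using h_m hK by (rule bounded_borelI)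
  have bbx: "bounded_borel (\<lambda>y. indicator {..t} y *\<^sub>R (h t * f y))" for t
    using hK F K0
    by (intro bounded_borelI[where K="K * F"]) (auto simp: norm_mult indicator_def intro!: mult_mono)
  have bby: "bounded_borel (\<lambda>t. indicator {..t} y *\<^sub>R (h t * f y))" for y
    using hK F K0
    by (intro bounded_borelI[where K="K * F"])
       (auto simp: norm_mult indicator_def intro!: mult_mono)
  have inner_y: "(LINT t:{a..b}|lborel. indicator {..t} y *\<^sub>R (h t * f y)) = (\<phi> b - \<phi> y) * f y"
    if "y \<in> {a..b}" for y
  proof -
    have "(LINT t:{a..b}|lborel. indicator {..t} y *\<^sub>R (h t * f y))
        = integral {a..b} (\<lambda>t. indicator {..t} y *\<^sub>R (h t * f y))"
      by (rule set_lebesgue_eq_integral[OF bby])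
    also have "\<dots> = integral {a..b} (\<lambda>t. if t \<in> {y..b} then \<phi>' t * f y else 0)"
      by (rule integral_cong) (use that in \<open>auto simp: h_def indicator_def\<close>)
    also have "\<dots> = integral {y..b} (\<lambda>t. \<phi>' t * f y)"
      using integral_restrict_Int[of "{a..b}" "{y..b}" "\<lambda>t. \<phi>' t * f y"] that
      by (simp add: Int_absorb1 Int_absorb2)
    also have "\<dots> = integral {y..b} \<phi>' * f y" by simp
    also have "integral {y..b} \<phi>' = \<phi> b - \<phi> y"
      by (rule integral_unique, rule fundamental_theorem_of_calculus)
         (use that has_vector_derivative_at_within[OF \<phi>] in auto)
    finally show ?thesis .
  qed
  have inner_t: "(LINT y:{a..b}|lborel. indicator {..t} y *\<^sub>R (h t * f y)) = h t * integral {a..t} f"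
    if "t \<in> {a..b}" for t
  proof -
    have "(LINT y:{a..b}|lborel. indicator {..t} y *\<^sub>R (h t * f y))
        = integral {a..b} (\<lambda>y. indicator {..t} y *\<^sub>R (h t * f y))"
      by (rule set_lebesgue_eq_integral[OF bbx])
    also have "\<dots> = integral {a..b} (\<lambda>y. if y \<in> {a..t} then h t * f y else 0)"
      by (rule integral_cong) (auto simp: indicator_def)
    also have "\<dots> = integral {a..t} (\<lambda>y. h t * f y)"
      using integral_restrict_Int[of "{a..b}" "{a..t}" "\<lambda>y. h t * f y"] that
      by (simp add: Int_absorb1 Int_absorb2)
    finally show ?thesis by simp
  qed
  have *: "integral {a..b} (\<lambda>y. (\<phi> b - \<phi> y) * f y) = (LINT t:{a..b}|lborel. h t * integral {a..t} f)"
  proof -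
    have bbp: "bounded_borel (\<lambda>y. (\<phi> b - \<phi> (max a (min y b))) * f y)"
    proof -
      have "compact (\<phi> ` {a..b})" by (intro compact_continuous_image \<phi>_cont) auto
      then obtain P where P: "\<And>x. x \<in> {a..b} \<Longrightarrow> norm (\<phi> x) \<le> P"
        by (meson bounded_iff compact_imp_bounded imageI)
      have "norm (\<phi> b - \<phi> (max a (min y b))) \<le> P + P" for y
        by (rule order_trans[OF norm_triangle_ineq4]) (use P[of b] P[of "max a (min y b)"] ab in auto)
      then show ?thesis using F
        by (intro bounded_borelI[where K="(P + P) * F"])
           (auto simp: norm_mult intro!: mult_mono order_trans[OF norm_ge_zero])
    qed
    have "integral {a..b} (\<lambda>y. (\<phi> b - \<phi> y) * f y)
        = integral {a..b} (\<lambda>y. (\<phi> b - \<phi> (max a (min y b))) * f y)"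
      by (rule integral_cong) auto
    also have "\<dots> = (LINT y:{a..b}|lborel. (\<phi> b - \<phi> (max a (min y b))) * f y)"
      by (rule set_lebesgue_eq_integral[OF bbp, symmetric])
    also have "\<dots> = (LINT y:{a..b}|lborel. LINT t:{a..b}|lborel. indicator {..t} y *\<^sub>R (h t * f y))"
      by (rule set_lebesgue_integral_cong) (auto simp: inner_y)
    also have "\<dots> = (LINT t:{a..b}|lborel. LINT y:{a..b}|lborel. indicator {..t} y *\<^sub>R (h t * f y))"
      by (rule Fubini_bounded_borel(1)[OF bb]) auto
    also have "\<dots> = (LINT t:{a..b}|lborel. h t * integral {a..t} f)"
      by (rule set_lebesgue_integral_cong) (auto simp: inner_t)
    finally show ?thesis .
  qed
  have "norm (LINT t:{a..b}|lborel. h t * integral {a..t} f) \<le> (LINT t:{a..b}|lborel. K * S)"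
    unfolding set_lebesgue_integral_def
  proof (rule Bochner_Integration.integral_norm_bound_integral)
    have "continuous_on {a..b} (\<lambda>t. integral {a..t} f)"
      by (rule indefinite_integral_continuous_1) (rule bounded_borel_integrable_on[OF f])
    then have "(\<lambda>t. indicator {a..b} t *\<^sub>R integral {a..t} f) \<in> borel_measurable borel"
      by (intro borel_measurable_continuous_on_indicator) auto
    then have m: "(\<lambda>t. h t * (indicator {a..b} t *\<^sub>R integral {a..t} f)) \<in> borel_measurable borel"
      by measurable
    have "set_integrable lborel {a..b} (\<lambda>t. h t * (indicator {a..b} t *\<^sub>R integral {a..t} f))"
      using hK S K0 S0
      by (intro bounded_borel_set_integrable bounded_borelI[OF m, of "K * S"])
         (auto simp: norm_mult indicator_def intro!: mult_mono)
    then show "integrable lborel (\<lambda>t. indicator {a..b} t *\<^sub>R (h t * integral {a..t} f))"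
      unfolding set_integrable_def
      by (rule Bochner_Integration.integrable_cong[THEN iffD1, rotated -1]) (auto simp: indicator_def)
    show "integrable lborel (\<lambda>t. indicator {a..b} t *\<^sub>R (K * S))"
      using ab by (auto intro!: integrable_real_indicator simp: emeasure_lborel_Icc)
  qed (use hK S K0 S0 in \<open>auto simp: norm_mult indicator_def intro!: mult_mono\<close>)
  also have "\<dots> = (b - a) * K * S" using ab by (simp add: set_lebesgue_integral_def)
  finally have 1: "norm (integral {a..b} (\<lambda>y. (\<phi> b - \<phi> y) * f y)) \<le> (b - a) * K * S"
    unfolding * .
  have fi: "(\<lambda>y. \<phi> b * f y) integrable_on {a..b}"
    using F by (intro bounded_borel_integrable_on bounded_borelI[where K="norm (\<phi> b) * F"])
      (auto simp: norm_mult mult_left_mono)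
  have gi: "(\<lambda>y. \<phi> y * f y) integrable_on {a..b}"
  proof -
    obtain P where P: "\<And>x. x \<in> {a..b} \<Longrightarrow> norm (\<phi> x) \<le> P"
      using compact_continuous_image[OF \<phi>_cont[of "{a..b}"]]
      by (meson bounded_iff compact_imp_bounded imageI compact_Icc)
    have "bounded_borel (\<lambda>y. (indicator {a..b} y *\<^sub>R \<phi> y) * f y)"
      using P F ab order_trans[OF norm_ge_zero P[of a]]
      by (intro bounded_borelI[where K="P * F"])
         (auto simp: norm_mult indicator_def intro!: mult_mono)
    from bounded_borel_integrable_on[OF this, of a b] show ?thesis
      by (rule integrable_eq) auto
  qed
  have "integral {a..b} (\<lambda>y. (\<phi> b - \<phi> y) * f y)
      = \<phi> b * integral {a..b} f - integral {a..b} (\<lambda>y. \<phi> y * f y)"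
    unfolding left_diff_distrib by (subst integral_diff[OF fi gi]) simp
  then have "integral {a..b} (\<lambda>y. \<phi> y * f y)
      = \<phi> b * integral {a..b} f - integral {a..b} (\<lambda>y. (\<phi> b - \<phi> y) * f y)" by simp
  then have "norm (integral {a..b} (\<lambda>y. \<phi> y * f y))
      \<le> norm (\<phi> b * integral {a..b} f) + norm (integral {a..b} (\<lambda>y. (\<phi> b - \<phi> y) * f y))"
    by (simp only: norm_triangle_ineq4)
  also have "\<dots> \<le> norm (\<phi> b) * S + (b - a) * K * S"
    using 1 S[of b] ab by (auto simp: norm_mult intro!: add_mono mult_left_mono)
  finally show ?thesis by (simp add: algebra_simps)
qed

lemma periodic_of_int:
  fixes f :: "real \<Rightarrow> 'a"
  assumes "\<And>x. f (x + 1) = f x"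
  shows "f (x + of_int k) = f x"
proof -
  have nat: "f (x + of_nat n) = f x" for n x
  proof (induction n)
    case (Suc n) then show ?case using assms[of "x + of_nat n"] by (simp add: algebra_simps)
  qed simp
  show ?thesis
  proof (cases "k \<ge> 0")
    case True then show ?thesis using nat[of x "nat k"] by simp
  next
    case False then show ?thesis using nat[of "x + of_int k" "nat (- k)"] by simp
  qed
qed

lemma integral_add_bounded_borel:
  fixes f :: "real \<Rightarrow> complex"
  assumes "bounded_borel f" "a \<le> b" "b \<le> c"
  shows "integral {a..b} f + integral {b..c} f = integral {a..c} f"
  by (rule Henstock_Kurzweil_Integration.integral_combine) (use assms bounded_borel_integrable_on in auto)

lemma integral_affine_subst:
  fixes f :: "real \<Rightarrow> complex"
  assumes f: "bounded_borel f" and m: "m \<noteq> 0" and ab: "a \<le> b"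
  shows "of_real m * integral {a..b} (\<lambda>y. f (p + m * y))
    = of_real (sgn m) * integral {min (p + m * a) (p + m * b)..max (p + m * a) (p + m * b)} f"
    (is "_ = _ * integral {?lo..?hi} f")
proof -
  note True = ab
  have [measurable]: "f \<in> borel_measurable borel" using f by (rule bounded_borel_measurable)
  obtain K where K: "\<And>x. norm (f x) \<le> K" using bounded_borel_bound[OF f] by blast
  have g: "bounded_borel (\<lambda>y. f (p + m * y))"
    by (rule bounded_borelI[where K=K]) (use K in auto)
  have ind: "indicator {?lo..?hi} (p + m * y) = (indicator {a..b} y :: real)" for y
  proof (cases "m > 0")
    case m: True
    then have "p + m * a \<le> p + m * b" using True by simp
    then show ?thesis using m by (auto simp: indicator_def min_def max_def)
  next
    case False
    then have m: "m < 0" using assms(2) by simp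
    then have "p + m * b \<le> p + m * a" using True by simp
    then have "?lo = p + m * b" "?hi = p + m * a" by auto
    then show ?thesis using m by (auto simp: indicator_def)
  qed
  have "integral {?lo..?hi} f = (LINT x|lborel. indicator {?lo..?hi} x *\<^sub>R f x)"
    using set_lebesgue_eq_integral[OF f] by (simp add: set_lebesgue_integral_def)
  also have "\<dots> = \<bar>m\<bar> *\<^sub>R (LINT y|lborel. indicator {?lo..?hi} (p + m * y) *\<^sub>R f (p + m * y))"
    by (rule lborel_integral_real_affine[OF m])
  also have "\<dots> = \<bar>m\<bar> *\<^sub>R integral {a..b} (\<lambda>y. f (p + m * y))"
    unfolding ind using set_lebesgue_eq_integral[OF g] by (simp add: set_lebesgue_integral_def)
  finally show ?thesis
    by (simp add: scaleR_conv_of_real sgn_mult_abs flip: mult.assoc of_real_mult)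
qed

lemma integral_period:
  fixes f :: "real \<Rightarrow> complex"
  assumes f: "bounded_borel f" and per: "\<And>y. f (y + 1) = f y"
  shows "integral {a..a + 1} f = integral {0..1} f"
proof -
  define Q where "Q a = integral {a..a + 1} f" for a
  have shift: "integral {a + 1..b + 1} f = integral {a..b} f" if "a \<le> b" for a b
    using integral_affine_subst[OF f _ that, of 1 1] that per by (simp add: add.commute)
  have frac: "Q (a + h) = Q a" if "0 \<le> h" "h \<le> 1" for a h
    using integral_add_bounded_borel[OF f, of a "a + h" "a + 1"]
      integral_add_bounded_borel[OF f, of "a + h" "a + 1" "a + h + 1"]
      shift[of a "a + h"] that by (simp add: Q_def algebra_simps)
  have "Q (a + 1) = Q a" for a using frac[of 1 a] by simp
  then have "Q (0 + frac a + of_int \<lfloor>a\<rfloor>) = Q (0 + frac a)"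
    by (rule periodic_of_int[where f=Q])
  also have "\<dots> = Q 0" by (rule frac) (auto simp: less_imp_le[OF frac_lt_1])
  finally show ?thesis by (simp add: Q_def frac_def)
qed

text \<open>
  Cut a long interval into unit intervals and one remainder.
\<close>

lemma norm_integral_le_unit_steps:
  fixes f :: "real \<Rightarrow> complex"
  assumes f: "bounded_borel f" and K1: "K1 \<ge> 0" and ut: "u \<le> t"
    and 1: "\<And>v. u \<le> v \<Longrightarrow> v + 1 \<le> t \<Longrightarrow> norm (integral {v..v + 1} f) \<le> K1"
    and 2: "\<And>v. u \<le> v \<Longrightarrow> v \<le> t \<Longrightarrow> t - v \<le> 1 \<Longrightarrow> norm (integral {v..t} f) \<le> K2"
  shows "norm (integral {u..t} f) \<le> (t - u) * K1 + K2"
proof -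
  have "norm (integral {v..t} f) \<le> (t - v) * K1 + K2"
    if "t - v \<le> real n + 1" "u \<le> v" "v \<le> t" for n v
    using that
  proof (induction n arbitrary: v)
    case 0
    then have "(t - v) * K1 \<ge> 0" using K1 by simp
    then show ?case using 2[of v] 0 by simp
  next
    case (Suc n)
    show ?case
    proof (cases "t - v \<le> 1")
      case True
      have "(t - v) * K1 \<ge> 0" using Suc.prems K1 by simp
      then show ?thesis using 2[of v] Suc.prems True by simp
    next
      case False
      have "integral {v..t} f = integral {v..v + 1} f + integral {v + 1..t} f"
        using integral_add_bounded_borel[OF f, of v "v + 1" t] False by simp
      moreover have "norm (integral {v..v + 1} f) \<le> K1" using 1[of v] Suc.prems False by simp
      moreover have "norm (integral {v + 1..t} f) \<le> (t - (v + 1)) * K1 + K2"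
        using Suc.IH[of "v + 1"] Suc.prems False by simp
      ultimately show ?thesis
        by (simp add: algebra_simps) (smt (verit) norm_triangle_ineq)
    qed
  qed
  from this[of u "nat \<lceil>t - u\<rceil>"] show ?thesis using ut
    by (simp add: of_nat_ceiling add_increasing2)
qed

section \<open>The fold, the twist and the pulled-back form\<close>

text \<open>
  A shear phase of duration $1/2$ and profile \<open>2 * \<alpha> * tent\<close> displaces by \<open>\<alpha> * tent\<close>.
\<close>

definition tent :: "real \<Rightarrow> real" where
  "tent y = \<bar>frac y - 1/2\<bar>"

definition tent_slope :: "real \<Rightarrow> real" where
  "tent_slope y = (if frac y < 1/2 then - 1 else 1)"

definition twist :: "real \<Rightarrow> complex" where
  "twist y = cis (sin (2 * pi * y))"

definition twist' :: "real \<Rightarrow> complex" where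
  "twist' y = \<i> * of_real (2 * pi * cos (2 * pi * y)) * twist y"

text \<open>
  The one-form \<open>twist y * \<eta>\<close>, pulled back through \<open>n\<close> half-steps, at the point
  \<open>(x, y)\<close> and evaluated on the vector \<open>(\<xi>, \<eta>)\<close>. A half-step shears in the
  first coordinate by a tent of the second one, multiplies by the twist of the second coordinate, and
  then exchanges the coordinates, so that both shears of a period take the same form. The vector is
  complex because it will be the value of a complex field.
\<close>

fun pulled_form :: "real \<Rightarrow> nat \<Rightarrow> real \<Rightarrow> real \<Rightarrow> complex \<Rightarrow> complex \<Rightarrow> complex" where
  "pulled_form \<alpha> 0 x y \<xi> \<eta> = twist y * \<eta>"
| "pulled_form \<alpha> (Suc n) x y \<xi> \<eta> =
     twist y * pulled_form \<alpha> n y (x + \<alpha> * tent y) \<eta> (\<xi> + of_real (\<alpha> * tent_slope y) * \<eta>)"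

text \<open>
  Lines are parametrised by the second coordinate because the next half-step shears along the first
  one by an amount that varies with the second; \<open>\<sigma>\<close> is the slope against the vertical.
\<close>

definition line_integral :: "real \<Rightarrow> nat \<Rightarrow> real \<Rightarrow> real \<Rightarrow> real \<Rightarrow> real \<Rightarrow> complex" where
  "line_integral \<alpha> n c \<sigma> a b =
     integral {a..b} (\<lambda>y. pulled_form \<alpha> n (c + \<sigma> * y) y (of_real \<sigma>) 1)"

lemma tent_add_one [simp]: "tent (y + 1) = tent y"
  by (simp add: tent_def frac_1_eq)

lemma tent_slope_add_one [simp]: "tent_slope (y + 1) = tent_slope y"
  by (simp add: tent_slope_def frac_1_eq)

lemma twist_add_one [simp]: "twist (y + 1) = twist y"
  by (simp add: twist_def distrib_left)

lemma norm_twist [simp]: "norm (twist y) = 1"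
  by (simp add: twist_def)

lemma tent_nonneg: "0 \<le> tent y" and tent_le: "tent y \<le> 1/2"
  using frac_ge_0[of y] frac_lt_1[of y] by (auto simp: tent_def abs_if)

lemma abs_tent_slope [simp]: "\<bar>tent_slope y\<bar> = 1"
  by (simp add: tent_slope_def)

lemma tent_lipschitz: "\<bar>tent x - tent y\<bar> \<le> \<bar>x - y\<bar>"
proof -
  have *: "\<bar>tent x - tent y\<bar> \<le> y - x" if "x \<le> y" for x y
  proof (cases "y - x \<ge> 1/2")
    case True
    then show ?thesis using tent_nonneg[of x] tent_nonneg[of y] tent_le[of x] tent_le[of y] by linarith
  next
    case False
    then have "\<lfloor>y\<rfloor> = \<lfloor>x\<rfloor> \<or> \<lfloor>y\<rfloor> = \<lfloor>x\<rfloor> + 1" using that by linarith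
    then show ?thesis
    proof
      assume "\<lfloor>y\<rfloor> = \<lfloor>x\<rfloor>" then show ?thesis using that by (auto simp: tent_def frac_def)
    next
      assume f: "\<lfloor>y\<rfloor> = \<lfloor>x\<rfloor> + 1"
      define n where "n = real_of_int \<lfloor>x\<rfloor>"
      have fy: "real_of_int \<lfloor>y\<rfloor> = n + 1" by (simp add: f n_def)
      have b: "n + 1 \<le> y" "x < n + 1" using of_int_floor_le[of y] fy unfolding n_def by linarith+
      have "tent x = x - n - 1/2" "tent y = n + 3/2 - y"
        using b False fy by (simp_all add: tent_def frac_def n_def[symmetric])
      then show ?thesis using b that by (simp add: abs_le_iff)
    qed
  qed
  show ?thesis using *[of x y] *[of y x] by (cases "x \<le> y") (auto simp: abs_minus_commute)
qed

lemma continuous_on_tent: "continuous_on A tent"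
proof -
  have "1-lipschitz_on A tent"
    by (rule lipschitz_onI) (use tent_lipschitz in \<open>auto simp: dist_real_def\<close>)
  then show ?thesis by (rule lipschitz_on_continuous_on)
qed

lemma measurable_tent [measurable]: "tent \<in> borel_measurable borel"
  by (rule borel_measurable_continuous_onI[OF continuous_on_tent])

lemma measurable_tent_slope [measurable]: "tent_slope \<in> borel_measurable borel"
proof -
  have eq: "tent_slope = (\<lambda>y. if y - of_int \<lfloor>y\<rfloor> < 1/2 then - 1 else 1)"
    by (auto simp: tent_slope_def frac_def)
  show ?thesis by (subst eq) measurable
qed

lemma continuous_on_twist: "continuous_on A twist"
  unfolding twist_def by (intro continuous_intros)

lemma continuous_on_twist': "continuous_on A twist'"
  unfolding twist'_def by (intro continuous_intros continuous_on_twist)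

lemma measurable_twist [measurable]: "twist \<in> borel_measurable borel"
  by (rule borel_measurable_continuous_onI[OF continuous_on_twist])

lemma has_vector_derivative_cis: "(cis has_vector_derivative \<i> * cis x) (at x)"
proof -
  have 1: "((\<lambda>x. \<i> * of_real x) has_vector_derivative \<i>) (at x)"
    using has_vector_derivative_mult_right[OF has_vector_derivative_of_real[OF DERIV_ident]]
    by simp
  have "((exp \<circ> (\<lambda>x. \<i> * of_real x)) has_vector_derivative \<i> * exp (\<i> * of_real x)) (at x)"
    by (rule field_vector_diff_chain_at[OF 1]) (rule DERIV_exp)
  then show ?thesis by (simp add: o_def cis_conv_exp[abs_def])
qed

text \<open>
  Source of all Lipschitz constants of the twist; the numbers $8 \ge 2\pi$ and $128 \ge 2(2\pi)^2$
  below are convenient upper bounds, whose size is irrelevant for large $\alpha$.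
\<close>

lemma norm_cis_diff_le: "norm (cis x - cis y) \<le> \<bar>x - y\<bar>"
proof -
  have "norm (cis x - cis y) \<le> 1 * norm (x - y)"
  proof (rule differentiable_bound[where S=UNIV and f'="\<lambda>x h. h *\<^sub>R (\<i> * cis x)"])
    show "(cis has_derivative (\<lambda>h. h *\<^sub>R (\<i> * cis x))) (at x within UNIV)" for x
      using has_vector_derivative_cis[of x] by (simp add: has_vector_derivative_def)
    show "onorm (\<lambda>h. h *\<^sub>R (\<i> * cis x)) \<le> 1" for x
      by (rule onorm_bound) (auto simp: norm_mult)
  qed auto
  then show ?thesis by simp
qed

lemma abs_sin_diff_le: "\<bar>sin x - sin y\<bar> \<le> \<bar>x - y :: real\<bar>"
  using norm_cis_diff_le[of x y] abs_Im_le_cmod[of "cis x - cis y"] by simp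

lemma abs_cos_diff_le: "\<bar>cos x - cos y\<bar> \<le> \<bar>x - y :: real\<bar>"
  using norm_cis_diff_le[of x y] abs_Re_le_cmod[of "cis x - cis y"] by simp

lemma has_vector_derivative_twist: "(twist has_vector_derivative twist' y) (at y)"
proof -
  have "((\<lambda>y. sin (2 * pi * y)) has_vector_derivative 2 * pi * cos (2 * pi * y)) (at y)"
    by (auto intro!: derivative_eq_intros simp flip: has_real_derivative_iff_has_vector_derivative)
  from vector_diff_chain_at[OF this has_vector_derivative_cis]
  show ?thesis
    by (simp add: o_def twist_def[abs_def] twist'_def scaleR_conv_of_real mult_ac)
qed

lemma norm_twist_diff_le: "norm (twist x - twist y) \<le> 8 * \<bar>x - y\<bar>"
proof -
  have "norm (twist x - twist y) \<le> \<bar>2 * pi * x - 2 * pi * y\<bar>"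
    unfolding twist_def using norm_cis_diff_le abs_sin_diff_le by (rule order_trans)
  also have "\<dots> = 2 * pi * \<bar>x - y\<bar>" by (simp add: abs_mult flip: right_diff_distrib)
  also have "\<dots> \<le> 8 * \<bar>x - y\<bar>" using pi_less_4 by (intro mult_right_mono) auto
  finally show ?thesis .
qed

lemma norm_twist'_le: "norm (twist' y) \<le> 8"
proof -
  have "2 * pi * \<bar>cos (2 * pi * y)\<bar> \<le> 8 * 1" using pi_less_4 by (intro mult_mono) auto
  then show ?thesis by (simp add: twist'_def norm_mult abs_mult)
qed

lemma norm_twist'_diff_le: "norm (twist' x - twist' y) \<le> 128 * \<bar>x - y\<bar>"
proof -
  have pi8: "2 * pi \<le> 8" using pi_less_4 by simp
  define c where "c y = \<i> * complex_of_real (2 * pi * cos (2 * pi * y))" for y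
  have "norm (c x - c y) = norm (\<i> * complex_of_real (2 * pi * (cos (2 * pi * x) - cos (2 * pi * y))))"
    by (simp add: c_def algebra_simps)
  also have "\<dots> = 2 * pi * \<bar>cos (2 * pi * x) - cos (2 * pi * y)\<bar>"
    by (simp only: norm_mult norm_of_real abs_mult) simp
  also have "\<dots> \<le> 2 * pi * \<bar>2 * pi * x - 2 * pi * y\<bar>"
    by (intro mult_left_mono abs_cos_diff_le) auto
  also have "\<dots> = (2 * pi) * (2 * pi) * \<bar>x - y\<bar>" by (simp add: abs_mult flip: right_diff_distrib)
  also have "\<dots> \<le> 8 * 8 * \<bar>x - y\<bar>" using pi8 by (intro mult_right_mono mult_mono) auto
  finally have 1: "norm (c x - c y) \<le> 64 * \<bar>x - y\<bar>" by simp
  have 2: "norm (c y) \<le> 8"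
    using norm_twist'_le[of y] by (simp add: c_def twist'_def norm_mult)
  have "twist' x - twist' y = (c x - c y) * twist x + c y * (twist x - twist y)"
    by (simp add: twist'_def c_def algebra_simps)
  also have "norm \<dots> \<le> norm (c x - c y) * 1 + norm (c y) * norm (twist x - twist y)"
    by (rule order_trans[OF norm_triangle_ineq]) (simp add: norm_mult)
  also have "norm (c y) * norm (twist x - twist y) \<le> 8 * (8 * \<bar>x - y\<bar>)"
    by (intro mult_mono 2 norm_twist_diff_le) auto
  also note 1
  finally show ?thesis by simp
qed

lemma pulled_form_linear:
  "pulled_form \<alpha> n x y \<xi> \<eta> = \<xi> * pulled_form \<alpha> n x y 1 0 + \<eta> * pulled_form \<alpha> n x y 0 1"
proof (induction n arbitrary: x y \<xi> \<eta>)
  case (Suc n)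
  define X where "X = x + \<alpha> * tent y"
  define k where "k = complex_of_real (\<alpha> * tent_slope y)"
  have step: "pulled_form \<alpha> (Suc n) x y \<xi> \<eta> = twist y *
     (\<eta> * pulled_form \<alpha> n y X 1 0 + (\<xi> + k * \<eta>) * pulled_form \<alpha> n y X 0 1)" for \<xi> \<eta>
    by (simp only: pulled_form.simps X_def[symmetric] k_def[symmetric] Suc[of y X \<eta> "\<xi> + k * \<eta>"])
  show ?case by (simp only: step) (simp add: algebra_simps)
qed simp

lemma pulled_form_scale:
  "pulled_form \<alpha> n x y (t * \<xi>) (t * \<eta>) = t * pulled_form \<alpha> n x y \<xi> \<eta>"
  by (subst (1 2) pulled_form_linear) (simp add: algebra_simps)

lemma pulled_form_add_one [simp]:
  "pulled_form \<alpha> n (x + 1) y \<xi> \<eta> = pulled_form \<alpha> n x y \<xi> \<eta>"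
  "pulled_form \<alpha> n x (y + 1) \<xi> \<eta> = pulled_form \<alpha> n x y \<xi> \<eta>"
proof (induction n arbitrary: x y \<xi> \<eta>)
  case (Suc n)
  { case 1 show ?case using Suc(2)[of y "x + \<alpha> * tent y"] by (simp add: algebra_simps) }
  { case 2 show ?case using Suc(1)[of y] by simp }
qed simp_all

lemma bounded_borel_pulled_form: "bounded_borel (\<lambda>(x, y). pulled_form \<alpha> n x y \<xi> \<eta>)"
proof (induction n arbitrary: \<xi> \<eta>)
  case 0
  have "(\<lambda>p::real \<times> real. twist (snd p) * \<eta>) \<in> borel_measurable borel"
    by (intro borel_measurable_continuous_onI continuous_intros
        continuous_on_compose2[OF continuous_on_twist[of UNIV]]) auto
  then show ?case
    by (intro bounded_borelI[where K="norm \<eta>"]) (auto simp: norm_mult case_prod_unfold)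
next
  case (Suc n)
  define T :: "real \<times> real \<Rightarrow> real \<times> real" where "T p = (snd p, fst p + \<alpha> * tent (snd p))" for p
  define P where "P a b p = (case p of (x, y) \<Rightarrow> pulled_form \<alpha> n x y a b)" for a b p
  have T: "T \<in> borel_measurable borel" unfolding T_def
    by (intro borel_measurable_continuous_onI continuous_intros
        continuous_on_compose2[OF continuous_on_tent[of UNIV]]) auto
  have snd_m: "(snd :: real \<times> real \<Rightarrow> real) \<in> borel_measurable borel"
    by (intro borel_measurable_continuous_onI continuous_intros)
  have P: "bounded_borel (P a b)" for a b unfolding P_def by (rule Suc)
  have [measurable]: "(\<lambda>p. P a b (T p)) \<in> borel_measurable borel" for a b
    using T bounded_borel_measurable[OF P] by (rule measurable_compose)
  have [measurable]: "(\<lambda>p::real \<times> real. twist (snd p)) \<in> borel_measurable borel"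
    "(\<lambda>p::real \<times> real. tent_slope (snd p)) \<in> borel_measurable borel"
    by (rule measurable_compose[OF snd_m measurable_twist] measurable_compose[OF snd_m measurable_tent_slope])+
  obtain K1 where K1: "K1 \<ge> 0" "\<And>p. norm (P 1 0 p) \<le> K1" using bounded_borel_bound[OF P] by blast
  obtain K2 where K2: "K2 \<ge> 0" "\<And>p. norm (P 0 1 p) \<le> K2" using bounded_borel_bound[OF P] by blast
  have eq: "(\<lambda>(x, y). pulled_form \<alpha> (Suc n) x y \<xi> \<eta>) = (\<lambda>p. twist (snd p) *
      (\<eta> * P 1 0 (T p) + (\<xi> + of_real (\<alpha> * tent_slope (snd p)) * \<eta>) * P 0 1 (T p)))"
    by (subst pulled_form.simps, subst pulled_form_linear) (auto simp: P_def T_def)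
  show ?case unfolding eq
  proof (rule bounded_borelI)
    fix p
    show "norm (twist (snd p) *
      (\<eta> * P 1 0 (T p) + (\<xi> + of_real (\<alpha> * tent_slope (snd p)) * \<eta>) * P 0 1 (T p)))
      \<le> norm \<eta> * K1 + (norm \<xi> + \<bar>\<alpha>\<bar> * norm \<eta>) * K2"
      unfolding norm_mult norm_twist mult_1
      by (rule norm_triangle_le, unfold norm_mult, intro add_mono mult_mono K1 K2 order_refl)
         (auto simp: norm_mult abs_mult intro!: order_trans[OF norm_triangle_ineq])
  qed measurable
qed

lemma bounded_borel_on_line:
  "bounded_borel (\<lambda>y. pulled_form \<alpha> n (c + \<sigma> * y) y \<xi> \<eta>)"
proof -
  define P where "P p = (case p of (x, y) \<Rightarrow> pulled_form \<alpha> n x y \<xi> \<eta>)" for p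
  have P: "bounded_borel P" unfolding P_def by (rule bounded_borel_pulled_form)
  obtain K where K: "\<And>p. norm (P p) \<le> K" using bounded_borel_bound[OF P] by blast
  have "(\<lambda>y. P (c + \<sigma> * y, y)) \<in> borel_measurable borel"
    by (rule measurable_compose[OF _ bounded_borel_measurable[OF P]])
       (intro borel_measurable_continuous_onI continuous_intros)
  then have "bounded_borel (\<lambda>y. P (c + \<sigma> * y, y))" using K by (rule bounded_borelI)
  then show ?thesis by (simp add: P_def)
qed

section \<open>Integrals along nearly vertical lines\<close>

lemma line_integral_split:
  assumes "a \<le> b" "b \<le> c"
  shows "line_integral \<alpha> n p \<sigma> a b + line_integral \<alpha> n p \<sigma> b c = line_integral \<alpha> n p \<sigma> a c"
  unfolding line_integral_def by (rule integral_add_bounded_borel[OF bounded_borel_on_line assms])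

lemma line_integral_shift: "line_integral \<alpha> n (c + of_int k) \<sigma> a b = line_integral \<alpha> n c \<sigma> a b"
proof -
  have "pulled_form \<alpha> n (c + of_int k + \<sigma> * y) y \<xi> \<eta> = pulled_form \<alpha> n (c + \<sigma> * y) y \<xi> \<eta>" for y \<xi> \<eta>
    using periodic_of_int[of "\<lambda>x. pulled_form \<alpha> n x y \<xi> \<eta>" "c + \<sigma> * y" k]
    by (simp add: algebra_simps)
  then show ?thesis by (simp add: line_integral_def)
qed

text \<open>
  The integral over the vertical unit circle serves as the reference value for all lines of unit length.
\<close>

definition mean_integral :: "real \<Rightarrow> nat \<Rightarrow> complex" where
  "mean_integral \<alpha> n = line_integral \<alpha> n 0 0 0 1"

lemma line_integral_unit: "line_integral \<alpha> n 0 0 u (u + 1) = mean_integral \<alpha> n"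
  using integral_period[OF bounded_borel_on_line[of \<alpha> n 0 0 0 1], of u]
  by (simp add: line_integral_def mean_integral_def)

text \<open>
  The induction hypothesis for the growth argument. A half-step turns a line of slope at most
  $2/\alpha$ into lines of slope at most $2/\alpha$, which fixes the class of lines. Any Hoelder
  exponent strictly between $0$ and $1$ would serve: the estimate for lengths deteriorates like
  $\alpha$ to the power of the exponent, that for distances like $\alpha$ to the power of one
  minus the exponent, and both must stay below $\alpha$.
\<close>

definition line_bounds :: "real \<Rightarrow> nat \<Rightarrow> real \<Rightarrow> real \<Rightarrow> bool" where
  "line_bounds \<alpha> n A D \<longleftrightarrow> 0 \<le> A \<and> 0 \<le> D \<and>
     (\<forall>c \<sigma> a b. \<bar>\<sigma>\<bar> \<le> 2 / \<alpha> \<longrightarrow> a \<le> b \<longrightarrow> b \<le> a + 1 \<longrightarrow>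
        norm (line_integral \<alpha> n c \<sigma> a b) \<le> A * sqrt (b - a)) \<and>
     (\<forall>c \<sigma> c' \<sigma>' a b d. \<bar>\<sigma>\<bar> \<le> 2 / \<alpha> \<longrightarrow> \<bar>\<sigma>'\<bar> \<le> 2 / \<alpha> \<longrightarrow> a \<le> b \<longrightarrow> b \<le> a + 1 \<longrightarrow> d \<le> 1 \<longrightarrow>
        (\<forall>y\<in>{a..b}. \<bar>(c + \<sigma> * y) - (c' + \<sigma>' * y)\<bar> \<le> d) \<longrightarrow>
        norm (line_integral \<alpha> n c \<sigma> a b - line_integral \<alpha> n c' \<sigma>' a b) \<le> D * sqrt d)"

lemma line_bounds_nonneg: "line_bounds \<alpha> n A D \<Longrightarrow> 0 \<le> A \<and> 0 \<le> D"
  by (simp add: line_bounds_def)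

lemma line_bounds_short:
  "line_bounds \<alpha> n A D \<Longrightarrow> \<bar>\<sigma>\<bar> \<le> 2 / \<alpha> \<Longrightarrow> a \<le> b \<Longrightarrow> b \<le> a + 1 \<Longrightarrow>
   norm (line_integral \<alpha> n c \<sigma> a b) \<le> A * sqrt (b - a)"
  unfolding line_bounds_def by blast

lemma line_bounds_close:
  "line_bounds \<alpha> n A D \<Longrightarrow> \<bar>\<sigma>\<bar> \<le> 2 / \<alpha> \<Longrightarrow> \<bar>\<sigma>'\<bar> \<le> 2 / \<alpha> \<Longrightarrow> a \<le> b \<Longrightarrow> b \<le> a + 1 \<Longrightarrow> d \<le> 1 \<Longrightarrow>
   (\<And>y. y \<in> {a..b} \<Longrightarrow> \<bar>(c + \<sigma> * y) - (c' + \<sigma>' * y)\<bar> \<le> d) \<Longrightarrow>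
   norm (line_integral \<alpha> n c \<sigma> a b - line_integral \<alpha> n c' \<sigma>' a b) \<le> D * sqrt d"
  unfolding line_bounds_def by blast

lemma line_bounds_short_const:
  assumes "line_bounds \<alpha> n A D" "\<bar>\<sigma>\<bar> \<le> 2 / \<alpha>" "a \<le> b" "b \<le> a + 1"
  shows "norm (line_integral \<alpha> n c \<sigma> a b) \<le> A"
proof -
  have "A * sqrt (b - a) \<le> A * 1"
    using assms line_bounds_nonneg by (intro mult_left_mono) auto
  then show ?thesis using line_bounds_short[OF assms, of c] by linarith
qed

text \<open>
  By periodicity the line may be moved by an integer so that it starts within $1/2$ of the reference
  line; its slope moves it by at most another $1/2$.
\<close>

lemma line_integral_unit_close:
  assumes lb: "line_bounds \<alpha> n A D" and \<alpha>: "\<alpha> \<ge> 4" and \<sigma>: "\<bar>\<sigma>\<bar> \<le> 2 / \<alpha>"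
  shows "norm (line_integral \<alpha> n c \<sigma> v (v + 1) - mean_integral \<alpha> n) \<le> D"
proof -
  define z where "z = round (c + \<sigma> * v)"
  have "2 / \<alpha> \<le> 1/2" using \<alpha> by (simp add: field_simps)
  then have \<sigma>2: "\<bar>\<sigma>\<bar> \<le> 1/2" using \<sigma> by simp
  have z: "\<bar>c + \<sigma> * v - of_int z\<bar> \<le> 1/2"
    using of_int_round_abs_le[of "c + \<sigma> * v"] by (simp add: z_def abs_minus_commute)
  have "norm (line_integral \<alpha> n (c + of_int (- z)) \<sigma> v (v + 1) - line_integral \<alpha> n 0 0 v (v + 1))
      \<le> D * sqrt 1"
  proof (rule line_bounds_close[OF lb \<sigma>])
    fix y assume y: "y \<in> {v..v + 1}"
    have "\<bar>\<sigma> * (y - v)\<bar> \<le> 1/2 * 1" unfolding abs_mult using \<sigma>2 y by (intro mult_mono) auto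
    moreover have "c + of_int (- z) + \<sigma> * y - (0 + 0 * y) = (c + \<sigma> * v - of_int z) + \<sigma> * (y - v)"
      by (simp add: algebra_simps)
    ultimately show "\<bar>c + of_int (- z) + \<sigma> * y - (0 + 0 * y)\<bar> \<le> 1" using z by linarith
  qed (use \<alpha> in auto)
  then show ?thesis unfolding line_integral_shift line_integral_unit by simp
qed

text \<open>
  On a long line the unit pieces cost \<open>D\<close> each, and only the remainder is uncontrolled.
\<close>

lemma line_integral_deviation:
  assumes lb: "line_bounds \<alpha> n A D" and \<alpha>: "\<alpha> \<ge> 4" and \<sigma>: "\<bar>\<sigma>\<bar> \<le> 2 / \<alpha>" and ut: "u \<le> t"
  shows "norm (integral {u..t} (\<lambda>y. pulled_form \<alpha> n (c + \<sigma> * y) y (of_real \<sigma>) 1 - mean_integral \<alpha> n))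
    \<le> (t - u) * D + (norm (mean_integral \<alpha> n) + A)"
proof -
  let ?f = "\<lambda>y. pulled_form \<alpha> n (c + \<sigma> * y) y (of_real \<sigma>) 1"
  let ?J = "mean_integral \<alpha> n"
  note bb = bounded_borel_on_line[of \<alpha> n c \<sigma> "of_real \<sigma>" 1]
  obtain K where K: "\<And>y. norm (?f y) \<le> K" using bounded_borel_bound[OF bb] by blast
  have bb': "bounded_borel (\<lambda>y. ?f y - ?J)"
    using bounded_borel_measurable[OF bb] K
    by (intro bounded_borelI[where K="K + norm ?J"])
       (auto intro: order_trans[OF norm_triangle_ineq4])
  have int: "integral {v..w} (\<lambda>y. ?f y - ?J) = line_integral \<alpha> n c \<sigma> v w - of_real (w - v) * ?J"
    if "v \<le> w" for v w
    using that by (subst integral_diff)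
      (auto simp: line_integral_def scaleR_conv_of_real intro!: bounded_borel_integrable_on bb bounded_borel_const)
  show ?thesis
  proof (rule norm_integral_le_unit_steps[OF bb' _ ut])
    fix v assume "u \<le> v" "v + 1 \<le> t"
    show "norm (integral {v..v + 1} (\<lambda>y. ?f y - ?J)) \<le> D"
      using line_integral_unit_close[OF lb \<alpha> \<sigma>, of c v] by (simp add: int)
  next
    fix v assume v: "u \<le> v" "v \<le> t" "t - v \<le> 1"
    have "norm (line_integral \<alpha> n c \<sigma> v t) \<le> A"
      using line_bounds_short_const[OF lb \<sigma>] v by auto
    moreover have "norm (of_real (t - v) * ?J) \<le> 1 * norm ?J"
      unfolding norm_mult norm_of_real using v by (intro mult_right_mono) auto
    ultimately show "norm (integral {v..t} (\<lambda>y. ?f y - ?J)) \<le> norm ?J + A"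
      unfolding int[OF v(2)] by (intro order_trans[OF norm_triangle_ineq4]) simp
  qed (use line_bounds_nonneg[OF lb] in auto)
qed

lemma line_integral_long:
  assumes lb: "line_bounds \<alpha> n A D" and \<alpha>: "\<alpha> \<ge> 4" and \<sigma>: "\<bar>\<sigma>\<bar> \<le> 2 / \<alpha>" and ut: "u \<le> t"
  shows "norm (line_integral \<alpha> n c \<sigma> u t) \<le> (t - u) * (norm (mean_integral \<alpha> n) + D) + A"
  unfolding line_integral_def
proof (rule norm_integral_le_unit_steps[OF bounded_borel_on_line _ ut], fold line_integral_def)
  fix v
  show "norm (line_integral \<alpha> n c \<sigma> v (v + 1)) \<le> norm (mean_integral \<alpha> n) + D"
    using line_integral_unit_close[OF lb \<alpha> \<sigma>, of c v]
      norm_triangle_sub[of "line_integral \<alpha> n c \<sigma> v (v + 1)" "mean_integral \<alpha> n"] by simp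
qed (use line_bounds_short_const[OF lb \<sigma>] line_bounds_nonneg[OF lb] in auto)

lemma line_integral_long_crude:
  assumes lb: "line_bounds \<alpha> n A D" and \<sigma>: "\<bar>\<sigma>\<bar> \<le> 2 / \<alpha>" and ut: "u \<le> t"
  shows "norm (line_integral \<alpha> n c \<sigma> u t) \<le> (t - u) * A + A"
  unfolding line_integral_def
  by (rule norm_integral_le_unit_steps[OF bounded_borel_on_line _ ut], fold line_integral_def)
     (use line_bounds_short_const[OF lb \<sigma>] line_bounds_nonneg[OF lb] in auto)

lemma line_integral_long_close:
  assumes lb: "line_bounds \<alpha> n A D" and \<sigma>: "\<bar>\<sigma>\<bar> \<le> 2 / \<alpha>" "\<bar>\<sigma>'\<bar> \<le> 2 / \<alpha>" and ut: "u \<le> t" and d: "d \<le> 1"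
    and close: "\<And>y. y \<in> {u..t} \<Longrightarrow> \<bar>(c + \<sigma> * y) - (c' + \<sigma>' * y)\<bar> \<le> d"
  shows "norm (integral {u..t} (\<lambda>y. pulled_form \<alpha> n (c + \<sigma> * y) y (of_real \<sigma>) 1
            - pulled_form \<alpha> n (c' + \<sigma>' * y) y (of_real \<sigma>') 1)) \<le> (t - u) * (D * sqrt d) + D * sqrt d"
proof -
  let ?f = "\<lambda>y. pulled_form \<alpha> n (c + \<sigma> * y) y (of_real \<sigma>) 1"
  let ?g = "\<lambda>y. pulled_form \<alpha> n (c' + \<sigma>' * y) y (of_real \<sigma>') 1"
  note bf = bounded_borel_on_line[of \<alpha> n c \<sigma> "of_real \<sigma>" 1]
  note bg = bounded_borel_on_line[of \<alpha> n c' \<sigma>' "of_real \<sigma>'" 1]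
  obtain K where K: "\<And>y. norm (?f y) \<le> K" using bounded_borel_bound[OF bf] by blast
  obtain L where L: "\<And>y. norm (?g y) \<le> L" using bounded_borel_bound[OF bg] by blast
  have bb': "bounded_borel (\<lambda>y. ?f y - ?g y)"
    using bounded_borel_measurable[OF bf] bounded_borel_measurable[OF bg] K L
    by (intro bounded_borelI[where K="K + L"])
       (auto intro!: order_trans[OF norm_triangle_ineq4] add_mono)
  have int: "integral {v..w} (\<lambda>y. ?f y - ?g y) = line_integral \<alpha> n c \<sigma> v w - line_integral \<alpha> n c' \<sigma>' v w"
    for v w
    by (subst integral_diff) (auto simp: line_integral_def intro!: bounded_borel_integrable_on bf bg)
  have d0: "d \<ge> 0" using close[of u] ut by (meson abs_ge_zero atLeastAtMost_iff order_refl order_trans)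
  show ?thesis
    by (rule norm_integral_le_unit_steps[OF bb' _ ut], unfold int)
       (use line_bounds_nonneg[OF lb] d0 d close in \<open>auto intro!: line_bounds_close[OF lb \<sigma>]\<close>)
qed

text \<open>
  The folds lie at the half-integers, so on each half-unit interval the shear is affine.
\<close>

lemma tent_on_half:
  fixes k :: int
  assumes "y \<in> {of_int k / 2..(of_int k + 1) / 2}" "a \<in> {of_int k / 2..(of_int k + 1) / 2}"
  shows "tent y = tent a + (if even k then - 1 else 1) * (y - a)"
    and "y < (of_int k + 1) / 2 \<Longrightarrow> tent_slope y = (if even k then - 1 else 1)"
proof -
  have *: "tent y = (if even k then of_int k / 2 + 1/2 - y else y - of_int k / 2) \<and>
      (y < (of_int k + 1) / 2 \<longrightarrow> tent_slope y = (if even k then - 1 else 1))"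
    if y: "y \<in> {of_int k / 2..(of_int k + 1) / 2}" for y
  proof (cases "even k")
    case True
    then obtain j where j: "k = 2 * j" by blast
    have "frac y = y - of_int j"
      unfolding frac_unique_iff using y by (auto simp: j)
    then show ?thesis using y True by (auto simp: tent_def tent_slope_def j add_divide_distrib)
  next
    case False
    then obtain j where j: "k = 2 * j + 1" by (rule oddE)
    show ?thesis
    proof (cases "y < of_int j + 1")
      case True
      have "frac y = y - of_int j"
        unfolding frac_unique_iff using y True by (auto simp: j)
      then show ?thesis using y False by (auto simp: tent_def tent_slope_def j add_divide_distrib)
    next
      case F: False
      then have "y = of_int (j + 1)" using y by (simp add: j)
      then show ?thesis using y False by (auto simp: tent_def j field_simps)
    qed
  qed
  show "tent y = tent a + (if even k then - 1 else 1) * (y - a)"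
    using *[OF assms(1)] *[OF assms(2)] by (auto simp: algebra_simps)
  show "y < (of_int k + 1) / 2 \<Longrightarrow> tent_slope y = (if even k then - 1 else 1)"
    using *[OF assms(1)] by blast
qed

text \<open>
  A unit interval meets at most three of the intervals between consecutive half-integers.
\<close>

lemma norm_three_halves:
  fixes Q :: "real \<Rightarrow> real \<Rightarrow> complex"
  assumes add: "\<And>a b c. a \<le> b \<Longrightarrow> b \<le> c \<Longrightarrow> Q a b + Q b c = Q a c"
    and ut: "u \<le> t" "t \<le> u + 1"
    and half: "\<And>(k::int) a b. u \<le> a \<Longrightarrow> a \<le> b \<Longrightarrow> b \<le> t \<Longrightarrow> of_int k / 2 \<le> a \<Longrightarrow> b \<le> (of_int k + 1) / 2
        \<Longrightarrow> norm (Q a b) \<le> K"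
  shows "norm (Q u t) \<le> 3 * K"
proof -
  define k where "k = \<lfloor>2 * u\<rfloor>"
  have k: "of_int k / 2 \<le> u" "u < (of_int k + 1) / 2"
    using floor_correct[of "2 * u"] by (simp_all add: k_def field_simps)
  define p where "p = min t ((of_int k + 1) / 2)"
  define q where "q = min t ((of_int k + 2) / 2)"
  have pq2: "p \<le> q" unfolding p_def q_def by (rule min.mono) simp_all
  have pq1: "u \<le> p" and pq3: "q \<le> t" using ut k by (simp_all add: p_def q_def)
  note pq = pq1 pq2 pq3
  have kk: "real_of_int (k + 1) = of_int k + 1" "real_of_int (k + 2) = of_int k + 2" by simp_all
  have p1: "p \<le> (of_int k + 1) / 2" and q1: "q \<le> (of_int k + 2) / 2"
    unfolding p_def q_def by (rule min.cobounded2)+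
  have p2: "p = t \<and> q = t \<or> p = (of_int k + 1) / 2"
    and q2: "q = t \<or> q = (of_int k + 2) / 2"
    using pq2 pq3 by (auto simp: p_def q_def min_def)
  have q1': "q \<le> (of_int k + 1 + 1) / 2" using q1 by (simp add: add.assoc)
  have k2: "t \<le> (of_int k + 2 + 1) / 2" using ut k by (simp add: field_simps)
  have 1: "norm (Q u p) \<le> K" by (rule half[of u p k]) (use pq ut k p1 in linarith)+
  have 2: "norm (Q p q) \<le> K" using p2
  proof
    assume "p = t \<and> q = t"
    then show ?thesis using pq ut k p1 by (intro half[of p q k]) linarith+
  next
    assume "p = (of_int k + 1) / 2"
    then show ?thesis by (intro half[of p q "k + 1"], unfold kk) (use pq ut k q1' in auto)+
  qed
  have 3: "norm (Q q t) \<le> K"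
  proof (cases "q = t")
    case False
    then have "q = (of_int k + 2) / 2" using q2 by simp
    then show ?thesis by (intro half[of q t "k + 2"], unfold kk) (use pq ut k k2 in auto)+
  next
    case True
    show ?thesis using p2
    proof
      assume "p = t \<and> q = t"
      then show ?thesis using pq ut k p1 by (intro half[of q t k]) linarith+
    next
      assume "p = (of_int k + 1) / 2"
      then show ?thesis using True by (intro half[of q t "k + 1"], unfold kk) (use pq ut k q1' in auto)+
    qed
  qed
  have "Q u t = Q u p + Q p q + Q q t" using add[of u p q] add[of u q t] pq ut by simp
  also have "norm \<dots> \<le> norm (Q u p) + norm (Q p q) + norm (Q q t)"
    by (intro order_trans[OF norm_triangle_ineq] add_mono norm_triangle_ineq) auto
  finally show ?thesis using 1 2 3 by simp
qed

section \<open>One half-step on half-unit intervals\<close>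

lemma twist_affine_derivative:
  "((\<lambda>X. twist (c + \<sigma> * X)) has_vector_derivative of_real \<sigma> * twist' (c + \<sigma> * X)) (at X)"
proof -
  have "((\<lambda>X. c + \<sigma> * X) has_vector_derivative \<sigma>) (at X)"
    by (auto intro!: derivative_eq_intros simp flip: has_real_derivative_iff_has_vector_derivative)
  from vector_diff_chain_at[OF this has_vector_derivative_twist]
  show ?thesis by (simp add: o_def scaleR_conv_of_real)
qed

text \<open>
  A half-unit interval becomes an image of length about $\alpha/2$, over which the twist, taken at the
  preimage, varies by a bounded amount only. Hence it can be removed at the price of a constant.
\<close>

lemma norm_integral_twist_le:
  assumes f: "bounded_borel f" and lh: "lo \<le> hi" and len: "(hi - lo) * \<bar>\<sigma>\<bar> \<le> 1/2"
    and S: "\<And>t. t \<in> {lo..hi} \<Longrightarrow> norm (integral {lo..t} f) \<le> S"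
  shows "norm (integral {lo..hi} (\<lambda>X. twist (c + \<sigma> * X) * f X)) \<le> 5 * S"
proof -
  have "norm (integral {lo..hi} (\<lambda>X. twist (c + \<sigma> * X) * f X))
      \<le> (norm (twist (c + \<sigma> * hi)) + (hi - lo) * (8 * \<bar>\<sigma>\<bar>)) * S"
  proof (rule norm_integral_product_le[OF f lh twist_affine_derivative _ _ S])
    show "continuous_on UNIV (\<lambda>X. of_real \<sigma> * twist' (c + \<sigma> * X))"
      by (intro continuous_intros continuous_on_compose2[OF continuous_on_twist'[of UNIV]]) auto
    show "norm (of_real \<sigma> * twist' (c + \<sigma> * X)) \<le> 8 * \<bar>\<sigma>\<bar>" for X
      using norm_twist'_le[of "c + \<sigma> * X"] mult_left_mono[of _ 8 "\<bar>\<sigma>\<bar>"]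
      by (simp add: norm_mult mult.commute[of 8])
  qed auto
  also have "\<dots> = (1 + 8 * ((hi - lo) * \<bar>\<sigma>\<bar>)) * S" by simp
  also have "\<dots> \<le> 5 * S"
  proof (rule mult_right_mono)
    show "1 + 8 * ((hi - lo) * \<bar>\<sigma>\<bar>) \<le> 5" using len by linarith
    show "0 \<le> S" using order_trans[OF norm_ge_zero S[of lo]] lh by simp
  qed
  finally show ?thesis .
qed

text \<open>
  The integrand on the image of a half-unit interval, as a function of the sheared coordinate
  \<open>X\<close>: the preimage is \<open>c + \<sigma> * X\<close>, and the image is again a line of
  this slope for the form with one half-step less.
\<close>

definition image_integrand :: "real \<Rightarrow> nat \<Rightarrow> real \<Rightarrow> real \<Rightarrow> real \<Rightarrow> complex" where
  "image_integrand \<alpha> n c \<sigma> X = twist (c + \<sigma> * X) * pulled_form \<alpha> n (c + \<sigma> * X) X (of_real \<sigma>) 1"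

lemma bounded_borel_twist_affine: "bounded_borel (\<lambda>X. twist (c + \<sigma> * X))"
proof (rule bounded_borelI[where K=1])
  show "(\<lambda>X. twist (c + \<sigma> * X)) \<in> borel_measurable borel"
    by (intro borel_measurable_continuous_onI continuous_on_compose2[OF continuous_on_twist[of UNIV]]
        continuous_intros) auto
qed simp

lemma bounded_borel_image_integrand: "bounded_borel (image_integrand \<alpha> n c \<sigma>)"
  unfolding image_integrand_def[abs_def]
  by (intro bounded_borel_mult bounded_borel_twist_affine bounded_borel_on_line)

text \<open>
  The substitution $X = c + \sigma y + \alpha\,\mathrm{tent}\,y$, affine with slope \<open>m\<close> on a
  half-unit interval. The form is evaluated on the tangent $(1, m)$ of the image, whose factor
  \<open>m\<close> is absorbed by the substitution; the image line has slope \<open>1 / m\<close>. Its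
  orientation is the sign of \<open>m\<close>.
\<close>

lemma line_integral_Suc_half:
  fixes k :: int
  assumes ab: "a \<le> b" "of_int k / 2 \<le> a" "b \<le> (of_int k + 1) / 2"
    and m: "m = \<sigma> + (if even k then - 1 else 1) * \<alpha>" "m \<noteq> 0"
    and p: "p = c + \<sigma> * a + \<alpha> * tent a - m * a"
  shows "line_integral \<alpha> (Suc n) c \<sigma> a b = of_real (sgn m) *
     integral {min (p + m * a) (p + m * b)..max (p + m * a) (p + m * b)}
       (image_integrand \<alpha> n (- p / m) (1 / m))"
proof -
  let ?s = "if even k then - 1 else 1 :: real"
  have "line_integral \<alpha> (Suc n) c \<sigma> a b
      = integral {a..b} (\<lambda>y. of_real m * image_integrand \<alpha> n (- p / m) (1 / m) (p + m * y))"
    unfolding line_integral_def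
  proof (rule integral_spike[of "{b}"])
    fix y assume y: "y \<in> {a..b} - {b}"
    have h: "y \<in> {of_int k / 2..(of_int k + 1) / 2}" "a \<in> {of_int k / 2..(of_int k + 1) / 2}"
      using y ab by auto
    have t: "tent y = tent a + ?s * (y - a)" "tent_slope y = ?s"
      using tent_on_half(1)[OF h] tent_on_half(2)[OF h] y ab by auto
    have X: "c + \<sigma> * y + \<alpha> * tent y = p + m * y"
      unfolding t p m(1) by (simp add: algebra_simps)
    have inv_eq: "- p / m + 1 / m * (p + m * y) = y" using m(2) by (simp add: field_simps)
    have mm: "of_real \<sigma> + of_real (\<alpha> * tent_slope y) * 1 = complex_of_real m"
      unfolding t m(1) by (simp add: mult.commute)
    have sc: "pulled_form \<alpha> n y (p + m * y) 1 (of_real m)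
        = of_real m * pulled_form \<alpha> n y (p + m * y) (of_real (1 / m)) 1"
      using pulled_form_scale[of \<alpha> n y "p + m * y" "of_real m" "of_real (1 / m)" 1] m(2) by simp
    show "of_real m * image_integrand \<alpha> n (- p / m) (1 / m) (p + m * y)
        = pulled_form \<alpha> (Suc n) (c + \<sigma> * y) y (of_real \<sigma>) 1"
      unfolding pulled_form.simps X mm sc image_integrand_def inv_eq by simp
  qed auto
  also have "\<dots> = of_real m * integral {a..b} (\<lambda>y. image_integrand \<alpha> n (- p / m) (1 / m) (p + m * y))"
    by simp
  also have "\<dots> = of_real (sgn m) *
     integral {min (p + m * a) (p + m * b)..max (p + m * a) (p + m * b)}
       (image_integrand \<alpha> n (- p / m) (1 / m))"
    by (rule integral_affine_subst[OF bounded_borel_image_integrand m(2) ab(1)])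
  finally show ?thesis .
qed

lemma image_slope_bounds:
  fixes \<alpha> \<sigma> m s :: real
  assumes \<alpha>: "\<alpha> \<ge> 4" and \<sigma>: "\<bar>\<sigma>\<bar> \<le> 2 / \<alpha>" and m: "m = \<sigma> + s * \<alpha>" and s: "s = 1 \<or> s = -1"
  shows "\<alpha> / 2 \<le> \<bar>m\<bar>" "\<bar>m\<bar> \<le> 2 * \<alpha>" "m \<noteq> 0" "\<bar>1 / m\<bar> \<le> 2 / \<alpha>" "sgn m = s"
proof -
  have "2 / \<alpha> \<le> 1" using \<alpha> by (simp add: field_simps)
  then have "\<bar>\<sigma>\<bar> \<le> 1" using \<sigma> by simp
  then have b: "- 1 \<le> \<sigma>" "\<sigma> \<le> 1" by simp_all
  show 1: "\<alpha> / 2 \<le> \<bar>m\<bar>" and "\<bar>m\<bar> \<le> 2 * \<alpha>" and "m \<noteq> 0" and "sgn m = s"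
    using b \<alpha> s unfolding m by (auto simp: abs_if sgn_if)
  have "\<bar>1 / m\<bar> = 1 / \<bar>m\<bar>" by simp
  also have "\<dots> \<le> 1 / (\<alpha> / 2)" using 1 \<alpha> by (intro divide_left_mono) auto
  finally show "\<bar>1 / m\<bar> \<le> 2 / \<alpha>" by simp
qed

lemma integral_image_short:
  assumes lb: "line_bounds \<alpha> n A D" and \<alpha>: "\<alpha> \<ge> 4" and \<sigma>: "\<bar>\<sigma>\<bar> \<le> 2 / \<alpha>"
    and uv: "u \<le> v" "v \<le> u + d" and d: "d \<le> 1"
  shows "norm (integral {u..v} (image_integrand \<alpha> n c \<sigma>)) \<le> 5 * (A * sqrt d)"
  unfolding image_integrand_def[abs_def]
proof (rule norm_integral_twist_le[OF bounded_borel_on_line uv(1)])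
  have "2 / \<alpha> \<le> 1/2" using \<alpha> by (simp add: field_simps)
  then have \<sigma>2: "\<bar>\<sigma>\<bar> \<le> 1/2" using \<sigma> by simp
  have "(v - u) * \<bar>\<sigma>\<bar> \<le> 1 * (1/2)" using uv d \<sigma>2 by (intro mult_mono) auto
  then show "(v - u) * \<bar>\<sigma>\<bar> \<le> 1/2" by simp
  fix t assume t: "t \<in> {u..v}"
  have "norm (line_integral \<alpha> n c \<sigma> u t) \<le> A * sqrt (t - u)"
    by (rule line_bounds_short[OF lb \<sigma>]) (use t uv d in auto)
  also have "\<dots> \<le> A * sqrt d"
    using t uv line_bounds_nonneg[OF lb] by (intro mult_left_mono) auto
  finally show "norm (integral {u..t} (\<lambda>X. pulled_form \<alpha> n (c + \<sigma> * X) X (of_real \<sigma>) 1)) \<le> A * sqrt d"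
    by (simp add: line_integral_def)
qed

text \<open>
  The image consists of about $\alpha/2$ unit lines, and all but a bounded number of them contribute
  the mean value, weighted by the twist at the preimage.
\<close>

lemma line_integral_Suc_half_main_term:
  fixes k :: int
  assumes lb: "line_bounds \<alpha> n A D" and \<alpha>: "\<alpha> \<ge> 4" and \<sigma>: "\<bar>\<sigma>\<bar> \<le> 2 / \<alpha>"
    and ab: "a \<le> b" "of_int k / 2 \<le> a" "b \<le> (of_int k + 1) / 2"
  shows "norm (line_integral \<alpha> (Suc n) c \<sigma> a b
      - mean_integral \<alpha> n * (of_real (\<sigma> + (if even k then - 1 else 1) * \<alpha>) * integral {a..b} twist))
    \<le> 5 * (\<alpha> * D + (norm (mean_integral \<alpha> n) + A))"
proof -
  let ?s = "if even k then - 1 else 1 :: real"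
  define m where "m = \<sigma> + ?s * \<alpha>"
  define p where "p = c + \<sigma> * a + \<alpha> * tent a - m * a"
  have s: "?s = 1 \<or> ?s = -1" by simp
  note m = image_slope_bounds[OF \<alpha> \<sigma> m_def s]
  define lo where "lo = min (p + m * a) (p + m * b)"
  define hi where "hi = max (p + m * a) (p + m * b)"
  define c' where "c' = - p / m"
  let ?J = "mean_integral \<alpha> n"
  let ?f = "\<lambda>X. pulled_form \<alpha> n (c' + 1 / m * X) X (of_real (1 / m)) 1"
  have lh: "lo \<le> hi" by (simp add: lo_def hi_def)
  have len: "hi - lo = \<bar>m\<bar> * (b - a)"
  proof -
    have "hi - lo = \<bar>m * b - m * a\<bar>" by (simp add: lo_def hi_def min_def max_def)
    then show ?thesis using ab by (simp add: abs_mult flip: right_diff_distrib)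
  qed
  have ba: "b - a \<le> 1/2" using ab by (simp add: field_simps)
  have bd: "bounded_borel (\<lambda>X. ?f X - ?J)"
    by (intro bounded_borel_diff bounded_borel_on_line bounded_borel_const)
  have D0: "D \<ge> 0" using line_bounds_nonneg[OF lb] by simp
  have "norm (integral {lo..hi} (\<lambda>X. twist (c' + 1 / m * X) * (?f X - ?J)))
      \<le> 5 * (\<alpha> * D + (norm ?J + A))"
  proof (rule norm_integral_twist_le[OF bd lh])
    show "(hi - lo) * \<bar>1 / m\<bar> \<le> 1/2" unfolding len using m(3) ba by simp
    fix t assume t: "t \<in> {lo..hi}"
    have "norm (integral {lo..t} (\<lambda>X. ?f X - ?J)) \<le> (t - lo) * D + (norm ?J + A)"
      by (rule line_integral_deviation[OF lb \<alpha> m(4)]) (use t in auto)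
    also have "(t - lo) * D \<le> \<alpha> * D"
    proof (rule mult_right_mono[OF _ D0])
      have "t - lo \<le> \<bar>m\<bar> * (b - a)" using t len by simp
      also have "\<dots> \<le> 2 * \<alpha> * (1/2)" using m ba ab \<alpha> by (intro mult_mono) auto
      finally show "t - lo \<le> \<alpha>" by simp
    qed
    finally show "norm (integral {lo..t} (\<lambda>X. ?f X - ?J)) \<le> \<alpha> * D + (norm ?J + A)" by simp
  qed
  also have "integral {lo..hi} (\<lambda>X. twist (c' + 1 / m * X) * (?f X - ?J))
      = integral {lo..hi} (image_integrand \<alpha> n c' (1 / m))
        - integral {lo..hi} (\<lambda>X. twist (c' + 1 / m * X)) * ?J"
  proof -
    have 1: "(\<lambda>X. twist (c' + 1 / m * X) * ?f X) integrable_on {lo..hi}"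
      by (intro bounded_borel_integrable_on bounded_borel_mult bounded_borel_twist_affine bounded_borel_on_line)
    have 2: "(\<lambda>X. twist (c' + 1 / m * X) * ?J) integrable_on {lo..hi}"
      by (intro bounded_borel_integrable_on bounded_borel_mult bounded_borel_twist_affine bounded_borel_const)
    show ?thesis
      unfolding right_diff_distrib integral_diff[OF 1 2]
      by (simp only: image_integrand_def[abs_def] integral_mult_left)
  qed
  finally have 1: "norm (integral {lo..hi} (image_integrand \<alpha> n c' (1 / m))
        - integral {lo..hi} (\<lambda>X. twist (c' + 1 / m * X)) * ?J) \<le> 5 * (\<alpha> * D + (norm ?J + A))" .
  have 2: "line_integral \<alpha> (Suc n) c \<sigma> a b = of_real (sgn m) * integral {lo..hi} (image_integrand \<alpha> n c' (1 / m))"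
    unfolding lo_def hi_def c'_def by (rule line_integral_Suc_half[OF ab m_def m(3) p_def])
  have "of_real m * integral {a..b} (\<lambda>y. twist (c' + 1 / m * (p + m * y)))
      = of_real (sgn m) * integral {lo..hi} (\<lambda>X. twist (c' + 1 / m * X))"
    unfolding lo_def hi_def
    by (rule integral_affine_subst[OF bounded_borel_twist_affine m(3) ab(1)])
  moreover have "c' + 1 / m * (p + m * y) = y" for y using m(3) by (simp add: c'_def field_simps)
  ultimately have 3: "of_real m * integral {a..b} twist
      = of_real (sgn m) * integral {lo..hi} (\<lambda>X. twist (c' + 1 / m * X))" by simp
  have "line_integral \<alpha> (Suc n) c \<sigma> a b - ?J * (of_real m * integral {a..b} twist)
      = of_real (sgn m) * (integral {lo..hi} (image_integrand \<alpha> n c' (1 / m))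
        - integral {lo..hi} (\<lambda>X. twist (c' + 1 / m * X)) * ?J)"
    unfolding 2 3 by (simp add: algebra_simps)
  then show ?thesis using 1 m(3) by (simp add: norm_mult abs_sgn_eq m_def[symmetric])
qed

text \<open>
  A short interval with an image of at most unit length is stretched by at most $2\alpha$, which
  costs $\sqrt{2\alpha}$ by the square root in the length estimate. A longer one is compared with the mean.
\<close>

lemma line_integral_Suc_half_bound:
  fixes k :: int
  assumes lb: "line_bounds \<alpha> n A D" and \<alpha>: "\<alpha> \<ge> 4" and \<sigma>: "\<bar>\<sigma>\<bar> \<le> 2 / \<alpha>"
    and ab: "a \<le> b" "of_int k / 2 \<le> a" "b \<le> (of_int k + 1) / 2"
  shows "norm (line_integral \<alpha> (Suc n) c \<sigma> a b)
    \<le> 5 * (2 * \<alpha> * (norm (mean_integral \<alpha> n) + D) + sqrt (2 * \<alpha>) * A) * sqrt (b - a)"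
proof -
  let ?s = "if even k then - 1 else 1 :: real"
  define m where "m = \<sigma> + ?s * \<alpha>"
  define p where "p = c + \<sigma> * a + \<alpha> * tent a - m * a"
  have s: "?s = 1 \<or> ?s = -1" by simp
  note m = image_slope_bounds[OF \<alpha> \<sigma> m_def s]
  define lo where "lo = min (p + m * a) (p + m * b)"
  define hi where "hi = max (p + m * a) (p + m * b)"
  define c' where "c' = - p / m"
  let ?J = "mean_integral \<alpha> n"
  have lh: "lo \<le> hi" by (simp add: lo_def hi_def)
  have len: "hi - lo = \<bar>m\<bar> * (b - a)"
  proof -
    have "hi - lo = \<bar>m * b - m * a\<bar>" by (simp add: lo_def hi_def min_def max_def)
    then show ?thesis using ab by (simp add: abs_mult flip: right_diff_distrib)
  qed
  have ba: "b - a \<le> 1/2" "b - a \<ge> 0" using ab by (simp_all add: field_simps)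
  have A0: "A \<ge> 0" "D \<ge> 0" using line_bounds_nonneg[OF lb] by auto
  let ?S = "(2 * \<alpha> * (norm ?J + D) + sqrt (2 * \<alpha>) * A) * sqrt (b - a)"
  have ba': "b - a \<le> sqrt (b - a)"
    using ba by (intro real_le_rsqrt) (simp add: power2_eq_square mult_left_le)
  have len2: "hi - lo \<le> 2 * \<alpha> * (b - a)" unfolding len using m ba by (intro mult_right_mono) auto
  have t1: "(hi - lo) * (norm ?J + D) \<le> 2 * \<alpha> * (norm ?J + D) * sqrt (b - a)"
  proof -
    have "(hi - lo) * (norm ?J + D) \<le> (2 * \<alpha> * sqrt (b - a)) * (norm ?J + D)"
      using len2 ba' A0 \<alpha> by (intro mult_right_mono order_trans[OF len2] mult_left_mono) auto
    then show ?thesis by (simp only: mult_ac)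
  qed
  have t2: "sqrt (hi - lo) \<le> sqrt (2 * \<alpha>) * sqrt (b - a)"
    using len2 by (simp flip: real_sqrt_mult)
  have "norm (integral {lo..hi} (image_integrand \<alpha> n c' (1 / m))) \<le> 5 * ?S"
    unfolding image_integrand_def[abs_def]
  proof (rule norm_integral_twist_le[OF bounded_borel_on_line lh], fold line_integral_def)
    show "(hi - lo) * \<bar>1 / m\<bar> \<le> 1/2" unfolding len using m(3) ba by simp
    fix t assume t: "t \<in> {lo..hi}"
    show "norm (line_integral \<alpha> n c' (1 / m) lo t) \<le> ?S"
    proof (cases "t - lo \<le> 1")
      case True
      have "norm (line_integral \<alpha> n c' (1 / m) lo t) \<le> A * sqrt (t - lo)"
        using t True by (intro line_bounds_short[OF lb m(4)]) auto
      also have "\<dots> \<le> A * (sqrt (2 * \<alpha>) * sqrt (b - a))"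
        using t by (intro mult_left_mono A0 order_trans[OF _ t2]) auto
      also have "\<dots> \<le> ?S" using A0 \<alpha> ba by (simp add: algebra_simps)
      finally show ?thesis .
    next
      case False
      have "norm (line_integral \<alpha> n c' (1 / m) lo t) \<le> (t - lo) * (norm ?J + D) + A"
        using t by (intro line_integral_long[OF lb \<alpha> m(4)]) auto
      also have "\<dots> \<le> (hi - lo) * (norm ?J + D) + A * sqrt (hi - lo)"
      proof (intro add_mono mult_right_mono)
        have "1 \<le> sqrt (hi - lo)" using False t by simp
        then show "A \<le> A * sqrt (hi - lo)" using A0 mult_left_mono[of 1 _ A] by simp
      qed (use t A0 in auto)
      also have "\<dots> \<le> 2 * \<alpha> * (norm ?J + D) * sqrt (b - a) + A * (sqrt (2 * \<alpha>) * sqrt (b - a))"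
        by (intro add_mono t1 mult_left_mono t2 A0)
      finally show ?thesis by (simp add: algebra_simps)
    qed
  qed
  moreover have "line_integral \<alpha> (Suc n) c \<sigma> a b = of_real (sgn m) * integral {lo..hi} (image_integrand \<alpha> n c' (1 / m))"
    unfolding lo_def hi_def c'_def by (rule line_integral_Suc_half[OF ab m_def m(3) p_def])
  ultimately have "norm (line_integral \<alpha> (Suc n) c \<sigma> a b) \<le> 5 * ?S"
    using m(3) by (simp add: norm_mult abs_sgn_eq)
  then show ?thesis by (simp only: mult.assoc)
qed

lemma norm_integral_change_ends:
  fixes f :: "real \<Rightarrow> complex"
  assumes f: "bounded_borel f" and ord: "lo1 \<le> hi1" "lo2 \<le> hi2"
    and d: "\<bar>lo1 - lo2\<bar> \<le> d" "\<bar>hi1 - hi2\<bar> \<le> d"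
    and K: "\<And>u v. u \<le> v \<Longrightarrow> v \<le> u + d \<Longrightarrow> norm (integral {u..v} f) \<le> K"
  shows "norm (integral {lo1..hi1} f - integral {lo2..hi2} f) \<le> 2 * K"
proof -
  define q where "q = min lo1 lo2"
  define I where "I t = integral {q..t} f" for t
  have I: "integral {u..v} f = I v - I u" if "q \<le> u" "u \<le> v" for u v
    using integral_add_bounded_borel[OF f that] by (simp add: I_def algebra_simps)
  have *: "norm (I v - I u) \<le> K" if "q \<le> u" "q \<le> v" "\<bar>u - v\<bar> \<le> d" for u v
  proof (cases "u \<le> v")
    case True then show ?thesis using K[of u v] I[of u v] that by auto
  next
    case False then show ?thesis using K[of v u] I[of v u] that by (auto simp: norm_minus_commute)
  qed
  have q: "q \<le> lo1" "q \<le> lo2" by (simp_all add: q_def)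
  have "integral {lo1..hi1} f - integral {lo2..hi2} f = (I hi1 - I hi2) - (I lo1 - I lo2)"
    using q ord by (simp add: I)
  also have "norm \<dots> \<le> norm (I hi1 - I hi2) + norm (I lo1 - I lo2)" by (rule norm_triangle_ineq4)
  also have "\<dots> \<le> K + K" using q ord d by (intro add_mono *) auto
  finally show ?thesis by simp
qed

text \<open>
  The images of two lines at distance \<open>d\<close> are two lines at distance at most $2d/\alpha$ on a
  common range, up to ends of length at most \<open>d\<close>. The difference of the integrals splits
  into three parts: the difference of the forms on the common range, which gains the square root of
  the contraction on each of about $\alpha$ unit pieces; the difference of the twists, which is
  $O(d/\alpha)$ together with its total variation; and the ends, handled by the length estimate.
\<close>

lemma line_integral_Suc_half_close:
  fixes k :: int
  assumes lb: "line_bounds \<alpha> n A D" and \<alpha>: "\<alpha> \<ge> 4"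
    and \<sigma>: "\<bar>\<sigma>1\<bar> \<le> 2 / \<alpha>" "\<bar>\<sigma>2\<bar> \<le> 2 / \<alpha>"
    and ab: "a \<le> b" "of_int k / 2 \<le> a" "b \<le> (of_int k + 1) / 2" and d: "d \<le> 1"
    and close: "\<And>y. y \<in> {a..b} \<Longrightarrow> \<bar>(c1 + \<sigma>1 * y) - (c2 + \<sigma>2 * y)\<bar> \<le> d"
  shows "norm (line_integral \<alpha> (Suc n) c1 \<sigma>1 a b - line_integral \<alpha> (Suc n) c2 \<sigma>2 a b)
    \<le> (1130 * A + 15 * sqrt \<alpha> * D) * sqrt d"
proof -
  let ?s = "if even k then - 1 else 1 :: real"
  define m1 where "m1 = \<sigma>1 + ?s * \<alpha>"
  define m2 where "m2 = \<sigma>2 + ?s * \<alpha>"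
  define p1 where "p1 = c1 + \<sigma>1 * a + \<alpha> * tent a - m1 * a"
  define p2 where "p2 = c2 + \<sigma>2 * a + \<alpha> * tent a - m2 * a"
  have s: "?s = 1 \<or> ?s = -1" by simp
  note m1 = image_slope_bounds[OF \<alpha> \<sigma>(1) m1_def s]
  note m2 = image_slope_bounds[OF \<alpha> \<sigma>(2) m2_def s]
  have A0: "A \<ge> 0" "D \<ge> 0" using line_bounds_nonneg[OF lb] by auto
  have d0: "d \<ge> 0" using close[of a] ab by auto
  have dsq: "d \<le> sqrt d" using d0 d by (intro real_le_rsqrt) (simp add: power2_eq_square mult_left_le)
  define lo1 where "lo1 = min (p1 + m1 * a) (p1 + m1 * b)"
  define hi1 where "hi1 = max (p1 + m1 * a) (p1 + m1 * b)"
  define lo2 where "lo2 = min (p2 + m2 * a) (p2 + m2 * b)"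
  define hi2 where "hi2 = max (p2 + m2 * a) (p2 + m2 * b)"
  have lh1: "lo1 \<le> hi1" and lh2: "lo2 \<le> hi2" by (simp_all add: lo1_def hi1_def lo2_def hi2_def)
  have ba: "b - a \<le> 1/2" "b - a \<ge> 0" using ab by (simp_all add: field_simps)
  have len1: "hi1 - lo1 = \<bar>m1\<bar> * (b - a)"
  proof -
    have "hi1 - lo1 = \<bar>m1 * b - m1 * a\<bar>" by (simp add: lo1_def hi1_def min_def max_def)
    then show ?thesis using ab by (simp add: abs_mult flip: right_diff_distrib)
  qed
  have len1\<alpha>: "hi1 - lo1 \<le> \<alpha>"
  proof -
    have "\<bar>m1\<bar> * (b - a) \<le> 2 * \<alpha> * (1/2)" using m1 ba \<alpha> by (intro mult_mono) auto
    then show ?thesis unfolding len1 by simp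
  qed
  have X: "\<bar>(p1 + m1 * y) - (p2 + m2 * y)\<bar> \<le> d" if "y \<in> {a..b}" for y
  proof -
    have "(p1 + m1 * y) - (p2 + m2 * y) = (c1 + \<sigma>1 * y) - (c2 + \<sigma>2 * y)"
      by (simp add: p1_def p2_def m1_def m2_def algebra_simps)
    then show ?thesis using close[OF that] by simp
  qed
  have ends: "\<bar>lo1 - lo2\<bar> \<le> d" "\<bar>hi1 - hi2\<bar> \<le> d"
    using X[of a] X[of b] ab by (auto simp: lo1_def lo2_def hi1_def hi2_def min_def max_def abs_le_iff)
  define c1' where "c1' = - p1 / m1"
  define c2' where "c2' = - p2 / m2"
  define y1 where "y1 X = c1' + 1 / m1 * X" for X
  define y2 where "y2 X = c2' + 1 / m2 * X" for X
  have \<alpha>2: "2 * d / \<alpha> \<le> 1" using d d0 \<alpha> by (simp add: field_simps)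
  have y12: "\<bar>y1 X - y2 X\<bar> \<le> 2 * d / \<alpha>" if X0: "X \<in> {lo1..hi1}" for X
  proof -
    have y1m: "m1 * y1 X = X - p1" and y2m: "m2 * y2 X = X - p2"
      using m1(3) m2(3) by (simp_all add: y1_def y2_def c1'_def c2'_def field_simps)
    have "y1 X \<in> {a..b}"
    proof (cases "m1 > 0")
      case True
      then have mono: "m1 * a \<le> m1 * b" using ab by simp
      then have "m1 * a \<le> m1 * y1 X" "m1 * y1 X \<le> m1 * b"
        using X0 unfolding y1m lo1_def hi1_def by auto
      then show ?thesis using True by simp
    next
      case False
      then have neg: "m1 < 0" using m1(3) by simp
      then have "m1 * b \<le> m1 * a" using ab by simp
      then have "m1 * b \<le> m1 * y1 X" "m1 * y1 X \<le> m1 * a"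
        using X0 unfolding y1m lo1_def hi1_def by auto
      then show ?thesis using neg by simp
    qed
    then have "\<bar>m2 * (y1 X - y2 X)\<bar> \<le> d"
      using X[of "y1 X"] y1m y2m by (simp add: algebra_simps abs_minus_commute)
    then have "\<bar>y1 X - y2 X\<bar> \<le> d / \<bar>m2\<bar>"
      using m2(3) unfolding abs_mult by (simp add: pos_le_divide_eq mult.commute)
    also have "\<dots> \<le> d / (\<alpha> / 2)" using m2(1) d0 \<alpha> by (intro divide_left_mono) auto
    finally show ?thesis by (simp add: mult.commute)
  qed
  let ?F1 = "image_integrand \<alpha> n c1' (1 / m1)" and ?F2 = "image_integrand \<alpha> n c2' (1 / m2)"
  let ?f1 = "\<lambda>X. pulled_form \<alpha> n (y1 X) X (of_real (1 / m1)) 1"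
  let ?f2 = "\<lambda>X. pulled_form \<alpha> n (y2 X) X (of_real (1 / m2)) 1"
  have F1: "?F1 X = twist (y1 X) * ?f1 X" and F2: "?F2 X = twist (y2 X) * ?f2 X" for X
    by (simp_all add: image_integrand_def y1_def y2_def)
  have bf1: "bounded_borel ?f1" and bf2: "bounded_borel ?f2"
    unfolding y1_def y2_def by (rule bounded_borel_on_line)+
  have bt1: "bounded_borel (\<lambda>X. twist (y1 X))" and bt2: "bounded_borel (\<lambda>X. twist (y2 X))"
    unfolding y1_def y2_def by (rule bounded_borel_twist_affine)+
  note bb = bf1 bf2 bt1 bt2 bounded_borel_mult bounded_borel_diff
  have "norm (integral {lo1..hi1} (\<lambda>X. twist (y1 X) * (?f1 X - ?f2 X))) \<le> 5 * (2 * \<alpha> * (D * sqrt (2 * d / \<alpha>)))"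
    unfolding y1_def
  proof (rule norm_integral_twist_le[OF bounded_borel_diff[OF bf1 bf2, unfolded y1_def] lh1])
    show "(hi1 - lo1) * \<bar>1 / m1\<bar> \<le> 1/2" unfolding len1 using m1(3) ba by simp
    fix t assume t: "t \<in> {lo1..hi1}"
    have "norm (integral {lo1..t} (\<lambda>X. pulled_form \<alpha> n (c1' + 1 / m1 * X) X (of_real (1 / m1)) 1 - ?f2 X))
      \<le> (t - lo1) * (D * sqrt (2 * d / \<alpha>)) + D * sqrt (2 * d / \<alpha>)"
      unfolding y2_def
      by (rule line_integral_long_close[OF lb m1(4) m2(4)])
         (use t \<alpha>2 y12 in \<open>auto simp: y1_def y2_def\<close>)
    also have "\<dots> = (t - lo1 + 1) * (D * sqrt (2 * d / \<alpha>))" by (simp add: algebra_simps)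
    also have "\<dots> \<le> 2 * \<alpha> * (D * sqrt (2 * d / \<alpha>))"
      using t len1\<alpha> \<alpha> A0 d0 by (intro mult_right_mono) auto
    finally show "norm (integral {lo1..t} (\<lambda>X. pulled_form \<alpha> n (c1' + 1 / m1 * X) X (of_real (1 / m1)) 1 - ?f2 X))
      \<le> 2 * \<alpha> * (D * sqrt (2 * d / \<alpha>))" .
  qed
  also have "\<dots> = 10 * sqrt 2 * sqrt \<alpha> * D * sqrt d"
  proof -
    have "\<alpha> * sqrt (2 * d / \<alpha>) = sqrt 2 * sqrt d * (\<alpha> / sqrt \<alpha>)"
      by (simp add: real_sqrt_divide real_sqrt_mult)
    then show ?thesis using \<alpha> by (simp add: real_div_sqrt algebra_simps)
  qed
  also have "\<dots> \<le> 15 * sqrt \<alpha> * D * sqrt d"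
  proof -
    have "sqrt 2 \<le> (3/2::real)" by (rule real_le_lsqrt) (auto simp: power2_eq_square)
    then show ?thesis using A0 \<alpha> d0 by (intro mult_right_mono) auto
  qed
  finally have I1: "norm (integral {lo1..hi1} (\<lambda>X. twist (y1 X) * (?f1 X - ?f2 X))) \<le> 15 * sqrt \<alpha> * D * sqrt d" .
  \<comment> \<open>bound for the derivative of the difference of the twists; the slopes of the image lines differ, too\<close>
  define Kd where "Kd = 512 * d / \<alpha>\<^sup>2 + 8 * \<bar>1 / m1 - 1 / m2\<bar>"
  have "norm (integral {lo1..hi1} (\<lambda>X. (twist (y1 X) - twist (y2 X)) * ?f2 X))
     \<le> (norm (twist (y1 hi1) - twist (y2 hi1)) + (hi1 - lo1) * Kd) * (2 * \<alpha> * A)"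
  proof (rule norm_integral_product_le[OF bf2 lh1])
    show "((\<lambda>X. twist (y1 X) - twist (y2 X)) has_vector_derivative
        of_real (1 / m1) * twist' (y1 X) - of_real (1 / m2) * twist' (y2 X)) (at X)" for X
      unfolding y1_def y2_def by (intro has_vector_derivative_diff twist_affine_derivative)
    show "continuous_on UNIV (\<lambda>X. of_real (1 / m1) * twist' (y1 X) - of_real (1 / m2) * twist' (y2 X))"
      unfolding y1_def y2_def
      by (intro continuous_intros continuous_on_compose2[OF continuous_on_twist'[of UNIV]]) auto
    fix X assume X0: "X \<in> {lo1..hi1}"
    have "of_real (1 / m1) * twist' (y1 X) - of_real (1 / m2) * twist' (y2 X)
        = of_real (1 / m2) * (twist' (y1 X) - twist' (y2 X)) + of_real (1 / m1 - 1 / m2) * twist' (y1 X)"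
      unfolding of_real_diff by (simp only: algebra_simps)
    also have "norm \<dots> \<le> \<bar>1 / m2\<bar> * norm (twist' (y1 X) - twist' (y2 X)) + \<bar>1 / m1 - 1 / m2\<bar> * norm (twist' (y1 X))"
      by (rule order_trans[OF norm_triangle_ineq]) (simp only: norm_mult norm_of_real order_refl)
    also have "\<dots> \<le> 2 / \<alpha> * (128 * (2 * d / \<alpha>)) + \<bar>1 / m1 - 1 / m2\<bar> * 8"
      using \<alpha> norm_twist'_diff_le[of "y1 X" "y2 X"] y12[OF X0]
      by (intro add_mono mult_mono m2(4) norm_twist'_le order_trans[OF norm_twist'_diff_le] mult_left_mono) auto
    also have "\<dots> = Kd" by (simp add: Kd_def power2_eq_square)
    finally show "norm (of_real (1 / m1) * twist' (y1 X) - of_real (1 / m2) * twist' (y2 X)) \<le> Kd" .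
  next
    fix t assume t: "t \<in> {lo1..hi1}"
    have "norm (integral {lo1..t} ?f2) \<le> (t - lo1) * A + A"
      using line_integral_long_crude[OF lb m2(4), of lo1 t c2'] t by (simp add: line_integral_def y2_def)
    also have "\<dots> = (t - lo1 + 1) * A" by (simp add: algebra_simps)
    also have "\<dots> \<le> 2 * \<alpha> * A" using t len1\<alpha> \<alpha> A0 by (intro mult_right_mono) auto
    finally show "norm (integral {lo1..t} ?f2) \<le> 2 * \<alpha> * A" .
  qed
  also have "\<dots> \<le> (560 * d / \<alpha>) * (2 * \<alpha> * A)"
  proof (rule mult_right_mono)
    have e1: "norm (twist (y1 hi1) - twist (y2 hi1)) \<le> 8 * (2 * d / \<alpha>)"
      using y12[of hi1] lh1 by (intro order_trans[OF norm_twist_diff_le] mult_left_mono) auto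
    have e2: "(hi1 - lo1) * (512 * d / \<alpha>\<^sup>2) \<le> \<alpha> * (512 * d / \<alpha>\<^sup>2)"
      using len1\<alpha> d0 by (intro mult_right_mono) auto
    \<comment> \<open>the slopes of two lines that stay close over length \<open>b - a\<close> differ by at most \<open>2 * d / (b - a)\<close>\<close>
    have e3: "(hi1 - lo1) * \<bar>1 / m1 - 1 / m2\<bar> \<le> 4 * d / \<alpha>"
    proof -
      have "1 / m1 - 1 / m2 = (\<sigma>2 - \<sigma>1) / (m1 * m2)"
        using m1(3) m2(3) unfolding m1_def m2_def by (simp add: field_simps)
      then have "(hi1 - lo1) * \<bar>1 / m1 - 1 / m2\<bar> = ((b - a) * \<bar>\<sigma>2 - \<sigma>1\<bar>) * \<bar>1 / m2\<bar>"
        unfolding len1 using m1(3) by (simp add: abs_mult)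
      also have "(b - a) * \<bar>\<sigma>2 - \<sigma>1\<bar> = \<bar>((c1 + \<sigma>1 * a) - (c2 + \<sigma>2 * a)) - ((c1 + \<sigma>1 * b) - (c2 + \<sigma>2 * b))\<bar>"
      proof -
        have "((c1 + \<sigma>1 * a) - (c2 + \<sigma>2 * a)) - ((c1 + \<sigma>1 * b) - (c2 + \<sigma>2 * b)) = (b - a) * (\<sigma>2 - \<sigma>1)"
          by (simp add: algebra_simps)
        then show ?thesis using ba by (simp add: abs_mult)
      qed
      also have "\<dots> * \<bar>1 / m2\<bar> \<le> (d + d) * (2 / \<alpha>)"
        using close[of a] close[of b] ab d0 m2(4) by (intro mult_mono) auto
      finally show ?thesis by simp
    qed
    have "norm (twist (y1 hi1) - twist (y2 hi1)) + (hi1 - lo1) * Kd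
      \<le> 8 * (2 * d / \<alpha>) + \<alpha> * (512 * d / \<alpha>\<^sup>2) + 8 * (4 * d / \<alpha>)"
    proof -
      have "(hi1 - lo1) * Kd = (hi1 - lo1) * (512 * d / \<alpha>\<^sup>2) + 8 * ((hi1 - lo1) * \<bar>1 / m1 - 1 / m2\<bar>)"
        unfolding Kd_def distrib_left by simp
      then show ?thesis using e1 e2 e3 by linarith
    qed
    also have "\<dots> = 560 * d / \<alpha>" using \<alpha> by (simp add: power2_eq_square field_simps)
    finally show "norm (twist (y1 hi1) - twist (y2 hi1)) + (hi1 - lo1) * Kd \<le> 560 * d / \<alpha>" .
  qed (use A0 \<alpha> in auto)
  also have "\<dots> = 1120 * A * d" using \<alpha> by simp
  also have "\<dots> \<le> 1120 * A * sqrt d" using dsq A0 by (intro mult_left_mono) auto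
  finally have I2: "norm (integral {lo1..hi1} (\<lambda>X. (twist (y1 X) - twist (y2 X)) * ?f2 X)) \<le> 1120 * A * sqrt d" .
  have I3: "norm (integral {lo1..hi1} ?F2 - integral {lo2..hi2} ?F2) \<le> 2 * (5 * (A * sqrt d))"
    by (rule norm_integral_change_ends[OF bounded_borel_image_integrand lh1 lh2 ends])
       (rule integral_image_short[OF lb \<alpha> m2(4) _ _ d])
  have "integral {lo1..hi1} ?F1 = integral {lo1..hi1} (\<lambda>X. twist (y1 X) * (?f1 X - ?f2 X)
      + (twist (y1 X) - twist (y2 X)) * ?f2 X + ?F2 X)"
    by (rule arg_cong[where f="integral _"], rule ext) (simp add: F1 F2 algebra_simps)
  also have "\<dots> = integral {lo1..hi1} (\<lambda>X. twist (y1 X) * (?f1 X - ?f2 X))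
      + integral {lo1..hi1} (\<lambda>X. (twist (y1 X) - twist (y2 X)) * ?f2 X) + integral {lo1..hi1} ?F2"
  proof -
    have 1: "(\<lambda>X. twist (y1 X) * (?f1 X - ?f2 X)) integrable_on {lo1..hi1}"
      by (intro bounded_borel_integrable_on bb)
    have 2: "(\<lambda>X. (twist (y1 X) - twist (y2 X)) * ?f2 X) integrable_on {lo1..hi1}"
      by (intro bounded_borel_integrable_on bb)
    have 3: "?F2 integrable_on {lo1..hi1}"
      by (intro bounded_borel_integrable_on bounded_borel_image_integrand)
    show ?thesis
      by (simp only: Henstock_Kurzweil_Integration.integral_add[OF integrable_add[OF 1 2] 3]
          Henstock_Kurzweil_Integration.integral_add[OF 1 2])
  qed
  finally have dec: "integral {lo1..hi1} ?F1 - integral {lo2..hi2} ?F2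
      = integral {lo1..hi1} (\<lambda>X. twist (y1 X) * (?f1 X - ?f2 X))
      + integral {lo1..hi1} (\<lambda>X. (twist (y1 X) - twist (y2 X)) * ?f2 X)
      + (integral {lo1..hi1} ?F2 - integral {lo2..hi2} ?F2)" by simp
  have LI1: "line_integral \<alpha> (Suc n) c1 \<sigma>1 a b = of_real ?s * integral {lo1..hi1} ?F1"
    using line_integral_Suc_half[OF ab m1_def m1(3) p1_def, of n]
    unfolding lo1_def hi1_def c1'_def m1(5) .
  have LI2: "line_integral \<alpha> (Suc n) c2 \<sigma>2 a b = of_real ?s * integral {lo2..hi2} ?F2"
    using line_integral_Suc_half[OF ab m2_def m2(3) p2_def, of n]
    unfolding lo2_def hi2_def c2'_def m2(5) .
  have "norm (line_integral \<alpha> (Suc n) c1 \<sigma>1 a b - line_integral \<alpha> (Suc n) c2 \<sigma>2 a b)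
      = norm (integral {lo1..hi1} ?F1 - integral {lo2..hi2} ?F2)"
    unfolding LI1 LI2 right_diff_distrib[symmetric] norm_mult norm_of_real by simp
  also have "\<dots> \<le> 15 * sqrt \<alpha> * D * sqrt d + 1120 * A * sqrt d + 2 * (5 * (A * sqrt d))"
    unfolding dec
    by (rule order_trans[OF norm_triangle_ineq], rule add_mono[OF _ I3],
        rule order_trans[OF norm_triangle_ineq], rule add_mono[OF I1 I2])
  also have "\<dots> = (1130 * A + 15 * sqrt \<alpha> * D) * sqrt d" by (simp add: algebra_simps)
  finally show ?thesis .
qed

section \<open>Exponential growth of the mean line integral\<close>

text \<open>
  The integral of slope sign times twist over a period: the slope of the tent is $-1$ on
  $[0,1/2)$ and $1$ on $[1/2,1)$.
\<close>

definition twist_bias :: complex where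
  "twist_bias = integral {1/2..1} twist - integral {0..1/2} twist"

text \<open>
  Both estimates follow by adding up at most three half-unit pieces. For the recursion of the mean the
  slope is $0$, so the main terms of the two halves of the unit circle have slopes $-\alpha$ and
  $\alpha$ exactly and combine to the bias.
\<close>

lemma line_bounds_Suc:
  assumes lb: "line_bounds \<alpha> n A D" and \<alpha>: "\<alpha> \<ge> 4"
  shows "line_bounds \<alpha> (Suc n) (15 * (2 * \<alpha> * (norm (mean_integral \<alpha> n) + D) + sqrt (2 * \<alpha>) * A))
           (3 * (1130 * A + 15 * sqrt \<alpha> * D))"
    and "norm (mean_integral \<alpha> (Suc n) - of_real \<alpha> * twist_bias * mean_integral \<alpha> n)
      \<le> 10 * (\<alpha> * D + (norm (mean_integral \<alpha> n) + A))"
proof -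
  let ?J = "mean_integral \<alpha> n"
  have A0: "A \<ge> 0" "D \<ge> 0" using line_bounds_nonneg[OF lb] by auto
  define A' where "A' = 2 * \<alpha> * (norm ?J + D) + sqrt (2 * \<alpha>) * A"
  define D' where "D' = 1130 * A + 15 * sqrt \<alpha> * D"
  have A'0: "A' \<ge> 0" and D'0: "D' \<ge> 0" using A0 \<alpha> by (simp_all add: A'_def D'_def)
  have 1: "norm (line_integral \<alpha> (Suc n) c \<sigma> a b) \<le> 15 * A' * sqrt (b - a)"
    if \<sigma>: "\<bar>\<sigma>\<bar> \<le> 2 / \<alpha>" and ab: "a \<le> b" "b \<le> a + 1" for c \<sigma> a b
  proof -
    have "norm (line_integral \<alpha> (Suc n) c \<sigma> a b) \<le> 3 * (5 * A' * sqrt (b - a))"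
    proof (rule norm_three_halves[OF line_integral_split ab])
      fix k u v assume uv: "a \<le> u" "u \<le> v" "v \<le> b" "of_int k / 2 \<le> u" "v \<le> (of_int k + 1) / 2"
      have "norm (line_integral \<alpha> (Suc n) c \<sigma> u v) \<le> 5 * A' * sqrt (v - u)"
        unfolding A'_def by (rule line_integral_Suc_half_bound[OF lb \<alpha> \<sigma> uv(2,4,5)])
      also have "\<dots> \<le> 5 * A' * sqrt (b - a)" using uv A'0 by (intro mult_left_mono) auto
      finally show "norm (line_integral \<alpha> (Suc n) c \<sigma> u v) \<le> 5 * A' * sqrt (b - a)" .
    qed
    then show ?thesis by simp
  qed
  have 2: "norm (line_integral \<alpha> (Suc n) c \<sigma> a b - line_integral \<alpha> (Suc n) c' \<sigma>' a b) \<le> 3 * D' * sqrt d"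
    if \<sigma>: "\<bar>\<sigma>\<bar> \<le> 2 / \<alpha>" "\<bar>\<sigma>'\<bar> \<le> 2 / \<alpha>" and ab: "a \<le> b" "b \<le> a + 1" and d: "d \<le> 1"
      and cl: "\<forall>y\<in>{a..b}. \<bar>(c + \<sigma> * y) - (c' + \<sigma>' * y)\<bar> \<le> d" for c \<sigma> c' \<sigma>' a b d
  proof -
    have "norm (line_integral \<alpha> (Suc n) c \<sigma> a b - line_integral \<alpha> (Suc n) c' \<sigma>' a b) \<le> 3 * (D' * sqrt d)"
    proof (rule norm_three_halves[where Q="\<lambda>a b. line_integral \<alpha> (Suc n) c \<sigma> a b - line_integral \<alpha> (Suc n) c' \<sigma>' a b", OF _ ab])
      show "line_integral \<alpha> (Suc n) c \<sigma> a b - line_integral \<alpha> (Suc n) c' \<sigma>' a b +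
        (line_integral \<alpha> (Suc n) c \<sigma> b e - line_integral \<alpha> (Suc n) c' \<sigma>' b e)
        = line_integral \<alpha> (Suc n) c \<sigma> a e - line_integral \<alpha> (Suc n) c' \<sigma>' a e"
        if "a \<le> b" "b \<le> e" for a b e
        using line_integral_split[OF that, of \<alpha> "Suc n" c \<sigma>] line_integral_split[OF that, of \<alpha> "Suc n" c' \<sigma>']
        by (simp add: algebra_simps)
      fix k u v assume uv: "a \<le> u" "u \<le> v" "v \<le> b" "of_int k / 2 \<le> u" "v \<le> (of_int k + 1) / 2"
      show "norm (line_integral \<alpha> (Suc n) c \<sigma> u v - line_integral \<alpha> (Suc n) c' \<sigma>' u v) \<le> D' * sqrt d"
        unfolding D'_def by (rule line_integral_Suc_half_close[OF lb \<alpha> \<sigma> uv(2,4,5) d]) (use cl uv in auto)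
    qed
    then show ?thesis by simp
  qed
  show "line_bounds \<alpha> (Suc n) (15 * (2 * \<alpha> * (norm ?J + D) + sqrt (2 * \<alpha>) * A))
           (3 * (1130 * A + 15 * sqrt \<alpha> * D))"
    unfolding A'_def[symmetric] D'_def[symmetric] line_bounds_def
    using 1 2 A'0 D'0 by (simp add: mult.assoc)
  have 3: "norm (line_integral \<alpha> (Suc n) 0 0 0 (1/2) - ?J * (of_real (- \<alpha>) * integral {0..1/2} twist))
      \<le> 5 * (\<alpha> * D + (norm ?J + A))"
    using line_integral_Suc_half_main_term[OF lb \<alpha>, of 0 0 "1/2" 0 0] \<alpha> by simp
  have 4: "norm (line_integral \<alpha> (Suc n) 0 0 (1/2) 1 - ?J * (of_real \<alpha> * integral {1/2..1} twist))
      \<le> 5 * (\<alpha> * D + (norm ?J + A))"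
    using line_integral_Suc_half_main_term[OF lb \<alpha>, of 0 "1/2" 1 1 0] \<alpha> by simp
  have "mean_integral \<alpha> (Suc n) = line_integral \<alpha> (Suc n) 0 0 0 (1/2) + line_integral \<alpha> (Suc n) 0 0 (1/2) 1"
    unfolding mean_integral_def by (rule line_integral_split[symmetric]) auto
  then have "mean_integral \<alpha> (Suc n) - of_real \<alpha> * twist_bias * ?J
     = (line_integral \<alpha> (Suc n) 0 0 0 (1/2) - ?J * (of_real (- \<alpha>) * integral {0..1/2} twist))
      + (line_integral \<alpha> (Suc n) 0 0 (1/2) 1 - ?J * (of_real \<alpha> * integral {1/2..1} twist))"
    by (simp add: twist_bias_def algebra_simps)
  also have "norm \<dots> \<le> 5 * (\<alpha> * D + (norm ?J + A)) + 5 * (\<alpha> * D + (norm ?J + A))"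
    by (rule order_trans[OF norm_triangle_ineq add_mono[OF 3 4]])
  also have "\<dots> = 10 * (\<alpha> * D + (norm ?J + A))" by (simp add: algebra_simps)
  finally show "norm (mean_integral \<alpha> (Suc n) - of_real \<alpha> * twist_bias * ?J)
      \<le> 10 * (\<alpha> * D + (norm ?J + A))" .
qed

text \<open>
  The imaginary part of the twist is $\sin(\sin 2\pi y)$, positive on the first half of the period and
  negative on the second.
\<close>

lemma twist_bias_nonzero: "twist_bias \<noteq> 0"
proof
  assume z: "twist_bias = 0"
  define f where "f y = sin (sin (2 * pi * y))" for y :: real
  have f: "Im (integral {a..b} twist) = integral {a..b} f" for a b
  proof -
    have "twist integrable_on {a..b}" by (intro integrable_continuous_real continuous_on_twist)
    from integral_linear[OF this bounded_linear_Im]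
    show ?thesis by (simp add: o_def f_def[abs_def] twist_def)
  qed
  have cont: "continuous_on A f" for A unfolding f_def by (intro continuous_intros)
  have int: "f integrable_on {a..b}" for a b by (intro integrable_continuous_real cont)
  have lower: "0 \<le> f y" if "y \<in> {0..1/2}" for y
  proof -
    have "2 * pi * y \<le> 2 * pi * (1/2)" using that by (intro mult_left_mono) auto
    then have "0 \<le> sin (2 * pi * y)" using that by (intro sin_ge_zero) auto
    moreover have "sin (2 * pi * y) \<le> pi" using sin_le_one[of "2 * pi * y"] pi_gt3 by linarith
    ultimately show ?thesis unfolding f_def by (rule sin_ge_zero)
  qed
  have upper: "f y \<le> 0" if "y \<in> {1/2..1}" for y
  proof -
    have "2 * pi * (y - 1/2) \<le> 2 * pi * (1/2)" using that by (intro mult_left_mono) auto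
    then have "0 \<le> sin (2 * pi * (y - 1/2))" using that by (intro sin_ge_zero) auto
    also have "2 * pi * (y - 1/2) = 2 * pi * y - pi" by (simp add: algebra_simps)
    finally have s: "sin (2 * pi * y) \<le> 0" by simp
    moreover have "- sin (2 * pi * y) \<le> pi" using sin_ge_minus_one[of "2 * pi * y"] pi_gt3 by linarith
    ultimately have "0 \<le> sin (- sin (2 * pi * y))" by (intro sin_ge_zero) simp_all
    then show ?thesis by (simp add: f_def)
  qed
  have "Im twist_bias = integral {1/2..1} f - integral {0..1/2} f" by (simp add: twist_bias_def f)
  moreover have "integral {1/2..1} f \<le> integral {1/2..1::real} (\<lambda>y. 0 :: real)"
    by (rule Henstock_Kurzweil_Integration.integral_le[OF int]) (use upper in auto)
  moreover have "0 \<le> integral {0..1/2} f" by (rule integral_nonneg[OF int lower])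
  ultimately have "integral {0..1/2} f = 0" using z by simp
  then have "\<forall>x\<in>{0..1/2}. f x = 0"
    using integral_eq_0_iff[OF cont, of 0 "1/2"] lower by auto
  then have "f (1/4) = 0" by auto
  moreover have "f (1/4) > 0" using pi_gt3 by (auto simp: f_def intro!: sin_gt_zero)
  ultimately show False by simp
qed

text \<open>
  The real part of the twist is $\cos(\sin 2\pi y) \ge \cos 1 \ge 1/2$.
\<close>

lemma mean_integral_0: "norm (mean_integral \<alpha> 0) \<ge> 1/2"
proof -
  define f where "f y = cos (sin (2 * pi * y))" for y :: real
  have f: "Re (integral {0..1} twist) = integral {0..1} f"
  proof -
    have "twist integrable_on {0..1}" by (intro integrable_continuous_real continuous_on_twist)
    from integral_linear[OF this bounded_linear_Re]
    show ?thesis by (simp add: o_def f_def[abs_def] twist_def)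
  qed
  have half: "1/2 \<le> f y" for y
  proof -
    define x where "x = sin (2 * pi * y)"
    have "\<bar>sin (x / 2)\<bar> \<le> \<bar>x / 2\<bar>" by (rule abs_sin_x_le_abs_x)
    also have "\<dots> \<le> 1/2" using abs_sin_le_one[of "2 * pi * y"] by (simp add: x_def)
    finally have "(sin (x / 2))\<^sup>2 \<le> (1/2)\<^sup>2" by (intro abs_le_square_iff[THEN iffD1]) simp
    then show ?thesis using cos_double_sin[of "x / 2"] by (simp add: f_def x_def[symmetric] power2_eq_square)
  qed
  have "integral {0..1::real} (\<lambda>y. 1/2 :: real) \<le> integral {0..1} f"
    by (rule Henstock_Kurzweil_Integration.integral_le) (use half in \<open>auto intro!: integrable_continuous_real continuous_intros simp: f_def\<close>)
  then have "1/2 \<le> Re (integral {0..1} twist)" by (simp add: f)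
  also have "\<dots> \<le> norm (integral {0..1} twist)" by (rule complex_Re_le_cmod)
  finally show ?thesis by (simp add: mean_integral_def line_integral_def)
qed

lemma line_bounds_0: "line_bounds \<alpha> 0 1 0"
proof -
  have "norm (integral {a..b} twist) \<le> sqrt (b - a)" if ab: "a \<le> b" "b \<le> a + 1" for a b
  proof -
    have "norm (integral {a..b} twist) \<le> 1 * (b - a)"
      by (rule integral_bound) (use ab continuous_on_twist in auto)
    also have "\<dots> \<le> sqrt (b - a)"
      using ab by (intro real_le_rsqrt) (simp add: power2_eq_square mult_left_le)
    finally show ?thesis .
  qed
  then show ?thesis by (simp add: line_bounds_def line_integral_def)
qed

text \<open>
  With \<open>j\<close> the modulus of the mean and $r = \sqrt\alpha$, the bounds
  \<open>A \<le> M * j\<close> and \<open>r * D \<le> M * j\<close> propagate: one half-step multiplies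
  \<open>j\<close> by at least $r^2 K/2$, where \<open>K\<close> is the modulus of the bias, whereas the new
  \<open>A\<close> is at most $45 r^2 j$ and the new \<open>D\<close> at most $3435 M j$. So \<open>M\<close> is
  chosen first, of order $1/K$, and \<open>\<alpha>\<close> afterwards.
\<close>

theorem mean_integral_growth:
  obtains \<alpha>0 where "\<alpha>0 \<ge> 4" and
    "\<And>\<alpha> n. \<alpha> \<ge> \<alpha>0 \<Longrightarrow> \<exists>A D. line_bounds \<alpha> n A D \<and> D \<le> norm (mean_integral \<alpha> n) / 2
        \<and> 3 ^ n / 2 \<le> norm (mean_integral \<alpha> n)"
proof -
  define K where "K = norm twist_bias"
  have K: "K > 0" using twist_bias_nonzero by (simp add: K_def)
  \<comment> \<open>the entry 2 is for the start of the induction, where the mean may be as small as 1/2\<close>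
  define M where "M = max 2 (90 / K)"
  have M2: "M \<ge> 2" and MK: "90 \<le> M * K"
    using K by (auto simp: M_def max_def field_simps)
  define R where "R = Max {2, 60 * M / K, 4 * M, 6870 / K, 6 / K}"
  have R: "R \<ge> 2" "R \<ge> 60 * M / K" "R \<ge> 4 * M" "R \<ge> 6870 / K" "R \<ge> 6 / K"
    unfolding R_def by (rule Max_ge; simp)+
  show ?thesis
  proof (rule that[of "R\<^sup>2"])
    show "R\<^sup>2 \<ge> 4" using R(1) power_mono[of 2 R 2] by simp
    fix \<alpha> :: real and n assume \<alpha>R: "\<alpha> \<ge> R\<^sup>2"
    define r where "r = sqrt \<alpha>"
    have r: "r \<ge> R" unfolding r_def using \<alpha>R by (rule real_le_rsqrt)
    have r2: "r \<ge> 2" "60 * M \<le> r * K" "r \<ge> 4 * M" "6870 \<le> r * K" "6 \<le> r * K"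
    proof -
      have "R * K \<le> r * K" using r K by (intro mult_right_mono) auto
      moreover have "60 * M \<le> R * K" "6870 \<le> R * K" "6 \<le> R * K"
        using R K by (simp_all add: pos_divide_le_eq)
      ultimately show "r \<ge> 2" "60 * M \<le> r * K" "r \<ge> 4 * M" "6870 \<le> r * K" "6 \<le> r * K"
        using R r by linarith+
    qed
    have \<alpha>: "\<alpha> \<ge> 4" using \<alpha>R R(1) power_mono[of 2 R 2] by simp
    have \<alpha>r: "\<alpha> = r * r" using \<alpha> by (simp add: r_def)
    have "\<exists>A D. line_bounds \<alpha> n A D \<and> A \<le> M * norm (mean_integral \<alpha> n)
        \<and> r * D \<le> M * norm (mean_integral \<alpha> n) \<and> 3 ^ n / 2 \<le> norm (mean_integral \<alpha> n)"
    proof (induction n)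
      case 0
      have "1 \<le> M * norm (mean_integral \<alpha> 0)"
        using mult_mono[OF M2 mean_integral_0[of \<alpha>]] M2 by simp
      then show ?case using line_bounds_0[of \<alpha>] mean_integral_0[of \<alpha>] by force
    next
      case (Suc n)
      define j where "j = norm (mean_integral \<alpha> n)"
      define j' where "j' = norm (mean_integral \<alpha> (Suc n))"
      from Suc obtain A D where lb: "line_bounds \<alpha> n A D" and A: "A \<le> M * j" and D: "r * D \<le> M * j"
        and j: "3 ^ n / 2 \<le> j" unfolding j_def by blast
      have j0: "j \<ge> 0" by (simp add: j_def)
      have AD0: "A \<ge> 0" "D \<ge> 0" using line_bounds_nonneg[OF lb] by auto
      note step = line_bounds_Suc[OF lb \<alpha>]
      have "norm (of_real \<alpha> * twist_bias * mean_integral \<alpha> n) = r * r * K * j"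
        using \<alpha> by (simp add: norm_mult K_def j_def \<alpha>r)
      then have "r * r * K * j \<le> j' + 10 * (r * r * D + (j + A))"
        using step(2) norm_triangle_sub[of "of_real \<alpha> * twist_bias * mean_integral \<alpha> n" "mean_integral \<alpha> (Suc n)"]
        unfolding j_def j'_def \<alpha>r by (simp add: norm_minus_commute)
      moreover have "10 * (r * r * D + (j + A)) \<le> (r * r * K / 2) * j"
      proof -
        have "r * (r * D) \<le> r * (M * j)" using D r2 by (intro mult_left_mono) auto
        then have "10 * (r * r * D + (j + A)) \<le> (10 * (r * M) + 10 + 10 * M) * j"
          using A by (simp add: algebra_simps)
        also have "\<dots> \<le> (30 * (r * M)) * j"
        proof (rule mult_right_mono[OF _ j0])
          have "1 * M \<le> r * M" "2 * 2 \<le> r * M"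
            using mult_mono[of 1 r M M] mult_mono[of 2 r 2 M] r2(1) M2 by simp_all
          then show "10 * (r * M) + 10 + 10 * M \<le> 30 * (r * M)" by linarith
        qed
        also have "\<dots> \<le> (r * r * K / 2) * j"
        proof (rule mult_right_mono[OF _ j0])
          have "r * (60 * M) \<le> r * (r * K)" using r2 by (intro mult_left_mono) auto
          then show "30 * (r * M) \<le> r * r * K / 2" by simp
        qed
        finally show ?thesis .
      qed
      ultimately have j': "r * r * K * j \<le> 2 * j'" by simp
      have J3: "3 * j \<le> j'"
      proof -
        have "2 * 6 \<le> r * (r * K)" using r2 by (intro mult_mono) auto
        then have "6 * j \<le> r * r * K * j" using j0 by (intro mult_right_mono) auto
        then show ?thesis using j' by simp
      qed
      let ?A = "15 * (2 * \<alpha> * (j + D) + sqrt (2 * \<alpha>) * A)" and ?D = "3 * (1130 * A + 15 * sqrt \<alpha> * D)"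
      have A': "?A \<le> M * j'"
      proof -
        have s2: "sqrt (2 * \<alpha>) \<le> 2 * r"
          using r2 by (intro real_le_lsqrt) (auto simp: \<alpha>r power2_eq_square)
        have 1: "2 * \<alpha> * D \<le> 2 * r * (M * j)"
          using mult_left_mono[OF D, of "2 * r"] r2 by (simp add: \<alpha>r mult_ac)
        have 2: "sqrt (2 * \<alpha>) * A \<le> 2 * r * (M * j)"
          using s2 A AD0 r2 by (intro mult_mono) auto
        have 3: "r * (4 * M) * j \<le> r * r * j"
          using r2 j0 by (intro mult_right_mono mult_left_mono) auto
        define T U V W where "T = r * (M * j)" and "U = 2 * \<alpha> * D" and "V = sqrt (2 * \<alpha>) * A"
          and "W = r * r * j"
        have bounds: "U \<le> 2 * T" "V \<le> 2 * T" "4 * T \<le> W"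
          using 1 2 3 by (simp_all only: T_def U_def V_def W_def mult.assoc mult.left_commute[of r 4])
        have "?A = 30 * W + 15 * (U + V)"
          by (simp add: \<alpha>r U_def V_def W_def algebra_simps)
        also have "\<dots> \<le> 45 * W"
        proof -
          have "U + V \<le> 2 * T + 2 * T" using bounds(1,2) by (rule add_mono)
          also have "\<dots> \<le> W" using bounds(3) by simp
          finally show ?thesis by simp
        qed
        finally have "2 * ?A \<le> 90 * (r * r * j)" by (simp add: W_def)
        also have "\<dots> \<le> (M * K) * (r * r * j)" using MK r2 j0 by (intro mult_right_mono) auto
        also have "\<dots> = M * (r * r * K * j)" by (simp add: mult_ac)
        also have "\<dots> \<le> M * (2 * j')" using j' M2 by (intro mult_left_mono) auto
        finally show ?thesis by simp
      qed
      have D': "r * ?D \<le> M * j'"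
      proof -
        have "?D \<le> 3435 * (M * j)" using A D by (simp add: r_def[symmetric] mult.assoc)
        then have "r * ?D \<le> r * (3435 * (M * j))" using r2 by (intro mult_left_mono) auto
        also have "2 * (r * (3435 * (M * j))) = 6870 * (r * M * j)" by simp
        also have "\<dots> \<le> (r * K) * (r * M * j)" using r2 M2 j0 by (intro mult_right_mono) auto
        also have "\<dots> = M * (r * r * K * j)" by (simp add: mult_ac)
        also have "\<dots> \<le> M * (2 * j')" using j' M2 by (intro mult_left_mono) auto
        finally show ?thesis by simp
      qed
      have "3 ^ Suc n / 2 \<le> j'" using j J3 by simp
      then show ?case using step(1) A' D' unfolding j_def[symmetric] j'_def[symmetric] by blast
    qed
    then obtain A D where *: "line_bounds \<alpha> n A D" "r * D \<le> M * norm (mean_integral \<alpha> n)"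
        "3 ^ n / 2 \<le> norm (mean_integral \<alpha> n)" by blast
    have "(4 * M) * D \<le> r * D" using r2 line_bounds_nonneg[OF *(1)] by (intro mult_right_mono) auto
    then have "M * (4 * D) \<le> M * norm (mean_integral \<alpha> n)" using *(2) by simp
    then have "4 * D \<le> norm (mean_integral \<alpha> n)" using M2 by simp
    then have "D \<le> norm (mean_integral \<alpha> n) / 2" using line_bounds_nonneg[OF *(1)] by simp
    then show "\<exists>A D. line_bounds \<alpha> n A D \<and> D \<le> norm (mean_integral \<alpha> n) / 2
        \<and> 3 ^ n / 2 \<le> norm (mean_integral \<alpha> n)" using * by blast
  qed
qed

section \<open>Integrals over the torus\<close>

lemma AE_lborel_iff_negligible: "(AE x in lborel. P x) \<longleftrightarrow> (\<exists>N. negligible N \<and> {x. \<not> P x} \<subseteq> N)"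
  using eventually_ae_filter_negligible[of P] by (simp add: AE_completion_iff)

text \<open>
  For a shift by less than one period in the direction \<open>b\<close>, the part of the cube that
  leaves through one face re-enters through the opposite one. The half-open slabs \<open>S\<close> make
  this an exact decomposition.
\<close>

lemma cube_integral_translate:
  fixes f :: "'a::euclidean_space \<Rightarrow> 'c::{banach,second_countable_topology}"
  assumes f: "bounded_borel f" and b: "b \<in> Basis" and per: "\<And>x. f (x + b) = f x"
  shows "(LINT x:cbox 0 One|lborel. f (x + h *\<^sub>R b)) = (LINT x:cbox 0 One|lborel. f x)"
proof -
  define P where "P = {x::'a. \<forall>j\<in>Basis - {b}. 0 \<le> x \<bullet> j \<and> x \<bullet> j \<le> 1}"
  define S where "S I = P \<inter> {x. x \<bullet> b \<in> I}" for I
  have f_m [measurable]: "f \<in> borel_measurable borel" using f by (rule bounded_borel_measurable)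
  have "P = (\<Inter>j\<in>Basis - {b}. {x. 0 \<le> x \<bullet> j} \<inter> {x. x \<bullet> j \<le> 1})" by (auto simp: P_def)
  moreover have "closed \<dots>"
    by (intro closed_INT ballI closed_Int closed_Collect_le continuous_intros)
  ultimately have "closed P" by simp
  then have P_m [measurable]: "P \<in> sets borel" by simp
  have S_m [measurable]: "S I \<in> sets borel" if [measurable]: "I \<in> sets borel" for I
    unfolding S_def by measurable
  have S_b: "bounded (S I)" if "I \<subseteq> {0..2}" for I
  proof (rule bounded_subset[OF bounded_cbox[of 0 "2 *\<^sub>R One"]])
    show "S I \<subseteq> cbox 0 (2 *\<^sub>R One)"
    proof
      fix x assume x: "x \<in> S I"
      have xj: "0 \<le> x \<bullet> j \<and> x \<bullet> j \<le> 1" if "j \<in> Basis - {b}" for j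
        using x that \<open>I \<subseteq> _\<close> unfolding S_def P_def by auto
      have "0 \<le> x \<bullet> j \<and> x \<bullet> j \<le> 2" if "j \<in> Basis" for j
      proof (cases "j = b")
        case True
        then show ?thesis using x \<open>I \<subseteq> _\<close> by (auto simp: S_def)
      next
        case False
        then show ?thesis using xj[of j] that by simp
      qed
      then show "x \<in> cbox 0 (2 *\<^sub>R One)" by (auto simp: mem_box)
    qed
  qed
  have int: "set_integrable lborel (S I) g" if "I \<in> sets borel" "I \<subseteq> {0..2}" "bounded_borel g"
    for I and g :: "'a \<Rightarrow> 'c"
    by (rule bounded_borel_set_integrable[OF that(3) S_m[OF that(1)] S_b[OF that(2)]])
  have translate: "(LINT x:S I|lborel. g (x + h *\<^sub>R b)) = (LINT x:S {t. t - h \<in> I}|lborel. g x)"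
    if [measurable]: "I \<in> sets borel" "g \<in> borel_measurable borel" for I h and g :: "'a \<Rightarrow> 'c"
  proof -
    have [measurable]: "{t. t - h \<in> I} \<in> sets borel"
      using measurable_sets_borel[of "\<lambda>t. t - h" borel I] by (simp add: vimage_def)
    have ind: "indicator (S I) x = (indicator (S {t. t - h \<in> I}) (h *\<^sub>R b + x) :: real)" for x
    proof -
      have "(h *\<^sub>R b + x) \<bullet> j = x \<bullet> j" if "j \<in> Basis - {b}" for j
        using that b inner_not_same_Basis[of b j] by (auto simp: inner_add_left)
      moreover have "(h *\<^sub>R b + x) \<bullet> b = x \<bullet> b + h" using b by (simp add: inner_add_left)
      ultimately show ?thesis by (auto simp: indicator_def S_def P_def)
    qed
    have "(LINT x:S {t. t - h \<in> I}|lborel. g x)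
        = integral\<^sup>L (distr lborel borel ((+) (h *\<^sub>R b))) (\<lambda>x. indicator (S {t. t - h \<in> I}) x *\<^sub>R g x)"
      unfolding lborel_distr_plus set_lebesgue_integral_def ..
    also have "\<dots> = (LINT x|lborel. indicator (S {t. t - h \<in> I}) (h *\<^sub>R b + x) *\<^sub>R g (h *\<^sub>R b + x))"
      by (rule integral_distr) measurable
    finally show ?thesis by (simp add: set_lebesgue_integral_def ind add.commute)
  qed
  have box: "(LINT x:cbox 0 One|lborel. g x) = (LINT x:S {0..<1}|lborel. g x)"
    if [measurable]: "g \<in> borel_measurable borel" for g :: "'a \<Rightarrow> 'c"
  proof -
    have "AE x::'a in lborel. x \<bullet> b \<noteq> 1"
      unfolding AE_lborel_iff_negligible using negligible_standard_hyperplane[OF b, of 1] by auto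
    then have "AE x in lborel. indicator (cbox 0 One) x *\<^sub>R g x = indicator (S {0..<1}) x *\<^sub>R g x"
    proof eventually_elim
      case (elim x)
      have "x \<in> cbox 0 One \<longleftrightarrow> x \<in> S {0..<1}"
        unfolding S_def P_def mem_box using b elim by (auto simp: order_less_le)
      then show ?case by (simp add: indicator_def)
    qed
    then show ?thesis unfolding set_lebesgue_integral_def by (intro integral_cong_AE) measurable
  qed
  have unit: "(LINT x:S {0..<1}|lborel. f (x + h *\<^sub>R b)) = (LINT x:S {0..<1}|lborel. f x)"
    if h: "0 \<le> h" "h \<le> 1" for h
  proof -
    have "(LINT x:S {0..<1}|lborel. f (x + h *\<^sub>R b)) = (LINT x:S {t. t - h \<in> {0..<1}}|lborel. f x)"
      by (rule translate) auto
    also have "S {t. t - h \<in> {0..<1}} = S {h..<1} \<union> S {1..<1 + h}"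
      using h by (auto simp: S_def)
    also have "(LINT x:S {h..<1} \<union> S {1..<1 + h}|lborel. f x)
        = (LINT x:S {h..<1}|lborel. f x) + (LINT x:S {1..<1 + h}|lborel. f x)"
      using h by (intro set_integral_Un int f) (auto simp: S_def)
    also have "(LINT x:S {1..<1 + h}|lborel. f x) = (LINT x:S {t. t - 1 \<in> {0..<h}}|lborel. f x)"
      by (rule arg_cong[where f="\<lambda>I. (LINT x:S I|lborel. f x)"]) auto
    also have "\<dots> = (LINT x:S {0..<h}|lborel. f (x + 1 *\<^sub>R b))"
      by (rule translate[symmetric]) auto
    also have "\<dots> = (LINT x:S {0..<h}|lborel. f x)" by (simp add: per)
    also have "(LINT x:S {h..<1}|lborel. f x) + \<dots> = (LINT x:S {h..<1} \<union> S {0..<h}|lborel. f x)"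
      using h by (intro set_integral_Un[symmetric] int f) (auto simp: S_def)
    also have "S {h..<1} \<union> S {0..<h} = S {0..<1}" using h by (auto simp: S_def)
    finally show ?thesis .
  qed
  have eq: "f (x + h *\<^sub>R b) = f (x + frac h *\<^sub>R b)" for x
  proof -
    have "f (x + (s + 1) *\<^sub>R b) = f (x + s *\<^sub>R b)" for s
      using per[of "x + s *\<^sub>R b"] by (simp add: scaleR_add_left add.assoc)
    from periodic_of_int[of "\<lambda>s. f (x + s *\<^sub>R b)", OF this, of "frac h" "\<lfloor>h\<rfloor>"]
    show ?thesis by (simp add: frac_def)
  qed
  show ?thesis
    unfolding eq using unit[of "frac h"] f_m
    by (subst (1 2) box) (auto simp: less_imp_le[OF frac_lt_1])
qed

lemma One_vec: "(\<Sum>Basis) = (1 :: real ^ 'n)"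
proof (rule euclidean_eqI)
  fix b :: "real ^ 'n" assume b: "b \<in> Basis"
  then obtain i where "b = axis i 1" by (auto simp: Basis_vec_def)
  then have "1 \<bullet> b = 1" by (simp add: inner_axis)
  moreover have "(\<Sum>Basis) \<bullet> b = 1" using b by (simp add: inner_sum_left inner_Basis)
  ultimately show "(\<Sum>Basis) \<bullet> b = 1 \<bullet> b" by simp
qed

lemma torus_integral_translate:
  fixes f :: "real ^ 'n \<Rightarrow> 'c::{banach,second_countable_topology}"
  assumes "bounded_borel f" "\<And>x. f (x + axis i 1) = f x"
  shows "torus_integral (\<lambda>x. f (x + h *\<^sub>R axis i 1)) = torus_integral f"
  using cube_integral_translate[OF assms(1), of "axis i 1" h] assms(2)
  by (simp add: torus_integral_def One_vec axis_in_Basis_iff)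

lemma interval_integral_translate:
  fixes f :: "real \<Rightarrow> 'c::{banach,second_countable_topology}"
  assumes "bounded_borel f" "\<And>x. f (x + 1) = f x"
  shows "(LINT x:{0..1}|lborel. f (x + h)) = (LINT x:{0..1}|lborel. f x)"
  using cube_integral_translate[OF assms(1), of 1 h] assms(2) by simp

lemma torus_integral_average:
  fixes f :: "real ^ 'n \<Rightarrow> 'c::{banach,second_countable_topology}"
  assumes f: "bounded_borel f" and per: "\<And>x. f (x + axis i 1) = f x"
  shows "torus_integral (\<lambda>x. LINT h:{0..1}|lborel. f (x + h *\<^sub>R axis i 1)) = torus_integral f"
    and "set_integrable lborel (cbox 0 1) (\<lambda>x. LINT h:{0..1}|lborel. f (x + h *\<^sub>R axis i 1))"
proof -
  have "bounded_borel (\<lambda>p :: (real ^ 'n) \<times> real. f (fst p + snd p *\<^sub>R axis i 1))"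
    by (rule bounded_borel_compose[OF f]) (intro borel_measurable_continuous_onI continuous_intros)
  then have bb: "bounded_borel (\<lambda>(x, h). f (x + h *\<^sub>R axis i 1))"
    by (simp add: case_prod_unfold)
  show "set_integrable lborel (cbox 0 1) (\<lambda>x. LINT h:{0..1}|lborel. f (x + h *\<^sub>R axis i 1))"
    by (rule Fubini_bounded_borel(2)[OF bb]) auto
  have "torus_integral (\<lambda>x. LINT h:{0..1}|lborel. f (x + h *\<^sub>R axis i 1))
      = (LINT h:{0..1}|lborel. torus_integral (\<lambda>x. f (x + h *\<^sub>R axis i 1)))"
    unfolding torus_integral_def by (rule Fubini_bounded_borel(1)[OF bb]) auto
  also have "\<dots> = (LINT h:{0..(1::real)}|lborel. torus_integral f)"
    using torus_integral_translate[OF f per] by simp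
  also have "\<dots> = torus_integral f" by (simp add: set_lebesgue_integral_def)
  finally show "torus_integral (\<lambda>x. LINT h:{0..1}|lborel. f (x + h *\<^sub>R axis i 1)) = torus_integral f" .
qed

text \<open>
  On every line in the direction of the shear the map is a translation. Averaging over translations in
  this direction reduces the claim to one-dimensional invariance, without disintegrating
  the cube.
\<close>

lemma torus_integral_shear:
  fixes f :: "real ^ 'n \<Rightarrow> 'c::{banach,second_countable_topology}"
  assumes f: "bounded_borel f" and per: "\<And>x. f (x + axis i 1) = f x"
    and v: "v \<in> borel_measurable borel" "\<And>x h. v (x + h *\<^sub>R axis i 1) = v x"
  shows "torus_integral (\<lambda>x. f (x + v x *\<^sub>R axis i 1)) = torus_integral f"
proof -
  have m: "(\<lambda>x. x + v x *\<^sub>R axis i 1) \<in> borel_measurable borel"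
    using v(1) by measurable
  have v1: "v (x + axis i 1) = v x" for x using v(2)[of x 1] by simp
  have "torus_integral (\<lambda>x. f (x + v x *\<^sub>R axis i 1))
      = torus_integral (\<lambda>x. LINT h:{0..1}|lborel.
          f ((x + h *\<^sub>R axis i 1) + v (x + h *\<^sub>R axis i 1) *\<^sub>R axis i 1))"
  proof (rule torus_integral_average(1)[symmetric, OF bounded_borel_compose[OF f m]])
    fix x
    show "f (x + axis i 1 + v (x + axis i 1) *\<^sub>R axis i 1) = f (x + v x *\<^sub>R axis i 1)"
      using per[of "x + v x *\<^sub>R axis i 1"] by (simp add: v1 algebra_simps)
  qed
  also have "\<dots> = torus_integral (\<lambda>x. LINT h:{0..1}|lborel. f (x + h *\<^sub>R axis i 1))"
  proof -
    have "(LINT h:{0..1}|lborel. f ((x + h *\<^sub>R axis i 1) + v (x + h *\<^sub>R axis i 1) *\<^sub>R axis i 1))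
        = (LINT h:{0..1}|lborel. f (x + h *\<^sub>R axis i 1))" for x
    proof -
      have bb: "bounded_borel (\<lambda>h. f (x + h *\<^sub>R axis i 1))"
        by (rule bounded_borel_compose[OF f]) (intro borel_measurable_continuous_onI continuous_intros)
      have p: "f (x + (h + 1) *\<^sub>R axis i 1) = f (x + h *\<^sub>R axis i 1)" for h
        using per[of "x + h *\<^sub>R axis i 1"] by (simp add: scaleR_add_left add.assoc)
      show ?thesis
        using interval_integral_translate[OF bb p, of "v x"]
        by (simp add: v(2) scaleR_add_left add.assoc)
    qed
    then show ?thesis by simp
  qed
  also have "\<dots> = torus_integral f" by (rule torus_integral_average(1)[OF f per])
  finally show ?thesis .
qed

section \<open>Lipschitz test functions and solenoidal fields\<close>

lemma torus_periodic_translate: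
  assumes "torus_periodic f"
  shows "f (x + (\<Sum>i\<in>I. of_int (k i) *\<^sub>R axis i 1)) = f x"
proof (induction I rule: infinite_finite_induct)
  case (insert i I)
  let ?y = "x + (\<Sum>i\<in>I. of_int (k i) *\<^sub>R axis i 1)"
  have "f (?y + (s + 1) *\<^sub>R axis i 1) = f (?y + s *\<^sub>R axis i 1)" for s
    using assms[unfolded torus_periodic_def, rule_format, of "?y + s *\<^sub>R axis i 1" i]
    by (simp only: scaleR_add_left scaleR_one add.assoc)
  from periodic_of_int[of "\<lambda>s. f (?y + s *\<^sub>R axis i 1)", OF this, of 0 "k i"]
  show ?case using insert by (simp add: algebra_simps)
qed auto

lemma bounded_range_torus_periodic:
  fixes f :: "real ^ 'n \<Rightarrow> 'b::real_normed_vector"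
  assumes per: "torus_periodic f" and cont: "continuous_on UNIV f"
  shows "bounded (range f)"
proof -
  have "range f \<subseteq> f ` cbox 0 1"
  proof
    fix y assume "y \<in> range f"
    then obtain x where y: "y = f x" by blast
    define z where "z = x + (\<Sum>i\<in>UNIV. of_int (- \<lfloor>x $ i\<rfloor>) *\<^sub>R axis i 1)"
    have "z $ j = frac (x $ j)" for j
      by (simp add: z_def sum_component axis_def frac_def if_distrib[of "\<lambda>t. _ * t"] sum_negf cong: if_cong)
    then have "z \<in> cbox 0 1" by (auto simp: mem_box_cart less_imp_le[OF frac_lt_1])
    moreover have "f z = y" unfolding y z_def by (rule torus_periodic_translate[OF per])
    ultimately show "y \<in> f ` cbox 0 1" by blast
  qed
  moreover have "compact (f ` cbox 0 1)"
    by (intro compact_continuous_image continuous_on_subset[OF cont]) auto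
  ultimately show ?thesis using compact_imp_bounded bounded_subset by blast
qed

lemma bounded_borel_torus_periodic:
  fixes f :: "real ^ 'n \<Rightarrow> 'b::real_normed_vector"
  assumes "torus_periodic f" "continuous_on UNIV f"
  shows "bounded_borel f"
  unfolding bounded_borel_def
  using bounded_range_torus_periodic[OF assms] borel_measurable_continuous_onI[OF assms(2)] by simp

lemma torus_periodicD: "torus_periodic f \<Longrightarrow> f (x + axis i 1) = f x"
  by (simp add: torus_periodic_def)

lemma torus_smooth_differentiable:
  assumes "torus_smooth f"
  shows "f differentiable (at x)" "partial i f differentiable (at x)"
    "partial j (partial i f) differentiable (at x)"
  using assms[unfolded torus_smooth_def, THEN conjunct2, rule_format, of "[]" x]
    assms[unfolded torus_smooth_def, THEN conjunct2, rule_format, of "[i]" x]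
    assms[unfolded torus_smooth_def, THEN conjunct2, rule_format, of "[i,j]" x]
  by simp_all

lemma torus_smooth_periodic: "torus_smooth f \<Longrightarrow> torus_periodic f"
  by (simp add: torus_smooth_def)

lemma torus_smooth_continuous:
  assumes "torus_smooth f"
  shows "continuous_on A f" "continuous_on A (partial i f)"
  using torus_smooth_differentiable[OF assms] differentiable_imp_continuous_within
  by (metis continuous_at_imp_continuous_on)+

lemma torus_smooth_has_derivative:
  fixes f :: "real ^ 'n \<Rightarrow> 'b::real_normed_vector"
  assumes "torus_smooth f"
  shows "(f has_derivative (\<lambda>h. \<Sum>j\<in>UNIV. h $ j *\<^sub>R partial j f x)) (at x)"
proof -
  have d: "(f has_derivative frechet_derivative f (at x)) (at x)"
    using torus_smooth_differentiable(1)[OF assms] frechet_derivative_works by blast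
  then have lin: "linear (frechet_derivative f (at x))"
    using has_derivative_linear by blast
  have "frechet_derivative f (at x) h = (\<Sum>j\<in>UNIV. h $ j *\<^sub>R partial j f x)" for h
  proof -
    have "h = (\<Sum>j\<in>UNIV. h $ j *\<^sub>R axis j 1)"
      using basis_expansion[of h] by (simp add: scalar_mult_eq_scaleR)
    then have "frechet_derivative f (at x) h = frechet_derivative f (at x) (\<Sum>j\<in>UNIV. h $ j *\<^sub>R axis j 1)"
      by simp
    then show ?thesis by (simp add: linear_sum[OF lin] linear_scale[OF lin] partial_def)
  qed
  then have "frechet_derivative f (at x) = (\<lambda>h. \<Sum>j\<in>UNIV. h $ j *\<^sub>R partial j f x)" by blast
  then show ?thesis using d by simp
qed

lemma torus_periodic_partial:
  fixes f :: "real ^ 'n \<Rightarrow> 'b::real_normed_vector"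
  assumes "torus_smooth f"
  shows "torus_periodic (partial i f)"
  unfolding torus_periodic_def
proof (intro allI)
  fix x j
  let ?D = "frechet_derivative f (at (x + axis j 1))"
  have d: "(f has_derivative ?D) (at (x + axis j 1))"
    using torus_smooth_differentiable(1)[OF assms] frechet_derivative_works by blast
  have "((\<lambda>y. f (y + axis j 1)) has_derivative ?D) (at x)"
    by (rule has_derivative_compose[of "\<lambda>y. y + axis j 1" "\<lambda>h. h", OF _ d])
       (auto intro!: derivative_eq_intros)
  moreover have "(\<lambda>y. f (y + axis j 1)) = f"
    using torus_periodicD[OF torus_smooth_periodic[OF assms]] by blast
  ultimately have "(f has_derivative ?D) (at x)" by simp
  then have "?D = frechet_derivative f (at x)" by (rule frechet_derivative_at)
  then show "partial i f (x + axis j 1) = partial i f x" by (simp add: partial_def)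
qed

lemma bounded_borel_smooth:
  fixes f :: "real ^ 'n \<Rightarrow> 'b::real_normed_vector"
  assumes "torus_smooth f"
  shows "bounded_borel f" "bounded_borel (partial i f)"
  by (rule bounded_borel_torus_periodic[OF torus_smooth_periodic[OF assms] torus_smooth_continuous(1)[OF assms]])
     (rule bounded_borel_torus_periodic[OF torus_periodic_partial[OF assms] torus_smooth_continuous(2)[OF assms]])

text \<open>
  Test functions that are only Lipschitz, with a prescribed gradient almost everywhere. Unlike smooth
  functions they are stable under composition with the flows below, which are only Lipschitz, and
  carrying the gradient along avoids Rademacher's theorem and the measurability of derivatives.
\<close>

definition torus_test :: "(real ^ 'n \<Rightarrow> real) \<Rightarrow> (real ^ 'n \<Rightarrow> real ^ 'n) \<Rightarrow> bool" where
  "torus_test \<phi> d\<phi> \<longleftrightarrow> torus_periodic \<phi> \<and> bounded_borel \<phi> \<and> (\<exists>L. L-lipschitz_on UNIV \<phi>) \<and>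
     torus_periodic d\<phi> \<and> bounded_borel d\<phi> \<and> (AE x in lborel. (\<phi> has_derivative (\<lambda>h. d\<phi> x \<bullet> h)) (at x))"

lemma torus_test_C1:
  fixes f :: "real ^ 'n \<Rightarrow> real"
  assumes per: "torus_periodic f" "torus_periodic d" and d: "continuous_on UNIV d"
    and der: "\<And>x. (f has_derivative (\<lambda>h. d x \<bullet> h)) (at x)"
  shows "torus_test f d"
proof -
  have cont: "continuous_on UNIV f"
    using der by (meson continuous_at_imp_continuous_on has_derivative_continuous)
  have bd: "bounded_borel d" by (rule bounded_borel_torus_periodic[OF per(2) d])
  obtain K where K: "K \<ge> 0" "\<And>x. norm (d x) \<le> K" using bounded_borel_bound[OF bd] by blast
  have "K-lipschitz_on UNIV f"
  proof (rule lipschitz_onI)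
    fix x y
    have "norm (f x - f y) \<le> K * norm (x - y)"
    proof (rule differentiable_bound[where S=UNIV and f'="\<lambda>x h. d x \<bullet> h"])
      show "onorm (\<lambda>h. d z \<bullet> h) \<le> K" for z
      proof (rule onorm_bound[OF K(1)])
        fix h
        have "\<bar>d z \<bullet> h\<bar> \<le> norm (d z) * norm h" by (rule Cauchy_Schwarz_ineq2)
        also have "\<dots> \<le> K * norm h" by (intro mult_right_mono K) auto
        finally show "norm (d z \<bullet> h) \<le> K * norm h" by simp
      qed
    qed (use der in auto)
    then show "dist (f x) (f y) \<le> K * dist x y" by (simp add: dist_norm)
  qed (rule K(1))
  then show ?thesis
    unfolding torus_test_def using per bounded_borel_torus_periodic[OF per(1) cont] bd der by auto
qed

lemma torus_test_smooth:
  assumes "torus_smooth \<phi>"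
  shows "torus_test \<phi> (\<lambda>x. \<chi> i. partial i \<phi> x)"
proof (rule torus_test_C1[OF torus_smooth_periodic[OF assms]])
  show "torus_periodic (\<lambda>x. \<chi> i. partial i \<phi> x)"
    using torus_periodic_partial[OF assms] by (simp add: torus_periodic_def)
  show "continuous_on UNIV (\<lambda>x. \<chi> i. partial i \<phi> x)"
    by (intro continuous_on_vec_lambda torus_smooth_continuous[OF assms])
  show "(\<phi> has_derivative (\<lambda>h. (\<chi> i. partial i \<phi> x) \<bullet> h)) (at x)" for x
    using torus_smooth_has_derivative[OF assms, of x] by (simp add: inner_vec_def mult.commute)
qed

lemma torus_test_component:
  fixes \<psi> :: "real ^ 'n \<Rightarrow> real ^ 'm"
  assumes "torus_smooth \<psi>"
  shows "torus_test (\<lambda>x. \<psi> x $ i) (\<lambda>x. \<chi> j. partial j \<psi> x $ i)"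
proof (rule torus_test_C1)
  show "torus_periodic (\<lambda>x. \<psi> x $ i)" "torus_periodic (\<lambda>x. \<chi> j. partial j \<psi> x $ i)"
    using torus_periodic_partial[OF assms] torus_smooth_periodic[OF assms] by (simp_all add: torus_periodic_def)
  show "continuous_on UNIV (\<lambda>x. \<chi> j. partial j \<psi> x $ i)"
    by (intro continuous_on_vec_lambda continuous_on_component torus_smooth_continuous[OF assms])
  show "((\<lambda>x. \<psi> x $ i) has_derivative (\<lambda>h. (\<chi> j. partial j \<psi> x $ i) \<bullet> h)) (at x)" for x
    using bounded_linear.has_derivative[OF bounded_linear_vec_nth torus_smooth_has_derivative[OF assms, of x], of i]
    by (simp add: inner_vec_def mult.commute)
qed

definition strong_div_free :: "(real ^ 'n \<Rightarrow> ('a :: {banach, second_countable_topology}) ^ 'n) \<Rightarrow> bool" where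
  "strong_div_free F \<longleftrightarrow> (\<forall>\<phi> d\<phi>. torus_test \<phi> d\<phi> \<longrightarrow> torus_integral (\<lambda>x. vdot (d\<phi> x) (F x)) = 0)"

lemma strong_div_free_imp_div_free: "strong_div_free F \<Longrightarrow> div_free F"
  unfolding strong_div_free_def div_free_def using torus_test_smooth by blast

lemma vdot_axis: "vdot a (axis i c) = (a $ i) *\<^sub>R c"
  by (simp add: vdot_def axis_def if_distrib[of "\<lambda>t. _ *\<^sub>R t"] cong: if_cong)

lemma vdot_add_right: "vdot a (b + c) = vdot a b + vdot a c"
  by (simp add: vdot_def scaleR_add_right sum.distrib)

lemma vdot_add_left: "vdot (a + b) c = vdot a c + vdot b c"
  by (simp add: vdot_def scaleR_add_left sum.distrib)

lemma vdot_diff_left: "vdot (a - b) c = vdot a c - vdot b c"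
  by (simp add: vdot_def scaleR_diff_left sum_subtractf)

lemma vdot_scaleR_left: "vdot (r *\<^sub>R a) c = r *\<^sub>R vdot a c"
  by (simp add: vdot_def scaleR_sum_right)

text \<open>
  Difference quotients of the test function in the direction \<open>i\<close> integrate to zero against
  \<open>c\<close> by translation invariance; dominated convergence passes to the derivative.
\<close>

lemma strong_div_free_axis:
  fixes c :: "real ^ 'n \<Rightarrow> 'a::{banach, second_countable_topology}"
  assumes c: "bounded_borel c" and inv: "\<And>x h. c (x + h *\<^sub>R axis i 1) = c x"
  shows "strong_div_free (\<lambda>x. axis i (c x))"
  unfolding strong_div_free_def vdot_axis
proof (intro allI impI)
  fix \<phi> :: "real ^ 'n \<Rightarrow> real" and d\<phi>
  assume "torus_test \<phi> d\<phi>"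
  then obtain L where per: "torus_periodic \<phi>" and \<phi>: "bounded_borel \<phi>" and L: "L-lipschitz_on UNIV \<phi>"
    and d\<phi>: "bounded_borel d\<phi>" and der: "AE x in lborel. (\<phi> has_derivative (\<lambda>h. d\<phi> x \<bullet> h)) (at x)"
    unfolding torus_test_def by blast
  obtain K where K: "K \<ge> 0" "\<And>x. norm (c x) \<le> K" using bounded_borel_bound[OF c] by blast
  define t where "t n = inverse (real (Suc n))" for n
  define D where "D n x = ((\<phi> (x + t n *\<^sub>R axis i 1) - \<phi> x) / t n) *\<^sub>R c x" for n x
  have t: "t n > 0" for n by (simp add: t_def)
  have t_lim: "filterlim t (at 0) sequentially"
    unfolding filterlim_at t_def using LIMSEQ_inverse_real_of_nat by auto
  have bt: "bounded_borel (\<lambda>x. \<phi> (x + t n *\<^sub>R axis i 1))" for n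
    by (rule bounded_borel_compose[OF \<phi>]) (intro borel_measurable_continuous_onI continuous_intros)
  have b1: "bounded_borel (\<lambda>x. \<phi> (x + t n *\<^sub>R axis i 1) *\<^sub>R c x)" and b2: "bounded_borel (\<lambda>x. \<phi> x *\<^sub>R c x)" for n
    by (intro bounded_borel_scaleR bt \<phi> c)+
  have int: "set_integrable lborel (cbox 0 1) f" if "bounded_borel f" for f :: "real ^ 'n \<Rightarrow> 'a"
    by (rule bounded_borel_set_integrable[OF that]) auto
  have zero: "torus_integral (D n) = 0" for n
  proof -
    have "torus_integral (\<lambda>x. \<phi> (x + t n *\<^sub>R axis i 1) *\<^sub>R c x)
        = torus_integral (\<lambda>x. \<phi> (x + t n *\<^sub>R axis i 1) *\<^sub>R c (x + t n *\<^sub>R axis i 1))" by (simp add: inv)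
    also have "\<dots> = torus_integral (\<lambda>x. \<phi> x *\<^sub>R c x)"
      by (rule torus_integral_translate[OF b2])
         (use inv[of _ 1] torus_periodicD[OF per] in simp)
    finally have eq: "torus_integral (\<lambda>x. \<phi> (x + t n *\<^sub>R axis i 1) *\<^sub>R c x) = torus_integral (\<lambda>x. \<phi> x *\<^sub>R c x)" .
    have "torus_integral (D n) = torus_integral (\<lambda>x. inverse (t n) *\<^sub>R
        (\<phi> (x + t n *\<^sub>R axis i 1) *\<^sub>R c x - \<phi> x *\<^sub>R c x))"
      by (simp add: D_def[abs_def] divide_inverse mult.commute flip: scaleR_diff_left)
    also have "\<dots> = inverse (t n) *\<^sub>R (torus_integral (\<lambda>x. \<phi> (x + t n *\<^sub>R axis i 1) *\<^sub>R c x)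
        - torus_integral (\<lambda>x. \<phi> x *\<^sub>R c x))"
      unfolding torus_integral_def
      by (simp only: set_integral_scaleR_right set_integral_diff(2)[OF int[OF b1] int[OF b2]])
    finally show ?thesis by (simp add: eq)
  qed
  have "(\<lambda>n. torus_integral (D n)) \<longlonglongrightarrow> torus_integral (\<lambda>x. (d\<phi> x $ i) *\<^sub>R c x)"
    unfolding torus_integral_def set_lebesgue_integral_def
  proof (rule integral_dominated_convergence[where w="\<lambda>x. indicator (cbox 0 1) x *\<^sub>R (L * K)"])
    have [measurable]: "(\<lambda>x. (d\<phi> x $ i) *\<^sub>R c x) \<in> borel_measurable borel"
      by (intro bounded_borel_measurable bounded_borel_scaleR bounded_borel_nth d\<phi> c)
    show "(\<lambda>x. indicator (cbox 0 1) x *\<^sub>R (d\<phi> x $ i) *\<^sub>R c x) \<in> borel_measurable lborel" by measurable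
    have [measurable]: "D n \<in> borel_measurable borel" for n
    proof -
      have "D n = (\<lambda>x. inverse (t n) *\<^sub>R (\<phi> (x + t n *\<^sub>R axis i 1) *\<^sub>R c x - \<phi> x *\<^sub>R c x))"
        by (simp add: D_def[abs_def] divide_inverse mult.commute flip: scaleR_diff_left)
      moreover have "\<dots> \<in> borel_measurable borel"
        using bounded_borel_measurable[OF b1[of n]] bounded_borel_measurable[OF b2] by measurable
      ultimately show ?thesis by simp
    qed
    show "(\<lambda>x. indicator (cbox 0 1) x *\<^sub>R D n x) \<in> borel_measurable lborel" for n by measurable
    have "set_integrable lborel (cbox 0 1 :: (real^'n) set) (\<lambda>x. L * K)"
      by (intro bounded_borel_set_integrable bounded_borel_const) auto
    then show "integrable lborel (\<lambda>x::real^'n. indicator (cbox 0 1) x *\<^sub>R (L * K))"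
      by (simp add: set_integrable_def)
    show "AE x in lborel. (\<lambda>n. indicator (cbox 0 1) x *\<^sub>R D n x)
        \<longlonglongrightarrow> indicator (cbox 0 1) x *\<^sub>R (d\<phi> x $ i) *\<^sub>R c x"
      using der
    proof eventually_elim
      case (elim x)
      have "((\<lambda>s. \<phi> (x + s *\<^sub>R axis i 1)) has_derivative (\<lambda>s. d\<phi> x \<bullet> (s *\<^sub>R axis i 1))) (at 0)"
        by (rule has_derivative_compose[of "\<lambda>s. x + s *\<^sub>R axis i 1" "\<lambda>s. s *\<^sub>R axis i 1" _ _ \<phi> "\<lambda>h. d\<phi> x \<bullet> h"])
           (use elim in \<open>auto intro!: derivative_eq_intros\<close>)
      moreover have "(\<lambda>s. d\<phi> x \<bullet> (s *\<^sub>R axis i 1)) = (*) (d\<phi> x $ i)"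
        by (auto simp: inner_axis mult.commute)
      ultimately have "((\<lambda>s. \<phi> (x + s *\<^sub>R axis i 1)) has_real_derivative d\<phi> x $ i) (at 0)"
        by (simp add: has_field_derivative_def)
      from DERIV_D[OF this]
      have "((\<lambda>s. (\<phi> (x + s *\<^sub>R axis i 1) - \<phi> x) / s) \<longlongrightarrow> d\<phi> x $ i) (at 0)" by simp
      from filterlim_compose[OF this t_lim]
      show ?case unfolding D_def by (intro tendsto_intros)
    qed
    show "AE x in lborel. norm (indicator (cbox 0 1) x *\<^sub>R D n x) \<le> indicator (cbox 0 1) x *\<^sub>R (L * K)" for n
    proof (rule AE_I2)
      fix x
      have "\<bar>\<phi> (x + t n *\<^sub>R axis i 1) - \<phi> x\<bar> \<le> L * t n"
        using lipschitz_onD[OF L, of "x + t n *\<^sub>R axis i 1" x] t[of n] by (simp add: dist_norm)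
      then have "\<bar>(\<phi> (x + t n *\<^sub>R axis i 1) - \<phi> x) / t n\<bar> \<le> L"
        using t[of n] by (simp add: pos_divide_le_eq)
      then have "norm (D n x) \<le> L * K"
        unfolding D_def norm_scaleR using K lipschitz_on_nonneg[OF L] by (intro mult_mono) auto
      then show "norm (indicator (cbox 0 1) x *\<^sub>R D n x) \<le> indicator (cbox 0 1) x *\<^sub>R (L * K)"
        by (simp add: indicator_def)
    qed
  qed
  then show "torus_integral (\<lambda>x. (d\<phi> x $ i) *\<^sub>R c x) = 0"
    using zero LIMSEQ_unique[OF tendsto_const] by fastforce
qed

lemma torus_testD:
  assumes "torus_test \<phi> d\<phi>"
  shows "torus_periodic \<phi>" "bounded_borel \<phi>" "\<exists>L. L-lipschitz_on UNIV \<phi>" "torus_periodic d\<phi>"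
    "bounded_borel d\<phi>" "AE x in lborel. (\<phi> has_derivative (\<lambda>h. d\<phi> x \<bullet> h)) (at x)"
  using assms by (simp_all add: torus_test_def)

lemma torus_test_mult:
  assumes f: "torus_test f df" and g: "torus_test g dg"
  shows "torus_test (\<lambda>x. f x * g x) (\<lambda>x. f x *\<^sub>R dg x + g x *\<^sub>R df x)"
proof -
  note F = torus_testD[OF f] and G = torus_testD[OF g]
  obtain K where K: "K \<ge> 0" "\<And>x. norm (f x) \<le> K" using bounded_borel_bound[OF F(2)] by blast
  obtain M where M: "M \<ge> 0" "\<And>x. norm (g x) \<le> M" using bounded_borel_bound[OF G(2)] by blast
  obtain L where L: "L-lipschitz_on UNIV f" using F(3) by blast
  obtain L' where L': "L'-lipschitz_on UNIV g" using G(3) by blast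
  have "(K * L' + L * M)-lipschitz_on UNIV (\<lambda>x. f x * g x)"
  proof (rule lipschitz_onI)
    fix x y
    have "f x * g x - f y * g y = f x * (g x - g y) + (f x - f y) * g y" by (simp add: algebra_simps)
    then have "\<bar>f x * g x - f y * g y\<bar> \<le> \<bar>f x\<bar> * \<bar>g x - g y\<bar> + \<bar>f x - f y\<bar> * \<bar>g y\<bar>"
      by (metis abs_mult abs_triangle_ineq)
    also have "\<dots> \<le> K * (L' * dist x y) + (L * dist x y) * M"
      using K M lipschitz_onD[OF L, of x y] lipschitz_onD[OF L', of x y] lipschitz_on_nonneg[OF L]
      by (intro add_mono mult_mono) (auto simp: dist_real_def)
    finally show "dist (f x * g x) (f y * g y) \<le> (K * L' + L * M) * dist x y"
      by (simp add: dist_real_def algebra_simps)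
  qed (use K M lipschitz_on_nonneg[OF L] lipschitz_on_nonneg[OF L'] in simp)
  moreover have "AE x in lborel. ((\<lambda>x. f x * g x) has_derivative (\<lambda>h. (f x *\<^sub>R dg x + g x *\<^sub>R df x) \<bullet> h)) (at x)"
    using F(6) G(6)
  proof eventually_elim
    case (elim x)
    show ?case
      using has_derivative_mult[OF elim] by (simp add: inner_add_left algebra_simps)
  qed
  moreover have "bounded_borel (\<lambda>x. f x * g x)"
    using bounded_borel_scaleR[OF F(2) G(2)] by simp
  moreover have "bounded_borel (\<lambda>x. f x *\<^sub>R dg x + g x *\<^sub>R df x)"
    by (intro bounded_borel_add bounded_borel_scaleR F G)
  ultimately show ?thesis
    unfolding torus_test_def using F(1,4) G(1,4) by (auto simp: torus_periodic_def)
qed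

section \<open>Transport of a field by a shear flow\<close>

definition shear_map :: "'n \<Rightarrow> (real ^ 'n \<Rightarrow> real) \<Rightarrow> real \<Rightarrow> real ^ 'n \<Rightarrow> real ^ 'n" where
  "shear_map i v \<tau> x = x + (\<tau> * v x) *\<^sub>R axis i 1"

text \<open>
  Push-forward of a vector field by the time-\<open>\<tau>\<close> map of the shear flow in direction
  \<open>i\<close> with profile \<open>v\<close> and gradient \<open>dv\<close>: the derivative of the flow adds
  to the field \<open>\<tau>\<close> times its component along \<open>dv\<close>, in the direction of the flow.
\<close>

definition push ::
    "'n \<Rightarrow> (real ^ 'n \<Rightarrow> real) \<Rightarrow> (real ^ 'n \<Rightarrow> real ^ 'n) \<Rightarrow> real \<Rightarrow>
     (real ^ 'n \<Rightarrow> complex ^ 'n) \<Rightarrow> real ^ 'n \<Rightarrow> complex ^ 'n" where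
  "push i v dv \<tau> B x = (let p = shear_map i v (- \<tau>) x in B p + axis i (\<tau> *\<^sub>R vdot (dv p) (B p)))"

definition regular_field :: "(real ^ 'n \<Rightarrow> complex ^ 'n) \<Rightarrow> bool" where
  "regular_field B \<longleftrightarrow> torus_periodic B \<and> bounded_borel B \<and> strong_div_free B"

locale shear_flow =
  fixes i :: "'n::finite" and v :: "real ^ 'n \<Rightarrow> real" and dv :: "real ^ 'n \<Rightarrow> real ^ 'n"
  assumes v_test: "torus_test v dv"
    and v_inv: "v (x + h *\<^sub>R axis i 1) = v x"
    and dv_inv: "dv (x + h *\<^sub>R axis i 1) = dv x"
begin

abbreviation "\<Phi> \<equiv> shear_map i v"

lemma v_flow [simp]: "v (\<Phi> \<tau> x) = v x" and dv_flow [simp]: "dv (\<Phi> \<tau> x) = dv x"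
  by (simp_all add: shear_map_def v_inv dv_inv)

lemma flow_inverse [simp]: "\<Phi> (- \<tau>) (\<Phi> \<tau> x) = x" "\<Phi> \<tau> (\<Phi> (- \<tau>) x) = x"
proof -
  have *: "\<Phi> a (\<Phi> b x) = x + ((a + b) * v x) *\<^sub>R axis i 1" for a b
    using v_flow[of b x] by (simp add: shear_map_def algebra_simps)
  show "\<Phi> (- \<tau>) (\<Phi> \<tau> x) = x" "\<Phi> \<tau> (\<Phi> (- \<tau>) x) = x" unfolding * by simp_all
qed

lemma flow_zero [simp]: "\<Phi> 0 x = x"
  by (simp add: shear_map_def)

lemma flow_periodic: "\<Phi> \<tau> (x + axis j 1) = \<Phi> \<tau> x + axis j 1"
  using torus_periodicD[OF torus_testD(1)[OF v_test]] by (simp add: shear_map_def)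

lemma torus_periodic_flow: "torus_periodic f \<Longrightarrow> torus_periodic (\<lambda>x. f (\<Phi> \<tau> x))"
  by (simp add: torus_periodic_def flow_periodic)

lemma flow_lipschitz: "\<exists>C. C-lipschitz_on UNIV (\<Phi> \<tau>)"
proof -
  obtain L where L: "L-lipschitz_on UNIV v" using torus_testD(3)[OF v_test] by blast
  have "(1 + \<bar>\<tau>\<bar> * L)-lipschitz_on UNIV (\<Phi> \<tau>)"
  proof (rule lipschitz_onI)
    fix x y
    have "\<Phi> \<tau> x - \<Phi> \<tau> y = (x - y) + (\<tau> * (v x - v y)) *\<^sub>R axis i 1"
      by (simp add: shear_map_def algebra_simps)
    then have "norm (\<Phi> \<tau> x - \<Phi> \<tau> y) \<le> norm (x - y) + \<bar>\<tau>\<bar> * \<bar>v x - v y\<bar>"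
      using norm_triangle_ineq[of "x - y" "(\<tau> * (v x - v y)) *\<^sub>R axis i (1::real)"] by (simp add: abs_mult)
    also have "\<dots> \<le> norm (x - y) + \<bar>\<tau>\<bar> * (L * norm (x - y))"
      using lipschitz_onD[OF L, of x y] by (intro add_mono mult_left_mono) (auto simp: dist_norm)
    finally show "dist (\<Phi> \<tau> x) (\<Phi> \<tau> y) \<le> (1 + \<bar>\<tau>\<bar> * L) * dist x y"
      by (simp add: dist_norm algebra_simps)
  qed (use lipschitz_on_nonneg[OF L] in simp)
  then show ?thesis by blast
qed

lemma v_continuous: "continuous_on A v"
  using torus_testD(3)[OF v_test] lipschitz_on_continuous_on continuous_on_subset by blast

lemma flow_measurable: "\<Phi> \<tau> \<in> borel_measurable borel"
  using flow_lipschitz lipschitz_on_continuous_on by (blast intro: borel_measurable_continuous_onI)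

lemma torus_integral_flow:
  fixes f :: "real ^ 'n \<Rightarrow> 'c::{banach,second_countable_topology}"
  assumes "bounded_borel f" "torus_periodic f"
  shows "torus_integral (\<lambda>x. f (\<Phi> \<tau> x)) = torus_integral f"
  unfolding shear_map_def
proof (rule torus_integral_shear[OF assms(1)])
  show "(\<lambda>x. \<tau> * v x) \<in> borel_measurable borel"
    using bounded_borel_measurable[OF torus_testD(2)[OF v_test]] by simp
qed (use torus_periodicD[OF assms(2)] v_inv in simp_all)

text \<open>
  The inverse flow is Lipschitz and hence maps null sets to null sets.
\<close>

lemma AE_flow:
  assumes "AE x in lborel. P x"
  shows "AE x in lborel. P (\<Phi> \<tau> x)"
proof -
  obtain N where N: "negligible N" "{x. \<not> P x} \<subseteq> N" using assms unfolding AE_lborel_iff_negligible by blast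
  obtain C where C: "C-lipschitz_on UNIV (\<Phi> (- \<tau>))" using flow_lipschitz by blast
  have "negligible (\<Phi> (- \<tau>) ` N)"
  proof (rule negligible_locally_Lipschitz_image[OF _ N(1)])
    fix x
    show "\<exists>T B. open T \<and> x \<in> T \<and> (\<forall>y\<in>N \<inter> T. norm (\<Phi> (- \<tau>) y - \<Phi> (- \<tau>) x) \<le> B * norm (y - x))"
      using lipschitz_onD[OF C] by (intro exI[of _ UNIV] exI[of _ C]) (auto simp: dist_norm)
  qed simp
  moreover have "{x. \<not> P (\<Phi> \<tau> x)} \<subseteq> \<Phi> (- \<tau>) ` N"
  proof
    fix x assume "x \<in> {x. \<not> P (\<Phi> \<tau> x)}"
    then have "\<Phi> \<tau> x \<in> N" using N(2) by blast
    then have "\<Phi> (- \<tau>) (\<Phi> \<tau> x) \<in> \<Phi> (- \<tau>) ` N" by (rule imageI)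
    then show "x \<in> \<Phi> (- \<tau>) ` N" by simp
  qed
  ultimately show ?thesis unfolding AE_lborel_iff_negligible by blast
qed

lemma torus_test_flow:
  assumes "torus_test \<phi> d\<phi>"
  shows "torus_test (\<lambda>x. \<phi> (\<Phi> \<tau> x)) (\<lambda>x. d\<phi> (\<Phi> \<tau> x) + (\<tau> * d\<phi> (\<Phi> \<tau> x) $ i) *\<^sub>R dv x)"
proof -
  note F = torus_testD[OF assms] and V = torus_testD[OF v_test]
  obtain L where L: "L-lipschitz_on UNIV \<phi>" using F(3) by blast
  obtain C where C: "C-lipschitz_on UNIV (\<Phi> \<tau>)" using flow_lipschitz by blast
  have "(L * C)-lipschitz_on UNIV (\<lambda>x. \<phi> (\<Phi> \<tau> x))"
    by (rule lipschitz_on_compose2[OF C lipschitz_on_subset[OF L]]) auto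
  moreover have "AE x in lborel. ((\<lambda>x. \<phi> (\<Phi> \<tau> x)) has_derivative
      (\<lambda>h. (d\<phi> (\<Phi> \<tau> x) + (\<tau> * d\<phi> (\<Phi> \<tau> x) $ i) *\<^sub>R dv x) \<bullet> h)) (at x)"
    using AE_flow[OF F(6), of \<tau>] V(6)
  proof eventually_elim
    case (elim x)
    have "(\<Phi> \<tau> has_derivative (\<lambda>h. h + (\<tau> * (dv x \<bullet> h)) *\<^sub>R axis i 1)) (at x)"
      unfolding shear_map_def[abs_def] by (auto intro!: derivative_eq_intros elim)
    from has_derivative_compose[OF this elim(1)]
    show ?case by (simp add: inner_add_left inner_add_right inner_axis algebra_simps)
  qed
  moreover have "bounded_borel (\<lambda>x. d\<phi> (\<Phi> \<tau> x) + (\<tau> * d\<phi> (\<Phi> \<tau> x) $ i) *\<^sub>R dv x)"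
  proof -
    have b: "bounded_borel (\<lambda>x. d\<phi> (\<Phi> \<tau> x))" by (rule bounded_borel_compose[OF F(5) flow_measurable])
    have "bounded_borel (\<lambda>x. \<tau> *\<^sub>R (d\<phi> (\<Phi> \<tau> x) $ i))"
      by (intro bounded_borel_scaleR bounded_borel_const bounded_borel_nth b)
    then show ?thesis using b V(5) by (intro bounded_borel_add bounded_borel_scaleR) simp_all
  qed
  ultimately show ?thesis
    unfolding torus_test_def
    using torus_periodic_flow[OF F(1)] torus_periodic_flow[OF F(4)] V(4)
      bounded_borel_compose[OF F(2) flow_measurable]
    by (auto simp: torus_periodic_def flow_periodic)
qed

lemma push_flow: "push i v dv \<tau> B (\<Phi> \<tau> p) = B p + axis i (\<tau> *\<^sub>R vdot (dv p) (B p))"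
  by (simp add: push_def Let_def)

lemma push_zero [simp]: "push i v dv 0 B = B"
  by (rule ext) (simp add: push_def Let_def axis_eq_0_iff)

lemma bounded_borel_push:
  assumes "bounded_borel B"
  shows "bounded_borel (push i v dv \<tau> B)"
  unfolding push_def[abs_def] Let_def
  by (rule bounded_borel_compose[OF _ flow_measurable])
     (intro bounded_borel_add bounded_borel_axis bounded_borel_scaleR bounded_borel_vdot bounded_borel_const
        assms torus_testD(5)[OF v_test])

lemma torus_periodic_push: "torus_periodic B \<Longrightarrow> torus_periodic (push i v dv \<tau> B)"
  using torus_testD(4)[OF v_test] by (simp add: torus_periodic_def push_def Let_def flow_periodic)

lemma vdot_push_flow:
  "vdot a (push i v dv \<tau> B (\<Phi> \<tau> p)) = vdot (a + (\<tau> * a $ i) *\<^sub>R dv p) (B p)"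
  by (simp add: push_flow vdot_add_right vdot_axis vdot_add_left vdot_scaleR_left mult.commute)

text \<open>
  A test function for the pushed field, composed with the flow, is a test function for the original
  field; smooth test functions would not be enough here, as the flow is only Lipschitz.
\<close>

lemma regular_field_push:
  assumes "regular_field B"
  shows "regular_field (push i v dv \<tau> B)"
proof -
  have B: "torus_periodic B" "bounded_borel B" "strong_div_free B"
    using assms by (simp_all add: regular_field_def)
  have "torus_integral (\<lambda>x. vdot (d\<phi> x) (push i v dv \<tau> B x)) = 0" if t: "torus_test \<phi> d\<phi>" for \<phi> d\<phi>
  proof -
    note F = torus_testD[OF t]
    have "torus_integral (\<lambda>x. vdot (d\<phi> x) (push i v dv \<tau> B x))
        = torus_integral (\<lambda>x. vdot (d\<phi> (\<Phi> \<tau> x)) (push i v dv \<tau> B (\<Phi> \<tau> x)))"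
    proof (rule torus_integral_flow[symmetric])
      show "bounded_borel (\<lambda>x. vdot (d\<phi> x) (push i v dv \<tau> B x))"
        by (intro bounded_borel_vdot F bounded_borel_push B)
      show "torus_periodic (\<lambda>x. vdot (d\<phi> x) (push i v dv \<tau> B x))"
        using F(4) torus_periodic_push[OF B(1)] by (simp add: torus_periodic_def)
    qed
    also have "\<dots> = 0"
      unfolding vdot_push_flow using B(3) torus_test_flow[OF t] unfolding strong_div_free_def by blast
    finally show ?thesis .
  qed
  then show ?thesis
    unfolding regular_field_def strong_div_free_def using bounded_borel_push[OF B(2)] torus_periodic_push[OF B(1)] by blast
qed

end

text \<open>
  For a velocity in a coordinate direction the term $\nabla\times\psi\cdot(u\times B)$ is the
  derivative of $\psi$ along $u$, paired with $B$, minus a gradient paired with $B$.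
\<close>

lemma vdot_curl_vcross_axis:
  fixes b :: "('a::real_vector) ^ 3"
  shows "vdot (curl \<psi> x) (vcross (w *\<^sub>R axis i 1) b)
    = w *\<^sub>R (vdot (partial i \<psi> x) b - vdot (\<chi> j. partial j \<psi> x $ i) b)"
  using exhaust_3[of i]
  by (auto simp: vdot_def curl_def vcross_def sum_3 vector_3 axis_def algebra_simps)

lemma bounded_linear_vdot_left:
  fixes b :: "'a::real_normed_vector ^ 'n"
  shows "bounded_linear (\<lambda>a. vdot a b)"
  by (rule linear_conv_bounded_linear[THEN iffD1], rule linearI) (simp_all add: vdot_add_left vdot_scaleR_left)

lemma smooth_along_flow:
  fixes \<psi> :: "real ^ 'n \<Rightarrow> 'b::real_normed_vector"
  assumes "torus_smooth \<psi>"
  shows "((\<lambda>s. \<psi> (shear_map i v s p)) has_vector_derivative v p *\<^sub>R partial i \<psi> (shear_map i v s p)) (at s within A)"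
proof -
  have "((\<lambda>s. shear_map i v s p) has_derivative (\<lambda>h. (h * v p) *\<^sub>R axis i 1)) (at s within A)"
    unfolding shear_map_def by (auto intro!: derivative_eq_intros)
  from has_derivative_compose[OF this torus_smooth_has_derivative[OF assms]]
  show ?thesis
    by (simp add: has_vector_derivative_def axis_def if_distrib[of "\<lambda>t. t *\<^sub>R _"] if_distrib[of "\<lambda>t. _ * t"] cong: if_cong)
qed

locale shear_flow3 = shear_flow i v dv for i :: 3 and v dv
begin

text \<open>
  Changing variables along the flow, the left-hand side at time \<open>s\<close> is the integral over
  \<open>p\<close> of \<open>vdot (\<psi> (\<Phi> s p)) (B p) + (s * \<psi> (\<Phi> s p) $ i) * \<beta> p\<close>,
  where \<open>\<beta>\<close> is the component of \<open>B\<close> along the gradient of the profile. Its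
  \<open>s\<close>-derivative \<open>K s p\<close> differs from the transported integrand of the equation by the
  gradient of \<open>v * (\<psi> $ i \<circ> \<Phi> s)\<close> paired with \<open>B\<close>, which integrates to zero.
\<close>

lemma weak_equation_push:
  assumes \<psi>: "torus_smooth \<psi>" and B: "regular_field B" and \<tau>: "0 \<le> \<tau>"
  defines "R \<equiv> \<lambda>s. torus_integral (\<lambda>x. vdot (curl \<psi> x) (vcross (v x *\<^sub>R axis i 1) (push i v dv s B x)))"
  shows "set_integrable lborel {0..\<tau>} R"
    and "torus_integral (\<lambda>x. vdot (\<psi> x) (push i v dv \<tau> B x))
      = torus_integral (\<lambda>x. vdot (\<psi> x) (B x)) + (LINT s:{0..\<tau>}|lborel. R s)"
proof -
  note V = torus_testD[OF v_test]
  have Bp: "torus_periodic B" and Bb: "bounded_borel B" and Bd: "strong_div_free B"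
    using B by (simp_all add: regular_field_def)
  define \<beta> where "\<beta> p = vdot (dv p) (B p)" for p
  have \<beta>: "bounded_borel \<beta>" unfolding \<beta>_def[abs_def] by (intro bounded_borel_vdot V Bb)
  define G where "G x = (\<chi> j. partial j \<psi> x $ i)" for x
  note G_test = torus_test_component[OF \<psi>, of i, folded G_def]
  note \<psi>b = bounded_borel_smooth[OF \<psi>]
  define K where "K s p = vdot (v p *\<^sub>R partial i \<psi> (\<Phi> s p)) (B p)
      + (\<psi> (\<Phi> s p) $ i + s * (v p * partial i \<psi> (\<Phi> s p) $ i)) *\<^sub>R \<beta> p" for s p
  have int: "set_integrable lborel (cbox 0 1) f" if "bounded_borel f" for f :: "real ^ 3 \<Rightarrow> complex"
    by (rule bounded_borel_set_integrable[OF that]) auto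
  have RK: "R s = torus_integral (K s)" for s
  proof -
    have bP: "bounded_borel (\<lambda>p. partial i \<psi> (\<Phi> s p))" and bG: "bounded_borel (\<lambda>p. G (\<Phi> s p))"
      and bpsi: "bounded_borel (\<lambda>p. \<psi> (\<Phi> s p))"
      by (rule bounded_borel_compose[OF _ flow_measurable], rule \<psi>b torus_testD(5)[OF G_test])+
    define f1 where "f1 p = v p *\<^sub>R (vdot (partial i \<psi> (\<Phi> s p)) (B p) - vdot (G (\<Phi> s p)) (B p))" for p
    define g where "g x = vdot (curl \<psi> x) (vcross (v x *\<^sub>R axis i 1) (push i v dv s B x))" for x
    have g: "g x = v x *\<^sub>R (vdot (partial i \<psi> x - G x) (push i v dv s B x))" for x
      unfolding g_def vdot_curl_vcross_axis G_def vdot_diff_left ..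
    have "R s = torus_integral (\<lambda>p. g (\<Phi> s p))"
      unfolding R_def g_def[symmetric]
    proof (rule torus_integral_flow[symmetric])
      show "bounded_borel g"
        unfolding g[abs_def] vdot_diff_left
      proof (intro bounded_borel_scaleR V)
        have "bounded_borel (\<lambda>x. vdot (partial i \<psi> x) (push i v dv s B x) - vdot (G x) (push i v dv s B x))"
          by (intro bounded_borel_diff bounded_borel_vdot bounded_borel_push \<psi>b torus_testD(5)[OF G_test] Bb)
        then show "bounded_borel (\<lambda>x. vdot (partial i \<psi> x) (push i v dv s B x) - vdot (G x) (push i v dv s B x))" .
      qed
      show "torus_periodic g"
        using V(1) torus_periodic_partial[OF \<psi>, of i] torus_testD(4)[OF G_test] torus_periodic_push[OF Bp]
        unfolding torus_periodic_def g by simp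
    qed
    also have "(\<lambda>p. g (\<Phi> s p)) = f1"
    proof
      fix p
      have "(partial i \<psi> (\<Phi> s p) - G (\<Phi> s p)) $ i = 0" by (simp add: G_def)
      then show "g (\<Phi> s p) = f1 p"
        unfolding g vdot_push_flow f1_def by (simp add: vdot_diff_left)
    qed
    finally have R1: "R s = torus_integral f1" .
    \<comment> \<open>the gradient of \<open>v * (\<psi> $ i \<circ> \<Phi> s)\<close>, paired with \<open>B\<close>\<close>
    define f2 where "f2 p = vdot (v p *\<^sub>R (G (\<Phi> s p) + (s * G (\<Phi> s p) $ i) *\<^sub>R dv p) + \<psi> (\<Phi> s p) $ i *\<^sub>R dv p) (B p)" for p
    have "torus_integral f2 = 0"
      using torus_test_mult[OF v_test torus_test_flow[OF G_test, of s]] Bd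
      unfolding strong_div_free_def f2_def by blast
    then have "R s = torus_integral f1 + torus_integral f2" using R1 by simp
    also have "\<dots> = torus_integral (\<lambda>p. f1 p + f2 p)"
      unfolding torus_integral_def
    proof (rule set_integral_add(2)[symmetric])
      show "set_integrable lborel (cbox 0 1) f1"
        unfolding f1_def by (intro int bounded_borel_scaleR bounded_borel_diff bounded_borel_vdot V bP bG Bb)
      have "bounded_borel (\<lambda>p. s *\<^sub>R (G (\<Phi> s p) $ i))"
        by (intro bounded_borel_scaleR bounded_borel_const bounded_borel_nth bG)
      then show "set_integrable lborel (cbox 0 1) f2"
        unfolding f2_def
        by (intro int bounded_borel_add bounded_borel_scaleR bounded_borel_vdot bounded_borel_nth V bpsi bG Bb) simp_all
    qed
    also have "(\<lambda>p. f1 p + f2 p) = K s"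
    proof
      fix p
      have "G (\<Phi> s p) $ i = partial i \<psi> (\<Phi> s p) $ i" by (simp add: G_def)
      then show "f1 p + f2 p = K s p"
        unfolding f1_def f2_def K_def \<beta>_def by (simp add: vdot_add_left vdot_scaleR_left algebra_simps)
    qed
    finally show ?thesis .
  qed
  \<comment> \<open>truncation in time keeps the integrand bounded on the whole line\<close>
  define c where "c s = max 0 (min s \<tau>)" for s :: real
  have c: "c s = s" if "s \<in> {0..\<tau>}" for s using that by (auto simp: c_def)
  have bK: "bounded_borel (\<lambda>(s, p). K (c s) p)"
  proof -
    have fst_m: "(\<lambda>q. fst q) \<in> borel_measurable (borel :: (real \<times> (real ^ 3)) measure)"
      and snd_m: "(\<lambda>q. snd q) \<in> borel_measurable (borel :: (real \<times> (real ^ 3)) measure)"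
      by (intro borel_measurable_continuous_onI continuous_intros)+
    have \<Phi>_m: "(\<lambda>q. \<Phi> (c (fst q)) (snd q)) \<in> borel_measurable borel"
      unfolding shear_map_def c_def
      by (intro borel_measurable_continuous_onI continuous_intros continuous_on_compose2[OF v_continuous[of UNIV]]) auto
    have bc: "bounded_borel (\<lambda>q::real \<times> (real ^ 3). c (fst q))"
    proof (rule bounded_borelI[where K=\<tau>])
      show "(\<lambda>q::real \<times> (real ^ 3). c (fst q)) \<in> borel_measurable borel"
        unfolding c_def by (intro borel_measurable_continuous_onI continuous_intros)
    qed (use \<tau> in \<open>auto simp: c_def\<close>)
    have bv: "bounded_borel (\<lambda>q::real \<times> (real ^ 3). v (snd q))" and bB: "bounded_borel (\<lambda>q::real \<times> (real ^ 3). B (snd q))"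
      and b\<beta>: "bounded_borel (\<lambda>q::real \<times> (real ^ 3). \<beta> (snd q))"
      by (rule bounded_borel_compose[OF V(2) snd_m] bounded_borel_compose[OF Bb snd_m] bounded_borel_compose[OF \<beta> snd_m])+
    have bP: "bounded_borel (\<lambda>q. partial i \<psi> (\<Phi> (c (fst q)) (snd q)))"
      and bpsi: "bounded_borel (\<lambda>q. \<psi> (\<Phi> (c (fst q)) (snd q)))"
      by (rule bounded_borel_compose[OF \<psi>b(2) \<Phi>_m] bounded_borel_compose[OF \<psi>b(1) \<Phi>_m])+
    have b3: "bounded_borel (\<lambda>q. c (fst q) *\<^sub>R (v (snd q) *\<^sub>R (partial i \<psi> (\<Phi> (c (fst q)) (snd q)) $ i)))"
      by (intro bounded_borel_scaleR bounded_borel_nth bc bv bP)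
    have "bounded_borel (\<lambda>q. K (c (fst q)) (snd q))"
      unfolding K_def using b3
      by (intro bounded_borel_add bounded_borel_scaleR bounded_borel_vdot bounded_borel_nth bv bP bB bpsi b\<beta>) simp_all
    then show ?thesis by (simp add: case_prod_unfold)
  qed
  have "set_integrable lborel {0..\<tau>} (\<lambda>s. LINT p:cbox 0 1|lborel. K (c s) p)"
    by (rule Fubini_bounded_borel(2)[OF bK]) auto
  then show "set_integrable lborel {0..\<tau>} R"
    by (rule set_integrable_cong[THEN iffD1, rotated -1]) (auto simp: RK torus_integral_def c)
  have FTC: "(LINT s:{0..\<tau>}|lborel. K (c s) p) = vdot (\<psi> (\<Phi> \<tau> p)) (push i v dv \<tau> B (\<Phi> \<tau> p)) - vdot (\<psi> p) (B p)" for p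
  proof -
    define E where "E s = vdot (\<psi> (\<Phi> s p)) (B p) + (s * \<psi> (\<Phi> s p) $ i) *\<^sub>R \<beta> p" for s
    have "bounded_borel (\<lambda>s. (\<lambda>(s, p). K (c s) p) (s, p))"
      by (rule bounded_borel_compose[OF bK]) (intro borel_measurable_continuous_onI continuous_intros)
    then have bs: "bounded_borel (\<lambda>s. K (c s) p)" by simp
    have "(E has_vector_derivative K s p) (at s within {0..\<tau>})" for s
    proof -
      note d = smooth_along_flow[OF \<psi>, of i v p s "{0..\<tau>}"]
      have 1: "((\<lambda>s. vdot (\<psi> (\<Phi> s p)) (B p)) has_vector_derivative vdot (v p *\<^sub>R partial i \<psi> (\<Phi> s p)) (B p)) (at s within {0..\<tau>})"
        by (rule bounded_linear.has_vector_derivative[OF bounded_linear_vdot_left d])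
      have "((\<lambda>s. \<psi> (\<Phi> s p) $ i) has_vector_derivative (v p *\<^sub>R partial i \<psi> (\<Phi> s p)) $ i) (at s within {0..\<tau>})"
        by (rule bounded_linear.has_vector_derivative[OF bounded_linear_vec_nth d])
      then have "((\<lambda>s. \<psi> (\<Phi> s p) $ i) has_real_derivative (v p * partial i \<psi> (\<Phi> s p) $ i)) (at s within {0..\<tau>})"
        by (simp add: has_real_derivative_iff_has_vector_derivative)
      from DERIV_mult[OF DERIV_ident this]
      have "((\<lambda>s. s * \<psi> (\<Phi> s p) $ i) has_real_derivative (\<psi> (\<Phi> s p) $ i + s * (v p * partial i \<psi> (\<Phi> s p) $ i))) (at s within {0..\<tau>})"
        by (simp add: algebra_simps)
      from has_vector_derivative_scaleR[OF this has_vector_derivative_const]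
      have 2: "((\<lambda>s. (s * \<psi> (\<Phi> s p) $ i) *\<^sub>R \<beta> p) has_vector_derivative
          (\<psi> (\<Phi> s p) $ i + s * (v p * partial i \<psi> (\<Phi> s p) $ i)) *\<^sub>R \<beta> p) (at s within {0..\<tau>})" by simp
      show ?thesis unfolding E_def[abs_def] K_def by (rule has_vector_derivative_add[OF 1 2])
    qed
    then have "((\<lambda>s. K s p) has_integral (E \<tau> - E 0)) {0..\<tau>}"
      by (intro fundamental_theorem_of_calculus \<tau>) auto
    then have "((\<lambda>s. K (c s) p) has_integral (E \<tau> - E 0)) {0..\<tau>}"
      by (rule has_integral_eq[rotated]) (simp add: c)
    then have "(LINT s:{0..\<tau>}|lborel. K (c s) p) = E \<tau> - E 0"
      using set_lebesgue_eq_integral[OF bs] by (simp add: integral_unique)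
    also have "E \<tau> = vdot (\<psi> (\<Phi> \<tau> p)) (push i v dv \<tau> B (\<Phi> \<tau> p))"
      by (simp add: E_def push_flow vdot_add_right vdot_axis \<beta>_def mult.commute)
    also have "E 0 = vdot (\<psi> p) (B p)" by (simp add: E_def)
    finally show ?thesis .
  qed
  have "(LINT s:{0..\<tau>}|lborel. R s) = (LINT s:{0..\<tau>}|lborel. LINT p:cbox 0 1|lborel. K (c s) p)"
    by (rule set_lebesgue_integral_cong) (auto simp: RK torus_integral_def c)
  also have "\<dots> = (LINT p:cbox 0 1|lborel. LINT s:{0..\<tau>}|lborel. K (c s) p)"
    by (rule Fubini_bounded_borel(1)[OF bK]) auto
  also have "\<dots> = (LINT p:cbox 0 1|lborel. vdot (\<psi> (\<Phi> \<tau> p)) (push i v dv \<tau> B (\<Phi> \<tau> p)) - vdot (\<psi> p) (B p))"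
    unfolding FTC ..
  also have "\<dots> = torus_integral (\<lambda>p. vdot (\<psi> (\<Phi> \<tau> p)) (push i v dv \<tau> B (\<Phi> \<tau> p))) - torus_integral (\<lambda>p. vdot (\<psi> p) (B p))"
    unfolding torus_integral_def
  proof (rule set_integral_diff(2))
    have "bounded_borel (\<lambda>x. vdot (\<psi> x) (push i v dv \<tau> B x))"
      by (intro bounded_borel_vdot \<psi>b bounded_borel_push Bb)
    from bounded_borel_compose[OF this flow_measurable]
    show "set_integrable lborel (cbox 0 1) (\<lambda>p. vdot (\<psi> (\<Phi> \<tau> p)) (push i v dv \<tau> B (\<Phi> \<tau> p)))" by (rule int)
    show "set_integrable lborel (cbox 0 1) (\<lambda>p. vdot (\<psi> p) (B p))"
      by (intro int bounded_borel_vdot \<psi>b Bb)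
  qed
  also have "torus_integral (\<lambda>p. vdot (\<psi> (\<Phi> \<tau> p)) (push i v dv \<tau> B (\<Phi> \<tau> p)))
      = torus_integral (\<lambda>x. vdot (\<psi> x) (push i v dv \<tau> B x))"
  proof (rule torus_integral_flow)
    show "bounded_borel (\<lambda>x. vdot (\<psi> x) (push i v dv \<tau> B x))"
      by (intro bounded_borel_vdot \<psi>b bounded_borel_push Bb)
    show "torus_periodic (\<lambda>x. vdot (\<psi> x) (push i v dv \<tau> B x))"
      using torus_smooth_periodic[OF \<psi>] torus_periodic_push[OF Bp] by (simp add: torus_periodic_def)
  qed
  finally show "torus_integral (\<lambda>x. vdot (\<psi> x) (push i v dv \<tau> B x))
      = torus_integral (\<lambda>x. vdot (\<psi> x) (B x)) + (LINT s:{0..\<tau>}|lborel. R s)" by simp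
qed

end

section \<open>The velocity field\<close>

lemma torus_test_add:
  assumes f: "torus_test f df" and g: "torus_test g dg"
  shows "torus_test (\<lambda>x. f x + g x) (\<lambda>x. df x + dg x)"
proof -
  note F = torus_testD[OF f] and G = torus_testD[OF g]
  obtain L where L: "L-lipschitz_on UNIV f" using F(3) by blast
  obtain L' where L': "L'-lipschitz_on UNIV g" using G(3) by blast
  have "AE x in lborel. ((\<lambda>x. f x + g x) has_derivative (\<lambda>h. (df x + dg x) \<bullet> h)) (at x)"
    using F(6) G(6) by eventually_elim (auto simp: inner_add_left intro: has_derivative_add)
  then show ?thesis
    unfolding torus_test_def using F(1,4) G(1,4) lipschitz_on_add[OF L L']
      bounded_borel_add[OF F(2) G(2)] bounded_borel_add[OF F(5) G(5)]
    by (auto simp: torus_periodic_def)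
qed

lemma torus_test_scale:
  assumes f: "torus_test f df"
  shows "torus_test (\<lambda>x. c * f x) (\<lambda>x. c *\<^sub>R df x)"
proof -
  note F = torus_testD[OF f]
  obtain L where L: "L-lipschitz_on UNIV f" using F(3) by blast
  have AE: "AE x in lborel. ((\<lambda>x. c * f x) has_derivative (\<lambda>h. (c *\<^sub>R df x) \<bullet> h)) (at x)"
    using F(6) by eventually_elim (auto intro: has_derivative_mult_right)
  have lip: "(\<bar>c\<bar> * L)-lipschitz_on UNIV (\<lambda>x. c * f x)"
    using lipschitz_on_cmult_real[OF L, of c] by simp
  have "torus_periodic (\<lambda>x. c * f x)" "torus_periodic (\<lambda>x. c *\<^sub>R df x)"
    using F(1,4) by (simp_all add: torus_periodic_def)
  moreover have "bounded_borel (\<lambda>x. c * f x)" "bounded_borel (\<lambda>x. c *\<^sub>R df x)"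
    using bounded_borel_scaleR[OF bounded_borel_const F(2), of c]
      bounded_borel_scaleR[OF bounded_borel_const F(5), of c] by simp_all
  ultimately show ?thesis unfolding torus_test_def using AE lip by blast
qed

lemma negligible_coordinate_countable:
  fixes j :: "'n::finite"
  assumes "countable S"
  shows "negligible {x :: real ^ 'n. x $ j \<in> S}"
proof -
  have "{x :: real ^ 'n. x $ j \<in> S} = \<Union>((\<lambda>c. {x. x \<bullet> axis j 1 = c}) ` S)"
    by (auto simp: inner_axis)
  moreover have "negligible \<dots>"
    by (rule negligible_countable_Union)
       (use assms in \<open>auto intro!: negligible_standard_hyperplane simp: axis_in_Basis_iff\<close>)
  ultimately show ?thesis by simp
qed

lemma nth_measurable: "(\<lambda>x::real ^ 'n. x $ j) \<in> borel_measurable borel"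
  by (intro borel_measurable_continuous_onI continuous_intros)

lemma torus_test_coordinate:
  fixes f f' :: "real \<Rightarrow> real" and j :: "'n::finite"
  assumes f: "bounded_borel f" "\<And>y. f (y + 1) = f y" "L-lipschitz_on UNIV f"
    and f': "bounded_borel f'" "\<And>y. f' (y + 1) = f' y"
    and S: "countable S" "\<And>y. y \<notin> S \<Longrightarrow> (f has_real_derivative f' y) (at y)"
  shows "torus_test (\<lambda>x::real ^ 'n. f (x $ j)) (\<lambda>x. axis j (f' (x $ j)))"
  unfolding torus_test_def
proof (intro conjI exI)
  show "torus_periodic (\<lambda>x::real ^ 'n. f (x $ j))"
    "torus_periodic (\<lambda>x::real ^ 'n. axis j (f' (x $ j)) :: real ^ 'n)"
    using f(2) f'(2) by (auto simp: torus_periodic_def axis_def)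
  show "bounded_borel (\<lambda>x::real ^ 'n. f (x $ j))"
    by (rule bounded_borel_compose[OF f(1) nth_measurable])
  show "bounded_borel (\<lambda>x::real ^ 'n. axis j (f' (x $ j)) :: real ^ 'n)"
    by (rule bounded_borel_axis[OF bounded_borel_compose[OF f'(1) nth_measurable]])
  show "L-lipschitz_on UNIV (\<lambda>x::real ^ 'n. f (x $ j))"
  proof (rule lipschitz_onI)
    fix x y :: "real ^ 'n"
    have "dist (f (x $ j)) (f (y $ j)) \<le> L * dist (x $ j) (y $ j)" by (rule lipschitz_onD[OF f(3)]) auto
    also have "\<dots> \<le> L * dist x y"
      using lipschitz_on_nonneg[OF f(3)] by (intro mult_left_mono dist_vec_nth_le)
    finally show "dist (f (x $ j)) (f (y $ j)) \<le> L * dist x y" .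
  qed (rule lipschitz_on_nonneg[OF f(3)])
  have "AE x::real^'n in lborel. x $ j \<notin> S"
    unfolding AE_lborel_iff_negligible using negligible_coordinate_countable[OF S(1), of j] by auto
  then show "AE x::real^'n in lborel. ((\<lambda>x. f (x $ j)) has_derivative (\<lambda>h. axis j (f' (x $ j)) \<bullet> h)) (at x)"
  proof eventually_elim
    case (elim x)
    have "((\<lambda>x::real ^ 'n. f (x $ j)) has_derivative (\<lambda>h. f' (x $ j) * (h $ j))) (at x)"
      by (rule has_derivative_compose[OF bounded_linear_imp_has_derivative[OF bounded_linear_vec_nth]])
         (use S(2)[OF elim] in \<open>simp add: has_field_derivative_def\<close>)
    then show ?case by (simp add: inner_axis' mult.commute)
  qed
qed

text \<open>
  Differentiability fails only on the planes through the half-integers.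
\<close>

lemma torus_test_tent:
  "torus_test (\<lambda>x::real ^ 'n. tent (x $ j)) (\<lambda>x. axis j (tent_slope (x $ j)))"
proof (rule torus_test_coordinate)
  show "bounded_borel tent"
    using tent_nonneg tent_le by (intro bounded_borelI[where K="1/2"] measurable_tent) auto
  show "bounded_borel tent_slope"
    by (intro bounded_borelI[where K=1] measurable_tent_slope) simp
  show "1-lipschitz_on UNIV tent"
    by (rule lipschitz_onI) (use tent_lipschitz in \<open>auto simp: dist_real_def\<close>)
  show "countable (range (\<lambda>k::int. of_int k / 2 :: real))" by simp
  fix y :: real assume y: "y \<notin> range (\<lambda>k::int. of_int k / 2)"
  define k where "k = \<lfloor>2 * y\<rfloor>"
  have "of_int k / 2 \<le> y" "y < (of_int k + 1) / 2"
    using floor_correct[of "2 * y"] by (simp_all add: k_def field_simps)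
  moreover have "y \<noteq> of_int k / 2" using y by blast
  ultimately have k: "of_int k / 2 < y" "y < (of_int k + 1) / 2" by simp_all
  let ?s = "if even k then - 1 else 1 :: real"
  have s: "tent_slope y = ?s" using tent_on_half(2)[of y k y] k by auto
  have "((\<lambda>z. tent y + ?s * (z - y)) has_real_derivative ?s) (at y)"
    by (auto intro!: derivative_eq_intros)
  then show "(tent has_real_derivative tent_slope y) (at y)"
    unfolding s
  proof (rule has_field_derivative_transform_within_open[where S="{of_int k / 2<..<(of_int k + 1) / 2 :: real}"])
    fix z :: real assume z: "z \<in> {of_int k / 2<..<(of_int k + 1) / 2}"
    then show "tent y + ?s * (z - y) = tent z" using k by (intro tent_on_half(1)[symmetric]) auto
  qed (use k in auto)
qed simp_all

text \<open>
  Scaled so that $e^{2\pi i\,\mathrm{phase}}$ is the twist.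
\<close>

definition phase :: "real \<Rightarrow> real" where
  "phase y = sin (2 * pi * y) / (2 * pi)"

lemma phase_add_one [simp]: "phase (y + 1) = phase y"
  by (simp add: phase_def distrib_left)

lemma cis_phase: "cis (2 * pi * phase y) = twist y"
  by (simp add: phase_def twist_def)

lemma phase_lipschitz: "1-lipschitz_on UNIV phase"
proof (rule lipschitz_onI)
  fix x y
  have "\<bar>sin (2 * pi * x) - sin (2 * pi * y)\<bar> \<le> \<bar>2 * pi * x - 2 * pi * y\<bar>" by (rule abs_sin_diff_le)
  also have "\<dots> = 2 * pi * \<bar>x - y\<bar>" by (simp add: abs_mult flip: right_diff_distrib)
  finally show "dist (phase x) (phase y) \<le> 1 * dist x y"
    by (simp add: phase_def dist_real_def field_simps flip: diff_divide_distrib)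
qed simp

lemma torus_test_phase:
  "torus_test (\<lambda>x::real ^ 'n. phase (x $ j)) (\<lambda>x. axis j (cos (2 * pi * x $ j)))"
proof (rule torus_test_coordinate[where f'="\<lambda>y. cos (2 * pi * y)" and S="{}"])
  show "bounded_borel phase"
  proof (rule bounded_borelI[where K="1 / (2 * pi)"])
    show "phase \<in> borel_measurable borel"
      unfolding phase_def by (intro borel_measurable_continuous_onI continuous_intros) auto
    show "norm (phase y) \<le> 1 / (2 * pi)" for y
      using abs_sin_le_one[of "2 * pi * y"] by (simp add: phase_def divide_right_mono)
  qed
  show "bounded_borel (\<lambda>y. cos (2 * pi * y))"
    by (rule bounded_borelI[where K=1]) (auto intro!: borel_measurable_continuous_onI continuous_intros)
  show "cos (2 * pi * (y + 1)) = cos (2 * pi * y)" for y by (simp add: distrib_left)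
  show "(phase has_real_derivative cos (2 * pi * y)) (at y)" for y
    unfolding phase_def by (auto intro!: derivative_eq_intros)
qed (use phase_lipschitz in auto)

definition V_profile :: "real \<Rightarrow> real ^ 3 \<Rightarrow> real" where "V_profile \<alpha> x = 2 * \<alpha> * tent (x $ 1)"
definition V_gradient :: "real \<Rightarrow> real ^ 3 \<Rightarrow> real ^ 3" where
  "V_gradient \<alpha> x = (2 * \<alpha>) *\<^sub>R axis 1 (tent_slope (x $ 1))"
definition H_profile :: "real \<Rightarrow> real ^ 3 \<Rightarrow> real" where "H_profile \<alpha> x = 2 * \<alpha> * tent (x $ 2)"
definition H_gradient :: "real \<Rightarrow> real ^ 3 \<Rightarrow> real ^ 3" where
  "H_gradient \<alpha> x = (2 * \<alpha>) *\<^sub>R axis 2 (tent_slope (x $ 2))"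
definition twist_phase :: "real ^ 2 \<Rightarrow> real" where "twist_phase p = phase (p $ 1) + phase (p $ 2)"
definition Z_profile :: "real ^ 3 \<Rightarrow> real" where "Z_profile x = - 1 * (phase (x $ 1) + phase (x $ 2))"
definition Z_gradient :: "real ^ 3 \<Rightarrow> real ^ 3" where
  "Z_gradient x = (- 1) *\<^sub>R (axis 1 (cos (2 * pi * x $ 1)) + axis 2 (cos (2 * pi * x $ 2)))"

lemma V_field_eq: "V_field \<alpha> = (\<lambda>x. V_profile \<alpha> x *\<^sub>R axis 2 1)"
  by (auto simp: V_field_def V_profile_def tent_def vec_eq_iff forall_3 vector_3 axis_def)

lemma H_field_eq: "H_field \<alpha> = (\<lambda>x. H_profile \<alpha> x *\<^sub>R axis 1 1)"
  by (auto simp: H_field_def H_profile_def tent_def vec_eq_iff forall_3 vector_3 axis_def)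

lemma Z_field_eq: "Z_field twist_phase = (\<lambda>x. Z_profile x *\<^sub>R axis 3 1)"
  by (auto simp: Z_field_def Z_profile_def twist_phase_def vec_eq_iff forall_3 vector_3 vector_2 axis_def)

interpretation V: shear_flow3 2 "V_profile \<alpha>" "V_gradient \<alpha>" for \<alpha>
proof unfold_locales
  show "torus_test (V_profile \<alpha>) (V_gradient \<alpha>)"
    unfolding V_profile_def[abs_def] V_gradient_def[abs_def] by (intro torus_test_scale torus_test_tent)
qed (simp_all add: V_profile_def V_gradient_def axis_def)

interpretation H: shear_flow3 1 "H_profile \<alpha>" "H_gradient \<alpha>" for \<alpha>
proof unfold_locales
  show "torus_test (H_profile \<alpha>) (H_gradient \<alpha>)"
    unfolding H_profile_def[abs_def] H_gradient_def[abs_def] by (intro torus_test_scale torus_test_tent)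
qed (simp_all add: H_profile_def H_gradient_def axis_def)

interpretation Z: shear_flow3 3 Z_profile Z_gradient
proof unfold_locales
  show "torus_test Z_profile Z_gradient"
    unfolding Z_profile_def[abs_def] Z_gradient_def[abs_def]
    by (intro torus_test_scale torus_test_add torus_test_phase)
qed (simp_all add: Z_profile_def Z_gradient_def axis_def)

lemma shear_flow_rest: "shear_flow i (\<lambda>x. 0) (\<lambda>x. 0)"
proof unfold_locales
  have "((\<lambda>x::real ^ 'a. 0::real) has_derivative (\<lambda>h. 0 \<bullet> h)) (at x)" for x
    by (simp only: inner_zero_left has_derivative_const)
  then have "AE x in lborel. ((\<lambda>x::real ^ 'a. 0::real) has_derivative (\<lambda>h. 0 \<bullet> h)) (at x)" by blast
  moreover have "0-lipschitz_on UNIV (\<lambda>x::real ^ 'a. 0::real)" by (rule lipschitz_onI) auto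
  ultimately show "torus_test (\<lambda>x. 0) (\<lambda>x::real ^ 'a. 0)"
    unfolding torus_test_def torus_periodic_def by (blast intro: bounded_borel_const)
qed simp_all

lemma torus_lipschitz_twist_phase: "torus_lipschitz twist_phase"
proof -
  have "torus_test twist_phase (\<lambda>x. axis 1 (cos (2 * pi * x $ 1)) + axis 2 (cos (2 * pi * x $ 2)))"
    unfolding twist_phase_def[abs_def] by (intro torus_test_add torus_test_phase)
  from torus_testD(1,3)[OF this] show ?thesis unfolding torus_lipschitz_def by blast
qed

lemma velocity_cases:
  obtains "velocity \<alpha> N twist_phase t = (\<lambda>x. 0 *\<^sub>R axis 1 1)"
  | "velocity \<alpha> N twist_phase t = (\<lambda>x. V_profile \<alpha> x *\<^sub>R axis 2 1)"
  | "velocity \<alpha> N twist_phase t = (\<lambda>x. H_profile \<alpha> x *\<^sub>R axis 1 1)"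
  | "velocity \<alpha> N twist_phase t = (\<lambda>x. Z_profile x *\<^sub>R axis 3 1)"
proof -
  define s where "s = t - (real N + 3) * of_int \<lfloor>t / (real N + 3)\<rfloor>"
  have u: "velocity \<alpha> N twist_phase t x =
      (if s < real N then 0 else if s < real N + 1/2 then V_field \<alpha> x
       else if s < real N + 1 then H_field \<alpha> x else if s < real N + 2 then 0 else Z_field twist_phase x)" for x
    unfolding velocity_def Let_def s_def ..
  show ?thesis
  proof (cases "s < real N \<or> \<not> s < real N + 1 \<and> s < real N + 2")
    case True
    then have "velocity \<alpha> N twist_phase t x = 0 *\<^sub>R axis 1 1" for x unfolding u by auto
    then show ?thesis using that(1) by blast
  next
    case F: False
    then consider "\<not> s < real N" "s < real N + 1/2" | "\<not> s < real N" "\<not> s < real N + 1/2" "s < real N + 1"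
      | "\<not> s < real N + 2" by argo
    then show ?thesis
    proof cases
      case 1
      then have "velocity \<alpha> N twist_phase t x = V_field \<alpha> x" for x unfolding u by simp
      then show ?thesis using that(2) unfolding V_field_eq by blast
    next
      case 2
      then have "velocity \<alpha> N twist_phase t x = H_field \<alpha> x" for x unfolding u by simp
      then show ?thesis using that(3) unfolding H_field_eq by blast
    next
      case 3
      then have "velocity \<alpha> N twist_phase t x = Z_field twist_phase x" for x unfolding u by simp
      then show ?thesis using that(4) unfolding Z_field_eq by blast
    qed
  qed
qed

lemma (in shear_flow) profile_field_bounds:
  "\<exists>M. \<forall>M'\<ge>M. (\<forall>x. norm (v x *\<^sub>R axis i 1 :: real ^ 'n) \<le> M')
      \<and> M'-lipschitz_on UNIV (\<lambda>x. v x *\<^sub>R axis i 1 :: real ^ 'n)"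
proof -
  obtain L where L: "L-lipschitz_on UNIV v" using torus_testD(3)[OF v_test] by blast
  obtain K where K: "K \<ge> 0" "\<And>x. norm (v x) \<le> K" using bounded_borel_bound[OF torus_testD(2)[OF v_test]] by blast
  have "M'-lipschitz_on UNIV (\<lambda>x. v x *\<^sub>R axis i 1 :: real ^ 'n)" if LM: "L \<le> M'" for M'
  proof (rule lipschitz_onI)
    fix x y
    have "v x *\<^sub>R axis i 1 - v y *\<^sub>R axis i 1 = (v x - v y) *\<^sub>R (axis i 1 :: real ^ 'n)"
      by (simp add: scaleR_diff_left)
    then have "dist (v x *\<^sub>R axis i 1 :: real ^ 'n) (v y *\<^sub>R axis i 1) = dist (v x) (v y)"
      by (simp only: dist_norm norm_scaleR norm_axis_1 real_norm_def mult_1_right)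
    also have "\<dots> \<le> L * dist x y" by (rule lipschitz_onD[OF L UNIV_I UNIV_I])
    also have "\<dots> \<le> M' * dist x y" by (rule mult_right_mono[OF LM zero_le_dist])
    finally show "dist (v x *\<^sub>R axis i 1 :: real ^ 'n) (v y *\<^sub>R axis i 1) \<le> M' * dist x y" .
  qed (rule order_trans[OF lipschitz_on_nonneg[OF L] LM])
  moreover have "norm (v x *\<^sub>R axis i 1 :: real ^ 'n) \<le> M'" if "K \<le> M'" for x M'
    using order_trans[OF K(2)[of x] that] by (simp only: norm_scaleR norm_axis_1 real_norm_def mult_1_right)
  ultimately have "(\<forall>x. norm (v x *\<^sub>R axis i 1 :: real ^ 'n) \<le> M')
      \<and> M'-lipschitz_on UNIV (\<lambda>x. v x *\<^sub>R axis i 1 :: real ^ 'n)" if "max L K \<le> M'" for M'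
    using max.boundedE[OF that] by blast
  then show ?thesis by blast
qed

lemma (in shear_flow) profile_field_div_free: "div_free (\<lambda>x. v x *\<^sub>R axis i 1 :: real ^ 'n)"
proof -
  have "strong_div_free (\<lambda>x. axis i (v x))"
    by (rule strong_div_free_axis[OF torus_testD(2)[OF v_test] v_inv])
  moreover have "(\<lambda>x. axis i (v x)) = (\<lambda>x. v x *\<^sub>R axis i 1 :: real ^ 'n)"
    by (auto simp: vec_eq_iff axis_def)
  ultimately show ?thesis using strong_div_free_imp_div_free by metis
qed

lemma (in shear_flow) profile_field_measurable:
  "(\<lambda>x. v x *\<^sub>R axis i 1 :: real ^ 'n) \<in> borel_measurable borel"
  using bounded_borel_measurable[OF torus_testD(2)[OF v_test]] by simp

lemma admissible_velocity_twist:
  "admissible_velocity (velocity \<alpha> N twist_phase)"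
  unfolding admissible_velocity_def
proof (intro conjI)
  let ?u = "velocity \<alpha> N twist_phase"
  show "\<exists>T>0. \<forall>t x. ?u (t + T) x = ?u t x"
  proof (intro exI[of _ "real N + 3"] conjI allI)
    fix t x
    have "(t + (real N + 3)) / (real N + 3) = t / (real N + 3) + 1" by (simp add: field_simps)
    then have f: "\<lfloor>(t + (real N + 3)) / (real N + 3)\<rfloor> = \<lfloor>t / (real N + 3)\<rfloor> + 1" by simp
    have "t + (real N + 3) - (real N + 3) * of_int (\<lfloor>t / (real N + 3)\<rfloor> + 1)
        = t - (real N + 3) * of_int \<lfloor>t / (real N + 3)\<rfloor>" by (simp add: algebra_simps)
    then show "?u (t + (real N + 3)) x = ?u t x" unfolding velocity_def Let_def f by simp
  qed auto
  have per: "torus_periodic (\<lambda>x. v x *\<^sub>R axis i 1)" if "torus_periodic v" for i v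
    using that by (simp add: torus_periodic_def)
  show "\<forall>t. torus_periodic (?u t)"
  proof
    fix t show "torus_periodic (?u t)"
      by (cases rule: velocity_cases[of \<alpha> N t])
         (auto intro!: per torus_testD(1)[OF V.v_test] torus_testD(1)[OF H.v_test] torus_testD(1)[OF Z.v_test]
            simp: torus_periodic_def[of "\<lambda>x. 0"])
  qed
  show "(\<lambda>(t, x). ?u t x) \<in> borel_measurable (lborel \<Otimes>\<^sub>M lborel)"
  proof -
    have [measurable]: "V_field \<alpha> \<in> borel_measurable borel" "H_field \<alpha> \<in> borel_measurable borel"
      "Z_field twist_phase \<in> borel_measurable borel"
      unfolding V_field_eq H_field_eq Z_field_eq
      by (rule V.profile_field_measurable H.profile_field_measurable Z.profile_field_measurable)+
    show ?thesis unfolding velocity_def Let_def by measurable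
  qed
  show "AE t in lborel. div_free (?u t)"
  proof (rule AE_I2)
    fix t show "div_free (?u t)"
      by (cases rule: velocity_cases[of \<alpha> N t])
         (simp_all only: V.profile_field_div_free H.profile_field_div_free Z.profile_field_div_free
            shear_flow.profile_field_div_free[OF shear_flow_rest])
  qed
  obtain MV where MV: "\<forall>M'\<ge>MV. (\<forall>x. norm (V_profile \<alpha> x *\<^sub>R axis 2 1 :: real ^ 3) \<le> M')
      \<and> M'-lipschitz_on UNIV (\<lambda>x. V_profile \<alpha> x *\<^sub>R axis 2 1 :: real ^ 3)"
    using V.profile_field_bounds[of \<alpha>] by blast
  obtain MH where MH: "\<forall>M'\<ge>MH. (\<forall>x. norm (H_profile \<alpha> x *\<^sub>R axis 1 1 :: real ^ 3) \<le> M')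
      \<and> M'-lipschitz_on UNIV (\<lambda>x. H_profile \<alpha> x *\<^sub>R axis 1 1 :: real ^ 3)"
    using H.profile_field_bounds[of \<alpha>] by blast
  obtain MZ where MZ: "\<forall>M'\<ge>MZ. (\<forall>x. norm (Z_profile x *\<^sub>R axis 3 1 :: real ^ 3) \<le> M')
      \<and> M'-lipschitz_on UNIV (\<lambda>x. Z_profile x *\<^sub>R axis 3 1 :: real ^ 3)"
    using Z.profile_field_bounds by blast
  obtain MR where MR: "\<forall>M'\<ge>MR. (\<forall>x::real ^ 3. norm (0 *\<^sub>R axis 1 1 :: real ^ 3) \<le> M')
      \<and> M'-lipschitz_on UNIV (\<lambda>x::real ^ 3. 0 *\<^sub>R axis 1 1 :: real ^ 3)"
    using shear_flow.profile_field_bounds[OF shear_flow_rest] by blast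
  define M where "M = Max {MV, MH, MZ, MR}"
  have M: "MV \<le> M" "MH \<le> M" "MZ \<le> M" "MR \<le> M" unfolding M_def by (rule Max_ge; simp)+
  show "\<exists>M. AE t in lborel. (\<forall>x. norm (?u t x) \<le> M) \<and> M-lipschitz_on UNIV (?u t)"
  proof (intro exI[of _ M] AE_I2)
    fix t show "(\<forall>x. norm (?u t x) \<le> M) \<and> M-lipschitz_on UNIV (?u t)"
      using MV[rule_format, OF M(1)] MH[rule_format, OF M(2)] MZ[rule_format, OF M(3)] MR[rule_format, OF M(4)]
      by (cases rule: velocity_cases[of \<alpha> N t]) (simp_all only:, blast+)
  qed
qed

section \<open>The solution of the induction equation\<close>

definition weak_pairing :: "(real ^ 3 \<Rightarrow> real ^ 3) \<Rightarrow> (real ^ 3 \<Rightarrow> complex ^ 3) \<Rightarrow> complex" where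
  "weak_pairing \<psi> B = torus_integral (\<lambda>x. vdot (\<psi> x) (B x))"

definition weak_rate ::
    "(real ^ 3 \<Rightarrow> real ^ 3) \<Rightarrow> (real ^ 3 \<Rightarrow> real ^ 3) \<Rightarrow> (real ^ 3 \<Rightarrow> complex ^ 3) \<Rightarrow> complex" where
  "weak_rate \<psi> w B = torus_integral (\<lambda>x. vdot (curl \<psi> x) (vcross (w x) (B x)))"

text \<open>
  The weak equation restricted to a time interval, with initial time \<open>a\<close>, so that the phases
  of a period can be treated one by one.
\<close>

definition weakly_evolves ::
    "(real \<Rightarrow> real ^ 3 \<Rightarrow> real ^ 3) \<Rightarrow> (real \<Rightarrow> real ^ 3 \<Rightarrow> complex ^ 3) \<Rightarrow> real \<Rightarrow> real \<Rightarrow> bool" where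
  "weakly_evolves u B a b \<longleftrightarrow> (\<forall>\<psi>. torus_smooth \<psi> \<longrightarrow> (\<forall>t\<in>{a..b}.
     set_integrable lborel {a..t} (\<lambda>s. weak_rate \<psi> (u s) (B s)) \<and>
     weak_pairing \<psi> (B t) = weak_pairing \<psi> (B a) + (LINT s:{a..t}|lborel. weak_rate \<psi> (u s) (B s))))"

lemma weakly_evolves_trans:
  assumes 1: "weakly_evolves u B a b" and 2: "weakly_evolves u B b c" and ab: "a \<le> b"
  shows "weakly_evolves u B a c"
  unfolding weakly_evolves_def
proof (intro allI impI ballI)
  fix \<psi> :: "real ^ 3 \<Rightarrow> real ^ 3" and t
  assume \<psi>: "torus_smooth \<psi>" and t: "t \<in> {a..c}"
  let ?R = "\<lambda>s. weak_rate \<psi> (u s) (B s)"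
  show "set_integrable lborel {a..t} ?R \<and>
     weak_pairing \<psi> (B t) = weak_pairing \<psi> (B a) + (LINT s:{a..t}|lborel. ?R s)"
  proof (cases "t \<le> b")
    case True
    then show ?thesis using t by (intro 1[unfolded weakly_evolves_def, rule_format, OF \<psi>]) auto
  next
    case False
    then have tb: "t \<in> {b..c}" using t by auto
    have A: "set_integrable lborel {a..b} ?R"
      "weak_pairing \<psi> (B b) = weak_pairing \<psi> (B a) + (LINT s:{a..b}|lborel. ?R s)"
      using 1[unfolded weakly_evolves_def, rule_format, OF \<psi>, of b] ab by auto
    have B: "set_integrable lborel {b..t} ?R"
      "weak_pairing \<psi> (B t) = weak_pairing \<psi> (B b) + (LINT s:{b..t}|lborel. ?R s)"
      using 2[unfolded weakly_evolves_def, rule_format, OF \<psi> tb] by auto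
    have un: "{a..t} = {a..b} \<union> {b..t}" using ab False by auto
    have "set_integrable lborel {a..t} ?R" unfolding un by (intro set_integrable_Un A B) auto
    moreover have "(LINT s:{a..t}|lborel. ?R s) = (LINT s:{a..b}|lborel. ?R s) + (LINT s:{b..t}|lborel. ?R s)"
      unfolding un
    proof (rule set_integral_Un_AE[OF _ _ _ A(1) B(1)])
      show "AE s in lborel. \<not> (s \<in> {a..b} \<and> s \<in> {b..t})"
        using AE_lborel_singleton[of b] by eventually_elim auto
    qed auto
    ultimately show ?thesis unfolding B(2) A(2) by simp
  qed
qed

text \<open>
  The velocity is prescribed on the half-open interval only: at the end point the next phase
  has already begun, but a single time is negligible.
\<close>

lemma (in shear_flow3) weakly_evolves_push:
  assumes B0: "regular_field (B a)" and ab: "a \<le> b"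
    and u: "\<And>s. a \<le> s \<Longrightarrow> s < b \<Longrightarrow> u s = (\<lambda>x. v x *\<^sub>R axis i 1)"
    and B: "\<And>s. a \<le> s \<Longrightarrow> s \<le> b \<Longrightarrow> B s = push i v dv (s - a) (B a)"
  shows "weakly_evolves u B a b"
  unfolding weakly_evolves_def
proof (intro allI impI ballI)
  fix \<psi> :: "real ^ 3 \<Rightarrow> real ^ 3" and t
  assume \<psi>: "torus_smooth \<psi>" and t: "t \<in> {a..b}"
  let ?R = "\<lambda>s. weak_rate \<psi> (u s) (B s)"
  define R0 where "R0 s = weak_rate \<psi> (\<lambda>x. v x *\<^sub>R axis i 1) (push i v dv s (B a))" for s
  have \<tau>: "0 \<le> t - a" using t by simp
  note W = weak_equation_push[OF \<psi> B0 \<tau>, folded weak_rate_def, folded R0_def]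
  define F where "F s = indicator {0..t - a} s *\<^sub>R R0 s" for s
  have F: "integrable lborel F" using W(1) unfolding set_integrable_def F_def .
  have shift: "integrable lborel (\<lambda>s. F (- a + 1 * s))"
    by (rule lborel_integrable_real_affine[OF F]) simp
  have "integral\<^sup>L lborel F = \<bar>1\<bar> *\<^sub>R (\<integral>s. F (- a + 1 * s) \<partial>lborel)"
    by (rule lborel_integral_real_affine) simp
  then have shiftI: "(LINT s|lborel. F (- a + 1 * s)) = integral\<^sup>L lborel F" by simp
  define G where "G s = indicator {a..t} s *\<^sub>R ?R s" for s
  have GF: "G s = F (- a + 1 * s)" if "s \<noteq> b" for s
  proof (cases "s \<in> {a..t}")
    case True
    then have "a \<le> s" "s < b" using that t by auto
    then have "?R s = R0 (s - a)" using u[of s] B[of s] unfolding R0_def by (simp only:)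
    then show ?thesis using True by (simp add: G_def F_def)
  next
    case False
    then show ?thesis by (auto simp: G_def F_def indicator_def)
  qed
  have "G = (\<lambda>s. if s = b then G b else F (- a + 1 * s))" using GF by auto
  moreover have "\<dots> \<in> borel_measurable lborel"
    using borel_measurable_integrable[OF shift] by measurable
  ultimately have G_m: "G \<in> borel_measurable lborel" by simp
  have AE: "AE s in lborel. G s = F (- a + 1 * s)"
    using AE_lborel_singleton[of b] by eventually_elim (rule GF)
  have G: "integrable lborel G"
    using integrable_cong_AE[OF G_m borel_measurable_integrable[OF shift] AE] shift by simp
  have I: "integral\<^sup>L lborel G = (LINT s:{0..t - a}|lborel. R0 s)"
    unfolding integral_cong_AE[OF G_m borel_measurable_integrable[OF shift] AE] shiftI
    by (simp add: set_lebesgue_integral_def F_def[abs_def])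
  show "set_integrable lborel {a..t} ?R \<and>
     weak_pairing \<psi> (B t) = weak_pairing \<psi> (B a) + (LINT s:{a..t}|lborel. ?R s)"
  proof (intro conjI)
    show "set_integrable lborel {a..t} ?R" using G unfolding set_integrable_def G_def[abs_def] .
    have "B t = push i v dv (t - a) (B a)" using B[of t] t by simp
    then have "weak_pairing \<psi> (B t) = weak_pairing \<psi> (B a) + (LINT s:{0..t - a}|lborel. R0 s)"
      using W(2) unfolding weak_pairing_def by (simp only:)
    moreover have "(LINT s:{a..t}|lborel. ?R s) = integral\<^sup>L lborel G"
      unfolding set_lebesgue_integral_def G_def[abs_def] ..
    ultimately show "weak_pairing \<psi> (B t) = weak_pairing \<psi> (B a) + (LINT s:{a..t}|lborel. ?R s)"
      unfolding I by simp
  qed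
qed

lemma weakly_evolves_rest:
  assumes B0: "regular_field (B a)" and ab: "a \<le> b"
    and u: "\<And>s. a \<le> s \<Longrightarrow> s < b \<Longrightarrow> u s = (\<lambda>x. 0)"
    and B: "\<And>s. a \<le> s \<Longrightarrow> s \<le> b \<Longrightarrow> B s = B a"
  shows "weakly_evolves u B a b"
proof -
  have sf: "shear_flow3 (1::3) (\<lambda>x. 0) (\<lambda>x. 0)" unfolding shear_flow3_def by (rule shear_flow_rest)
  have p: "push (1::3) (\<lambda>x. 0) (\<lambda>x. 0) s C = C" for s C
    by (rule ext) (simp add: push_def shear_map_def vdot_def axis_eq_0_iff)
  show ?thesis
  proof (rule shear_flow3.weakly_evolves_push[where u=u and B=B and a=a and b=b, OF sf, OF B0 ab])
    fix s assume s: "a \<le> s"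
    show "u s = (\<lambda>x. 0 *\<^sub>R axis 1 1)" if "s < b" using u[OF s that] by simp
    show "B s = push 1 (\<lambda>x. 0) (\<lambda>x. 0) (s - a) (B a)" if "s \<le> b" unfolding p by (rule B[OF s that])
  qed
qed

definition V_push :: "real \<Rightarrow> real \<Rightarrow> (real ^ 3 \<Rightarrow> complex ^ 3) \<Rightarrow> real ^ 3 \<Rightarrow> complex ^ 3" where
  "V_push \<alpha> = push 2 (V_profile \<alpha>) (V_gradient \<alpha>)"
definition H_push :: "real \<Rightarrow> real \<Rightarrow> (real ^ 3 \<Rightarrow> complex ^ 3) \<Rightarrow> real ^ 3 \<Rightarrow> complex ^ 3" where
  "H_push \<alpha> = push 1 (H_profile \<alpha>) (H_gradient \<alpha>)"
definition Z_push :: "real \<Rightarrow> (real ^ 3 \<Rightarrow> complex ^ 3) \<Rightarrow> real ^ 3 \<Rightarrow> complex ^ 3" where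
  "Z_push = push 3 Z_profile Z_gradient"

text \<open>
  The part of a phase of length \<open>l\<close> that has elapsed at time \<open>s\<close> after its start.
\<close>

definition elapsed :: "real \<Rightarrow> real \<Rightarrow> real" where
  "elapsed l s = max 0 (min l s)"

text \<open>
  The field at time \<open>s\<close> of a period that it entered as \<open>B\<close>. A phase that has not begun
  acts by \<open>push\<close> with time \<open>0\<close>, a finished one with its full duration, so one
  formula covers the whole period, including its end.
\<close>

definition stage :: "real \<Rightarrow> nat \<Rightarrow> real \<Rightarrow> (real ^ 3 \<Rightarrow> complex ^ 3) \<Rightarrow> real ^ 3 \<Rightarrow> complex ^ 3" where
  "stage \<alpha> N s B = Z_push (elapsed 1 (s - (real N + 2)))
     (H_push \<alpha> (elapsed (1/2) (s - (real N + 1/2))) (V_push \<alpha> (elapsed (1/2) (s - real N)) B))"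

definition period_map :: "real \<Rightarrow> (real ^ 3 \<Rightarrow> complex ^ 3) \<Rightarrow> real ^ 3 \<Rightarrow> complex ^ 3" where
  "period_map \<alpha> B = Z_push 1 (H_push \<alpha> (1/2) (V_push \<alpha> (1/2) B))"

definition solution ::
    "real \<Rightarrow> nat \<Rightarrow> (real ^ 3 \<Rightarrow> complex ^ 3) \<Rightarrow> real \<Rightarrow> real ^ 3 \<Rightarrow> complex ^ 3" where
  "solution \<alpha> N B t = (let k = nat \<lfloor>t / (real N + 3)\<rfloor> in
     stage \<alpha> N (t - real k * (real N + 3)) ((period_map \<alpha> ^^ k) B))"

lemma push_0: "V_push \<alpha> 0 B = B" "H_push \<alpha> 0 B = B" "Z_push 0 B = B"
  by (simp_all add: V_push_def H_push_def Z_push_def)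

lemma regular_pushes:
  "regular_field B \<Longrightarrow> regular_field (V_push \<alpha> s B)"
  "regular_field B \<Longrightarrow> regular_field (H_push \<alpha> s B)"
  "regular_field B \<Longrightarrow> regular_field (Z_push s B)"
  unfolding V_push_def H_push_def Z_push_def
  by (rule V.regular_field_push H.regular_field_push Z.regular_field_push; assumption)+

lemma regular_stage: "regular_field B \<Longrightarrow> regular_field (stage \<alpha> N s B)"
  unfolding stage_def by (intro regular_pushes)

lemma regular_period_map: "regular_field B \<Longrightarrow> regular_field ((period_map \<alpha> ^^ k) B)"
  by (induction k) (auto simp: period_map_def intro: regular_pushes)

lemma stage_0: "stage \<alpha> N 0 B = B"
  by (simp add: stage_def elapsed_def push_0)

lemma stage_period: "stage \<alpha> N (real N + 3) B = period_map \<alpha> B"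
  by (simp add: stage_def elapsed_def period_map_def)

lemma floor_period:
  assumes "0 \<le> s" "s < real N + 3"
  shows "\<lfloor>(real k * (real N + 3) + s) / (real N + 3)\<rfloor> = int k"
proof -
  have "(real k * (real N + 3) + s) / (real N + 3) = real k + s / (real N + 3)"
    by (simp add: add_divide_distrib)
  moreover have "\<lfloor>s / (real N + 3)\<rfloor> = 0" using assms by (simp add: floor_eq_iff)
  ultimately show ?thesis by simp
qed

lemma solution_stage:
  assumes s: "0 \<le> s" "s \<le> real N + 3"
  shows "solution \<alpha> N B (real k * (real N + 3) + s) = stage \<alpha> N s ((period_map \<alpha> ^^ k) B)"
proof -
  have *: "solution \<alpha> N B (real k * (real N + 3) + s) = stage \<alpha> N s ((period_map \<alpha> ^^ k) B)"
    if "0 \<le> s" "s < real N + 3" for k s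
    using floor_period[OF that, of k] by (simp add: solution_def)
  show ?thesis
  proof (cases "s < real N + 3")
    case True
    then show ?thesis using s(1) by (rule *[rotated])
  next
    case False
    then have s3: "s = real N + 3" using s by simp
    have eq: "real k * (real N + 3) + s = real (Suc k) * (real N + 3) + 0"
      by (simp add: s3 algebra_simps)
    have "solution \<alpha> N B (real (Suc k) * (real N + 3) + 0) = stage \<alpha> N 0 ((period_map \<alpha> ^^ Suc k) B)"
      by (rule *) auto
    then have "solution \<alpha> N B (real k * (real N + 3) + s) = period_map \<alpha> ((period_map \<alpha> ^^ k) B)"
      unfolding eq stage_0 by simp
    then show ?thesis using s3 stage_period by (simp only:)
  qed
qed

lemma velocity_stage:
  assumes "0 \<le> s" "s < real N + 3"
  shows "velocity \<alpha> N twist_phase (real k * (real N + 3) + s) x =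
    (if s < real N then 0 else if s < real N + 1/2 then V_field \<alpha> x
     else if s < real N + 1 then H_field \<alpha> x else if s < real N + 2 then 0 else Z_field twist_phase x)"
  using floor_period[OF assms, of k] by (simp add: velocity_def Let_def mult.commute)

lemma weakly_evolves_period:
  assumes reg: "regular_field B"
  shows "weakly_evolves (velocity \<alpha> N twist_phase) (solution \<alpha> N B)
    (real k * (real N + 3)) (real (Suc k) * (real N + 3))"
proof -
  let ?u = "velocity \<alpha> N twist_phase" and ?B = "solution \<alpha> N B"
  define p where "p = real k * (real N + 3)"
  define C where "C = (period_map \<alpha> ^^ k) B"
  have regC: "regular_field C" unfolding C_def by (rule regular_period_map[OF reg])
  have sol: "?B (p + s) = stage \<alpha> N s C" if "0 \<le> s" "s \<le> real N + 3" for s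
    unfolding p_def C_def by (rule solution_stage[OF that])
  have vel: "?u (p + s) x =
    (if s < real N then 0 else if s < real N + 1/2 then V_field \<alpha> x
     else if s < real N + 1 then H_field \<alpha> x else if s < real N + 2 then 0 else Z_field twist_phase x)"
    if "0 \<le> s" "s < real N + 3" for s x
    unfolding p_def by (rule velocity_stage[OF that])
  have sol': "?B t = stage \<alpha> N (t - p) C" if "p \<le> t" "t \<le> p + real N + 3" for t
    using sol[of "t - p"] that by simp
  have vel': "?u t x =
    (if t - p < real N then 0 else if t - p < real N + 1/2 then V_field \<alpha> x
     else if t - p < real N + 1 then H_field \<alpha> x else if t - p < real N + 2 then 0 else Z_field twist_phase x)"
    if "p \<le> t" "t < p + real N + 3" for t x
    using vel[of "t - p"] that by simp
  have regB: "regular_field (?B t)" if "p \<le> t" "t \<le> p + real N + 3" for t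
    unfolding sol'[OF that] by (rule regular_stage[OF regC])
  have 1: "weakly_evolves ?u ?B p (p + real N)"
  proof (rule weakly_evolves_rest)
    show "regular_field (?B p)" by (rule regB) auto
    fix s assume s: "p \<le> s"
    { assume "s < p + real N" then show "?u s = (\<lambda>x. 0)" using s by (intro ext) (simp add: vel') }
    { assume "s \<le> p + real N" then show "?B s = ?B p" using s by (simp add: sol' stage_def elapsed_def push_0) }
  qed simp
  have 2: "weakly_evolves ?u ?B (p + real N) (p + real N + 1/2)"
  proof (rule V.weakly_evolves_push)
    show "regular_field (?B (p + real N))" by (rule regB) auto
    fix s assume s: "p + real N \<le> s"
    { assume "s < p + real N + 1/2" then show "?u s = (\<lambda>x. V_profile \<alpha> x *\<^sub>R axis 2 1)"
        using s by (intro ext) (simp add: vel' V_field_eq) }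
    { assume "s \<le> p + real N + 1/2"
      then show "?B s = push 2 (V_profile \<alpha>) (V_gradient \<alpha>) (s - (p + real N)) (?B (p + real N))"
        using s by (simp add: sol' stage_def elapsed_def push_0 V_push_def diff_diff_eq) }
  qed simp
  have 3: "weakly_evolves ?u ?B (p + real N + 1/2) (p + real N + 1)"
  proof (rule H.weakly_evolves_push)
    show "regular_field (?B (p + real N + 1/2))" by (rule regB) auto
    fix s assume s: "p + real N + 1/2 \<le> s"
    { assume "s < p + real N + 1" then show "?u s = (\<lambda>x. H_profile \<alpha> x *\<^sub>R axis 1 1)"
        using s by (intro ext) (simp add: vel' H_field_eq) }
    { assume "s \<le> p + real N + 1"
      then show "?B s = push 1 (H_profile \<alpha>) (H_gradient \<alpha>) (s - (p + real N + 1/2)) (?B (p + real N + 1/2))"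
        using s by (simp add: sol' stage_def elapsed_def push_0 H_push_def diff_diff_eq add.assoc) }
  qed simp
  have 4: "weakly_evolves ?u ?B (p + real N + 1) (p + real N + 2)"
  proof (rule weakly_evolves_rest)
    show "regular_field (?B (p + real N + 1))" by (rule regB) auto
    fix s assume s: "p + real N + 1 \<le> s"
    { assume "s < p + real N + 2" then show "?u s = (\<lambda>x. 0)" using s by (intro ext) (simp add: vel') }
    { assume "s \<le> p + real N + 2" then show "?B s = ?B (p + real N + 1)"
        using s by (simp add: sol' stage_def elapsed_def push_0) }
  qed simp
  have 5: "weakly_evolves ?u ?B (p + real N + 2) (p + real N + 3)"
  proof (rule Z.weakly_evolves_push)
    show "regular_field (?B (p + real N + 2))" by (rule regB) auto
    fix s assume s: "p + real N + 2 \<le> s"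
    { assume "s < p + real N + 3" then show "?u s = (\<lambda>x. Z_profile x *\<^sub>R axis 3 1)"
        using s by (intro ext) (simp add: vel' Z_field_eq) }
    { assume "s \<le> p + real N + 3"
      then show "?B s = push 3 Z_profile Z_gradient (s - (p + real N + 2)) (?B (p + real N + 2))"
        using s by (simp add: sol' stage_def elapsed_def push_0 Z_push_def diff_diff_eq add.assoc) }
  qed simp
  have "weakly_evolves ?u ?B p (p + real N + 3)"
    by (rule weakly_evolves_trans[OF weakly_evolves_trans[OF weakly_evolves_trans[OF
          weakly_evolves_trans[OF 1 2] 3] 4] 5]) simp_all
  moreover have "p + real N + 3 = real (Suc k) * (real N + 3)" by (simp add: p_def algebra_simps)
  ultimately show ?thesis by (simp add: p_def)
qed

lemma weakly_evolves_solution: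
  assumes reg: "regular_field B"
  shows "weakly_evolves (velocity \<alpha> N twist_phase) (solution \<alpha> N B) 0 (real k * (real N + 3))"
proof (induction k)
  case 0
  have "weakly_evolves (velocity \<alpha> N twist_phase) (solution \<alpha> N B) 0 0"
  proof (rule weakly_evolves_rest)
    show "regular_field (solution \<alpha> N B 0)"
      using solution_stage[of 0 N \<alpha> B 0] reg by (simp add: stage_0)
  qed auto
  then show ?case by simp
next
  case (Suc k)
  show ?case
    by (rule weakly_evolves_trans[OF Suc weakly_evolves_period[OF reg]]) simp
qed

lemma torus_integral_const: "torus_integral (\<lambda>x::real ^ 'n. c) = (c::real)"
proof -
  have "measure lborel (cbox 0 1 :: (real ^ 'n) set) = 1"
    by (subst measure_lborel_cbox_eq) (auto simp: One_vec[symmetric] inner_sum_left_Basis)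
  then show ?thesis by (simp add: torus_integral_def set_lebesgue_integral_def)
qed

lemma norm_torus_integral_diff_le:
  fixes F :: "real ^ 'n \<Rightarrow> complex"
  assumes F: "set_integrable lborel (cbox 0 1) F" and D: "\<And>x. norm (F x - m) \<le> D"
  shows "norm (torus_integral F - m) \<le> D"
proof -
  have c: "set_integrable lborel (cbox 0 1 :: (real ^ 'n) set) (\<lambda>x. c)" for c :: "'c::{banach,second_countable_topology}"
    by (intro bounded_borel_set_integrable bounded_borel_const) auto
  have m: "torus_integral (\<lambda>x::real ^ 'n. m) = m"
  proof -
    have i: "integrable lborel (indicator (cbox 0 1) :: real ^ 'n \<Rightarrow> real)"
      using c[of "1::real"] by (simp add: set_integrable_def)
    have "(LINT x|lborel. indicator (cbox 0 1 :: (real ^ 'n) set) x) = (1::real)"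
      using torus_integral_const[of 1, where 'n='n] by (simp add: torus_integral_def set_lebesgue_integral_def)
    then show ?thesis
      unfolding torus_integral_def set_lebesgue_integral_def
      by (subst integral_scaleR_left) (use i in simp_all)
  qed
  have "torus_integral F - m = torus_integral (\<lambda>x. F x - m)"
    using set_integral_diff(2)[OF F c[of m]] m by (simp add: torus_integral_def)
  also have "norm \<dots> \<le> torus_integral (\<lambda>x. norm (F x - m))"
    unfolding torus_integral_def
    by (rule set_integral_norm_bound) (rule set_integral_diff(1)[OF F c])
  also have "\<dots> \<le> torus_integral (\<lambda>x::real ^ 'n. D)"
    unfolding torus_integral_def
    by (rule set_integral_mono[OF set_integrable_norm[OF set_integral_diff(1)[OF F c]] c]) (rule D)
  finally show ?thesis by (simp add: torus_integral_const)
qed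

lemma bounded_borel_norm_power2: "bounded_borel B \<Longrightarrow> bounded_borel (\<lambda>x. (norm (B x))\<^sup>2)"
  for B :: "'a::topological_space \<Rightarrow> 'b::{real_normed_vector,second_countable_topology}"
proof -
  assume B: "bounded_borel B"
  obtain K where K: "K \<ge> 0" "\<And>x. norm (B x) \<le> K" using bounded_borel_bound[OF B] by blast
  have [measurable]: "B \<in> borel_measurable borel" using B by (rule bounded_borel_measurable)
  show ?thesis
    by (rule bounded_borelI[where K="K\<^sup>2"]) (use K in \<open>auto intro!: power_mono\<close>)
qed

lemma regular_field_L2: "regular_field B \<Longrightarrow> torus_L2 B"
  unfolding regular_field_def torus_L2_def
  by (auto intro!: bounded_borel_set_integrable bounded_borel_norm_power2 dest: bounded_borel_measurable)

lemma norm_vdot_le: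
  fixes b :: "'a::real_normed_vector ^ 'n"
  shows "norm (vdot a b) \<le> real CARD('n) * (norm a * norm b)"
proof -
  have "norm (vdot a b) \<le> (\<Sum>i\<in>(UNIV::'n set). norm a * norm b)"
    unfolding vdot_def
    by (rule sum_norm_le) (auto intro!: mult_mono component_le_norm_cart Finite_Cartesian_Product.norm_nth_le)
  then show ?thesis by simp
qed

lemma (in shear_flow) push_bound:
  obtains M where "M \<ge> 1"
    "\<And>\<tau> B K x. \<lbrakk>0 \<le> \<tau>; \<tau> \<le> 1; \<And>x. norm (B x) \<le> K\<rbrakk> \<Longrightarrow> norm (push i v dv \<tau> B x) \<le> M * K"
proof -
  obtain D where D: "D \<ge> 0" "\<And>x. norm (dv x) \<le> D" using bounded_borel_bound[OF torus_testD(5)[OF v_test]] by blast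
  show ?thesis
  proof (rule that[of "1 + real CARD('n) * D"])
    show "1 \<le> 1 + real CARD('n) * D" using D by simp
    fix \<tau> K :: real and B :: "real ^ 'n \<Rightarrow> complex ^ 'n" and x
    assume \<tau>: "0 \<le> \<tau>" "\<tau> \<le> 1" and K: "\<And>x. norm (B x) \<le> K"
    define p where "p = \<Phi> (- \<tau>) x"
    have "norm (\<tau> *\<^sub>R vdot (dv p) (B p)) \<le> 1 * (real CARD('n) * (norm (dv p) * norm (B p)))"
      unfolding norm_scaleR using \<tau> by (intro mult_mono norm_vdot_le) auto
    also have "\<dots> \<le> 1 * (real CARD('n) * (D * K))"
      using D K by (intro mult_left_mono mult_mono) auto
    finally have "norm (axis i (\<tau> *\<^sub>R vdot (dv p) (B p))) \<le> real CARD('n) * D * K" by (simp add: norm_axis_eq)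
    then have "norm (B p + axis i (\<tau> *\<^sub>R vdot (dv p) (B p))) \<le> K + real CARD('n) * D * K"
      using K[of p] by (intro norm_triangle_le add_mono)
    then show "norm (push i v dv \<tau> B x) \<le> (1 + real CARD('n) * D) * K"
      by (simp add: push_def Let_def p_def algebra_simps)
  qed
qed

lemma stage_bound:
  obtains M where "\<And>s B K x. \<lbrakk>\<And>x. norm (B x) \<le> K\<rbrakk> \<Longrightarrow> norm (stage \<alpha> N s B x) \<le> M * K"
proof -
  obtain M1 where M1: "\<And>\<tau> B K x. \<lbrakk>0 \<le> \<tau>; \<tau> \<le> 1; \<And>x. norm (B x) \<le> K\<rbrakk> \<Longrightarrow> norm (V_push \<alpha> \<tau> B x) \<le> M1 * K"
    unfolding V_push_def by (rule V.push_bound[of \<alpha>]) blast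
  obtain M2 where M2: "\<And>\<tau> B K x. \<lbrakk>0 \<le> \<tau>; \<tau> \<le> 1; \<And>x. norm (B x) \<le> K\<rbrakk> \<Longrightarrow> norm (H_push \<alpha> \<tau> B x) \<le> M2 * K"
    unfolding H_push_def by (rule H.push_bound[of \<alpha>]) blast
  obtain M3 where M3: "\<And>\<tau> B K x. \<lbrakk>0 \<le> \<tau>; \<tau> \<le> 1; \<And>x. norm (B x) \<le> K\<rbrakk> \<Longrightarrow> norm (Z_push \<tau> B x) \<le> M3 * K"
    unfolding Z_push_def by (rule Z.push_bound) blast
  have c: "0 \<le> elapsed 1 s" "elapsed 1 s \<le> 1" "0 \<le> elapsed (1/2) s" "elapsed (1/2) s \<le> 1" for s
    by (auto simp: elapsed_def)
  have "norm (stage \<alpha> N s B x) \<le> M3 * (M2 * (M1 * K))" if "\<And>x. norm (B x) \<le> K" for s B K x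
    unfolding stage_def by (intro M1 M2 M3 c that)
  then show ?thesis by (intro that[of "M3 * (M2 * M1)"]) (simp add: mult.assoc)
qed

lemma solution_0: "solution \<alpha> N B 0 = B"
  using solution_stage[of 0 N \<alpha> B 0] by (simp add: stage_0)

lemma ideal_solution_solution:
  assumes reg: "regular_field B"
  shows "ideal_solution (velocity \<alpha> N twist_phase) B (solution \<alpha> N B)"
  unfolding ideal_solution_def
proof (intro conjI allI impI)
  fix t :: real
  have r: "regular_field (solution \<alpha> N B t)"
    unfolding solution_def Let_def by (intro regular_stage regular_period_map reg)
  show "torus_L2 (solution \<alpha> N B t)" by (rule regular_field_L2[OF r])
  show "div_free (solution \<alpha> N B t)"
    using r unfolding regular_field_def by (intro strong_div_free_imp_div_free) blast
next
  show "AE x in lborel. solution \<alpha> N B 0 x = B x" by (simp add: solution_0)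
next
  fix T :: real
  obtain M where M: "\<And>s B K x. \<lbrakk>\<And>x. norm (B x) \<le> K\<rbrakk> \<Longrightarrow> norm (stage \<alpha> N s B x) \<le> M * K"
    using stage_bound[of \<alpha> N] by blast
  have "\<forall>k. \<exists>K. \<forall>x. norm ((period_map \<alpha> ^^ k) B x) \<le> K"
    using regular_period_map[OF reg] bounded_borel_bound unfolding regular_field_def by metis
  then obtain K where K: "\<And>k x. norm ((period_map \<alpha> ^^ k) B x) \<le> K k" by metis
  define n where "n = nat \<lfloor>T / (real N + 3)\<rfloor>"
  define C where "C = (\<Sum>k\<le>n. (M * K k)\<^sup>2)"
  show "\<exists>C. \<forall>t\<in>{0..T}. torus_integral (\<lambda>x. (norm (solution \<alpha> N B t x))\<^sup>2) \<le> C"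
  proof (intro exI[of _ C] ballI)
    fix t assume t: "t \<in> {0..T}"
    define k where "k = nat \<lfloor>t / (real N + 3)\<rfloor>"
    have "k \<le> n" unfolding k_def n_def using t by (intro nat_mono floor_mono divide_right_mono) auto
    then have kC: "(M * K k)\<^sup>2 \<le> C" unfolding C_def by (intro member_le_sum) auto
    have bound: "norm (solution \<alpha> N B t x) \<le> M * K k" for x
      unfolding solution_def Let_def k_def[symmetric] by (rule M[OF K])
    have r: "regular_field (solution \<alpha> N B t)"
      unfolding solution_def Let_def by (intro regular_stage regular_period_map reg)
    have "torus_integral (\<lambda>x. (norm (solution \<alpha> N B t x))\<^sup>2) \<le> torus_integral (\<lambda>x::real ^ 3. (M * K k)\<^sup>2)"
      unfolding torus_integral_def
    proof (rule set_integral_mono)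
      show "set_integrable lborel (cbox 0 1) (\<lambda>x. (norm (solution \<alpha> N B t x))\<^sup>2)"
        using regular_field_L2[OF r] by (simp add: torus_L2_def)
      show "set_integrable lborel (cbox 0 1 :: (real ^ 3) set) (\<lambda>x. (M * K k)\<^sup>2)"
        by (intro bounded_borel_set_integrable bounded_borel_const) auto
    qed (intro power_mono bound norm_ge_zero)
    then show "torus_integral (\<lambda>x. (norm (solution \<alpha> N B t x))\<^sup>2) \<le> C"
      using kC by (simp add: torus_integral_const)
  qed
next
  fix \<psi> :: "real ^ 3 \<Rightarrow> real ^ 3" and t :: real
  assume \<psi>: "torus_smooth \<psi>" and t: "0 \<le> t"
  define k where "k = nat \<lceil>t / (real N + 3)\<rceil>"
  have "t / (real N + 3) \<le> real k" unfolding k_def by linarith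
  then have "t \<in> {0..real k * (real N + 3)}" using t by (simp add: pos_divide_le_eq)
  note W = weakly_evolves_solution[OF reg, of \<alpha> N k, unfolded weakly_evolves_def, rule_format, OF \<psi> this,
      unfolded weak_pairing_def weak_rate_def solution_0]
  show "set_integrable lborel {0..t} (\<lambda>s. torus_integral (\<lambda>x. vdot (curl \<psi> x)
      (vcross (velocity \<alpha> N twist_phase s x) (solution \<alpha> N B s x))))"
    using W by blast
  show "torus_integral (\<lambda>x. vdot (\<psi> x) (solution \<alpha> N B t x)) = torus_integral (\<lambda>x. vdot (\<psi> x) (B x)) +
      (LINT s:{0..t}|lborel. torus_integral (\<lambda>x. vdot (curl \<psi> x)
        (vcross (velocity \<alpha> N twist_phase s x) (solution \<alpha> N B s x))))"
    using W by blast
qed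

section \<open>Pairing the solution with a wave\<close>

text \<open>
  Two amplitudes make the family closed under partial derivatives, which gives smoothness by induction.
\<close>

definition wave :: "real \<Rightarrow> real \<Rightarrow> real ^ 3 \<Rightarrow> real ^ 3" where
  "wave c d x = axis 1 (c * cos (2 * pi * x $ 3) + d * sin (2 * pi * x $ 3))"

lemma wave_has_derivative:
  "(wave c d has_derivative (\<lambda>h. h $ 3 *\<^sub>R wave (2 * pi * d) (- (2 * pi * c)) x)) (at x)"
proof -
  have nth: "((\<lambda>x::real ^ 3. x $ 3) has_derivative (\<lambda>h. h $ 3)) (at x)"
    by (rule bounded_linear_imp_has_derivative[OF bounded_linear_vec_nth])
  have "((\<lambda>x::real ^ 3. c * cos (2 * pi * x $ 3) + d * sin (2 * pi * x $ 3)) has_derivative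
      (\<lambda>h. h $ 3 * (2 * pi * d * cos (2 * pi * x $ 3) + (- (2 * pi * c)) * sin (2 * pi * x $ 3)))) (at x)"
    by (auto intro!: derivative_eq_intros nth simp: algebra_simps)
  from bounded_linear.has_derivative[OF bounded_linear_axis this]
  have "((\<lambda>x::real ^ 3. axis 1 (c * cos (2 * pi * x $ 3) + d * sin (2 * pi * x $ 3)) :: real ^ 3) has_derivative
      (\<lambda>h. axis 1 (h $ 3 * (2 * pi * d * cos (2 * pi * x $ 3) + (- (2 * pi * c)) * sin (2 * pi * x $ 3))))) (at x)" .
  moreover have "axis 1 (r * s) = r *\<^sub>R (axis 1 s :: real ^ 3)" for r s
    by (simp add: vec_eq_iff axis_def)
  ultimately show ?thesis unfolding wave_def[abs_def] by simp
qed

lemma partial_wave: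
  "partial i (wave c d) = (if i = 3 then wave (2 * pi * d) (- (2 * pi * c)) else wave 0 0)"
proof
  fix x
  have "frechet_derivative (wave c d) (at x) = (\<lambda>h. h $ 3 *\<^sub>R wave (2 * pi * d) (- (2 * pi * c)) x)"
    by (rule frechet_derivative_at[OF wave_has_derivative, symmetric])
  then show "partial i (wave c d) x = (if i = 3 then wave (2 * pi * d) (- (2 * pi * c)) else wave 0 0) x"
    by (auto simp: partial_def axis_def wave_def vec_eq_iff)
qed

lemma torus_smooth_wave: "torus_smooth (wave c d)"
  unfolding torus_smooth_def
proof (intro conjI allI)
  have "cos (2 * pi * (y + 1)) = cos (2 * pi * y)" "sin (2 * pi * (y + 1)) = sin (2 * pi * y)" for y
    by (simp_all add: distrib_left)
  then show "torus_periodic (wave c d)"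
    by (auto simp: torus_periodic_def wave_def axis_def vec_eq_iff)
  fix js x
  show "fold partial js (wave c d) differentiable (at x)"
  proof (induction js arbitrary: c d)
    case Nil
    show ?case using wave_has_derivative[of c d x] by (auto simp: differentiable_def)
  next
    case (Cons j js)
    show ?case using Cons by (simp add: partial_wave)
  qed
qed

text \<open>
  The $z$-dependence $e^{2\pi iz}$, preserved by all flows that occur.
\<close>

definition first_mode :: "(real ^ 3 \<Rightarrow> complex ^ 3) \<Rightarrow> bool" where
  "first_mode B \<longleftrightarrow> (\<forall>x h j. B (x + h *\<^sub>R axis 3 1) $ j = cis (2 * pi * h) * B x $ j)"

lemma first_mode_push:
  assumes B: "first_mode B"
    and v: "\<And>x h. v (x + h *\<^sub>R axis 3 1) = v x" and dv: "\<And>x h. dv (x + h *\<^sub>R axis 3 1) = dv x"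
  shows "first_mode (push i v dv \<tau> B)"
  unfolding first_mode_def
proof (intro allI)
  fix x h j
  define p where "p = shear_map i v (- \<tau>) x"
  have p: "shear_map i v (- \<tau>) (x + h *\<^sub>R axis 3 1) = p + h *\<^sub>R axis 3 1"
    by (simp add: shear_map_def v p_def)
  have "vdot (dv p) (B (p + h *\<^sub>R axis 3 1)) = cis (2 * pi * h) * vdot (dv p) (B p)"
    using B by (simp add: vdot_def first_mode_def sum_distrib_left)
  then show "push i v dv \<tau> B (x + h *\<^sub>R axis 3 1) $ j = cis (2 * pi * h) * push i v dv \<tau> B x $ j"
    using B unfolding push_def p dv Let_def p_def[symmetric]
    by (simp add: first_mode_def axis_def algebra_simps)
qed

lemma first_mode_period_map:
  assumes "first_mode B" shows "first_mode ((period_map \<alpha> ^^ k) B)"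
proof (induction k)
  case (Suc k)
  have "first_mode (period_map \<alpha> C)" if "first_mode C" for C
    unfolding period_map_def V_push_def H_push_def Z_push_def
    by (intro first_mode_push that)
       (simp_all add: V_profile_def H_profile_def Z_profile_def V_gradient_def H_gradient_def Z_gradient_def axis_def)
  then show ?case using Suc by simp
qed (simp add: assms)

lemma cis_add_one:
  "cis (2 * pi * (y + 1)) = cis (2 * pi * y)" "cis (- (2 * pi * (y + 1))) = cis (- (2 * pi * y))"
proof -
  have "cis (2 * pi * (y + 1)) = cis (2 * pi * y) * cis (2 * pi)"
    "cis (- (2 * pi * (y + 1))) = cis (- (2 * pi * y)) * cis (- (2 * pi))"
    by (simp_all only: cis_mult) (simp_all add: algebra_simps)
  moreover have "cis (2 * pi) = 1" "cis (- (2 * pi)) = 1" by (simp_all add: complex_eq_iff)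
  ultimately show "cis (2 * pi * (y + 1)) = cis (2 * pi * y)"
    "cis (- (2 * pi * (y + 1))) = cis (- (2 * pi * y))" by simp_all
qed

text \<open>
  Of the two exponentials in the cosine only $e^{-2\pi iz}$ matches the mode; the other one leaves a
  function that a translation by $1/4$ turns into its negative.
\<close>

lemma weak_pairing_wave:
  assumes mode: "first_mode B" and B: "bounded_borel B" "torus_periodic B"
  shows "weak_pairing (wave 1 0) B = 1/2 * torus_integral (\<lambda>x. cis (- (2 * pi * x $ 3)) * B x $ 1)"
proof -
  have cis_bb: "bounded_borel (\<lambda>x::real ^ 3. cis (c * x $ 3))" for c
    by (rule bounded_borelI[where K=1])
       (auto intro!: borel_measurable_continuous_onI continuous_intros)
  define f where "f x = cis (2 * pi * x $ 3) * B x $ 1" for x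
  define g where "g x = cis (- (2 * pi * x $ 3)) * B x $ 1" for x
  have fb: "bounded_borel f" unfolding f_def[abs_def]
    by (intro bounded_borel_mult bounded_borel_nth B cis_bb)
  have gb: "bounded_borel g"
    using cis_bb[of "- (2 * pi)"] bounded_borel_mult[OF _ bounded_borel_nth[OF B(1)]]
    unfolding g_def[abs_def] by simp
  have int: "set_integrable lborel (cbox 0 1) h" if "bounded_borel h" for h :: "real ^ 3 \<Rightarrow> complex"
    by (rule bounded_borel_set_integrable[OF that]) auto
  have "torus_integral f = torus_integral (\<lambda>x. f (x + (1/4) *\<^sub>R axis 3 1))"
    by (rule torus_integral_translate[OF fb, symmetric])
       (use B(2) in \<open>simp add: f_def torus_periodic_def axis_def cis_add_one\<close>)
  also have "(\<lambda>x. f (x + (1/4) *\<^sub>R axis 3 1)) = (\<lambda>x. - f x)"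
  proof
    fix x :: "real ^ 3"
    have "f (x + (1/4) *\<^sub>R axis 3 1) = cis (2 * pi * (x $ 3 + 1/4)) * (cis (2 * pi * (1/4)) * B x $ 1)"
      using mode unfolding f_def first_mode_def by (simp add: axis_def)
    also have "\<dots> = (\<i> * \<i>) * f x"
    proof -
      have "cis (2 * pi * (x $ 3 + 1/4)) = cis (2 * pi * x $ 3) * cis (pi / 2)"
        unfolding cis_mult by (simp add: distrib_left)
      moreover have "a * \<i> * (\<i> * b) = (\<i> * \<i>) * (a * b)" for a b by (simp only: mult_ac)
      ultimately show ?thesis by (simp add: f_def)
    qed
    finally show "f (x + (1/4) *\<^sub>R axis 3 1) = - f x" by simp
  qed
  also have "torus_integral (\<lambda>x. - f x) = - torus_integral f"
    by (simp add: torus_integral_def set_lebesgue_integral_def)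
  finally have f0: "torus_integral f = 0" by simp
  have "weak_pairing (wave 1 0) B = torus_integral (\<lambda>x. (1/2) *\<^sub>R (g x + f x))"
    unfolding weak_pairing_def
  proof (rule arg_cong[where f=torus_integral], rule ext)
    fix x :: "real ^ 3"
    have "cis (- (2 * pi * x $ 3)) + cis (2 * pi * x $ 3) = of_real (2 * cos (2 * pi * x $ 3))"
      by (simp add: complex_eq_iff)
    then have "g x + f x = of_real (2 * cos (2 * pi * x $ 3)) * B x $ 1"
      unfolding f_def g_def distrib_right[symmetric] by simp
    moreover have "vdot (wave 1 0 x) (B x) = of_real (cos (2 * pi * x $ 3)) * B x $ 1"
      by (simp add: vdot_def wave_def sum_3 axis_def scaleR_conv_of_real)
    ultimately show "vdot (wave 1 0 x) (B x) = (1/2) *\<^sub>R (g x + f x)"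
      by (simp add: scaleR_conv_of_real)
  qed
  also have "\<dots> = (1/2) *\<^sub>R (torus_integral g + torus_integral f)"
    unfolding torus_integral_def
    by (simp only: set_integral_scaleR_right set_integral_add(2)[OF int[OF gb] int[OF fb]])
  finally show ?thesis by (simp add: f0 g_def[abs_def] scaleR_conv_of_real)
qed

lemma bounded_borel_pulled_form_compose:
  fixes a b :: "'a::euclidean_space \<Rightarrow> real" and C D :: "'a \<Rightarrow> complex"
  assumes a: "a \<in> borel_measurable borel" and b: "b \<in> borel_measurable borel"
    and C: "bounded_borel C" and D: "bounded_borel D"
  shows "bounded_borel (\<lambda>x. pulled_form \<alpha> n (a x) (b x) (C x) (D x))"
proof -
  have ab: "(\<lambda>x. (a x, b x)) \<in> borel_measurable borel" using a b by (rule borel_measurable_Pair)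
  have "bounded_borel (\<lambda>x. (\<lambda>(x, y). pulled_form \<alpha> n x y \<xi> \<eta>) (a x, b x))" for \<xi> \<eta>
    by (rule bounded_borel_compose[OF bounded_borel_pulled_form ab])
  then have "bounded_borel (\<lambda>x. pulled_form \<alpha> n (a x) (b x) \<xi> \<eta>)" for \<xi> \<eta> by simp
  then show ?thesis
    by (subst pulled_form_linear) (intro bounded_borel_add bounded_borel_mult C D)
qed

lemma bounded_borel_cis_nth: "bounded_borel (\<lambda>x::real ^ 3. cis (- (2 * pi * x $ 3)))"
  by (rule bounded_borelI[where K=1]) (auto intro!: borel_measurable_continuous_onI continuous_intros)

lemma bounded_borel_twist_nth: "bounded_borel (\<lambda>x::real ^ 3. twist (x $ j))"
  by (rule bounded_borelI[where K=1]) (auto intro!: measurable_compose[OF nth_measurable measurable_twist])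

lemma cnj_twist_mult: "cnj (twist y) * twist y = 1"
  by (simp add: twist_def cis_cnj cis_mult)

text \<open>
  Change variables successively along the three shears of a period. The phase of $Z$ supplies
  \<open>twist (x $ 1) * twist (x $ 2)\<close>, the first factor of which belongs to the next period's
  \<open>V_push\<close> and is compensated by its conjugate.
\<close>

lemma torus_integral_period_step:
  assumes B: "bounded_borel B" "torus_periodic B"
  shows "torus_integral (\<lambda>x. cis (- (2 * pi * x $ 3)) * (cnj (twist (x $ 1)) *
        pulled_form \<alpha> n (x $ 2) (x $ 1) (period_map \<alpha> B x $ 2) (period_map \<alpha> B x $ 1)))
    = torus_integral (\<lambda>x. cis (- (2 * pi * x $ 3)) *
        pulled_form \<alpha> (Suc n) (x $ 1) (x $ 2 + \<alpha> * tent (x $ 1)) (B x $ 1)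
          (B x $ 2 + of_real (\<alpha> * tent_slope (x $ 1)) * B x $ 1))"
proof -
  define B1 where "B1 = V_push \<alpha> (1/2) B"
  define B2 where "B2 = H_push \<alpha> (1/2) B1"
  define B3 where "B3 = Z_push 1 B2"
  have b1: "bounded_borel B1" "torus_periodic B1" unfolding B1_def V_push_def
    by (intro V.bounded_borel_push V.torus_periodic_push B)+
  have b2: "bounded_borel B2" "torus_periodic B2" unfolding B2_def H_push_def
    by (intro H.bounded_borel_push H.torus_periodic_push b1)+
  have b3: "bounded_borel B3" "torus_periodic B3" unfolding B3_def Z_push_def
    by (intro Z.bounded_borel_push Z.torus_periodic_push b2)+
  note bb = bounded_borel_mult bounded_borel_pulled_form_compose bounded_borel_cis_nth
    bounded_borel_twist_nth bounded_borel_nth nth_measurable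
  define f1 where "f1 x = cis (- (2 * pi * x $ 3)) * (cnj (twist (x $ 1)) *
        pulled_form \<alpha> n (x $ 2) (x $ 1) (B3 x $ 2) (B3 x $ 1))" for x
  define f2 where "f2 x = cis (- (2 * pi * x $ 3)) * (twist (x $ 2) *
        pulled_form \<alpha> n (x $ 2) (x $ 1) (B2 x $ 2) (B2 x $ 1))" for x
  define f3 where "f3 x = cis (- (2 * pi * x $ 3)) *
        pulled_form \<alpha> (Suc n) (x $ 1) (x $ 2) (B1 x $ 1) (B1 x $ 2)" for x
  have cnj_bb: "bounded_borel (\<lambda>x::real ^ 3. cnj (twist (x $ 1)))"
    by (rule bounded_borel_linear[OF bounded_linear_cnj bounded_borel_twist_nth])
  have ax: "(axis i 1 :: real ^ 3) $ j = (if j = i then 1 else 0)" for i j by (simp add: axis_def)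
  have f1b: "bounded_borel f1" "torus_periodic f1"
    unfolding f1_def[abs_def]
    by (intro bb cnj_bb b3) (auto simp: torus_periodic_def ax forall_3 cis_add_one torus_periodicD[OF b3(2)])
  have f2b: "bounded_borel f2" "torus_periodic f2"
    unfolding f2_def[abs_def]
    by (intro bb b2) (auto simp: torus_periodic_def ax forall_3 cis_add_one torus_periodicD[OF b2(2)])
  have f3b: "bounded_borel f3" "torus_periodic f3"
    unfolding f3_def[abs_def]
    by (intro bb b1) (auto simp: torus_periodic_def ax forall_3 cis_add_one torus_periodicD[OF b1(2)] simp del: pulled_form.simps)
  have 1: "f1 (shear_map 3 Z_profile 1 p) = f2 p" for p
  proof -
    have B3: "B3 (shear_map 3 Z_profile 1 p) = B2 p + axis 3 (1 *\<^sub>R vdot (Z_gradient p) (B2 p))"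
      unfolding B3_def Z_push_def by (rule Z.push_flow)
    have "cis (- (2 * pi * (p $ 3 - (phase (p $ 1) + phase (p $ 2)))))
        = cis (- (2 * pi * p $ 3)) * twist (p $ 1) * twist (p $ 2)"
      unfolding cis_phase[symmetric] cis_mult by (simp add: algebra_simps)
    moreover have "shear_map 3 Z_profile 1 p $ 1 = p $ 1" "shear_map 3 Z_profile 1 p $ 2 = p $ 2"
      "shear_map 3 Z_profile 1 p $ 3 = p $ 3 - (phase (p $ 1) + phase (p $ 2))"
      by (simp_all add: shear_map_def Z_profile_def axis_def)
    moreover have "B3 (shear_map 3 Z_profile 1 p) $ 1 = B2 p $ 1" "B3 (shear_map 3 Z_profile 1 p) $ 2 = B2 p $ 2"
      unfolding B3 by (simp_all add: axis_def)
    ultimately have "f1 (shear_map 3 Z_profile 1 p) = (cnj (twist (p $ 1)) * twist (p $ 1)) * f2 p"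
      unfolding f1_def f2_def by simp
    then show ?thesis by (simp only: cnj_twist_mult mult_1)
  qed
  have 2: "f2 (shear_map 1 (H_profile \<alpha>) (1/2) p) = f3 p" for p
  proof -
    have B2: "B2 (shear_map 1 (H_profile \<alpha>) (1/2) p) = B1 p + axis 1 ((1/2) *\<^sub>R vdot (H_gradient \<alpha> p) (B1 p))"
      unfolding B2_def H_push_def by (rule H.push_flow)
    have "(1/2) *\<^sub>R vdot (H_gradient \<alpha> p) (B1 p) = of_real (\<alpha> * tent_slope (p $ 2)) * B1 p $ 2"
    proof -
      have "H_gradient \<alpha> p $ j = (if j = 2 then 2 * \<alpha> * tent_slope (p $ 2) else 0)" for j
        by (simp add: H_gradient_def axis_def)
      then show ?thesis by (simp add: vdot_def sum_3 scaleR_conv_of_real)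
    qed
    then have "B2 (shear_map 1 (H_profile \<alpha>) (1/2) p) $ 1 = B1 p $ 1 + of_real (\<alpha> * tent_slope (p $ 2)) * B1 p $ 2"
      "B2 (shear_map 1 (H_profile \<alpha>) (1/2) p) $ 2 = B1 p $ 2"
      unfolding B2 by (simp_all add: axis_def)
    moreover have "shear_map 1 (H_profile \<alpha>) (1/2) p $ 1 = p $ 1 + \<alpha> * tent (p $ 2)"
      "shear_map 1 (H_profile \<alpha>) (1/2) p $ 2 = p $ 2" "shear_map 1 (H_profile \<alpha>) (1/2) p $ 3 = p $ 3"
      by (simp_all add: shear_map_def H_profile_def axis_def)
    ultimately show ?thesis unfolding f2_def f3_def pulled_form.simps by simp
  qed
  have 3: "f3 (shear_map 2 (V_profile \<alpha>) (1/2) p) = cis (- (2 * pi * p $ 3)) *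
        pulled_form \<alpha> (Suc n) (p $ 1) (p $ 2 + \<alpha> * tent (p $ 1)) (B p $ 1)
          (B p $ 2 + of_real (\<alpha> * tent_slope (p $ 1)) * B p $ 1)" for p
  proof -
    have B1: "B1 (shear_map 2 (V_profile \<alpha>) (1/2) p) = B p + axis 2 ((1/2) *\<^sub>R vdot (V_gradient \<alpha> p) (B p))"
      unfolding B1_def V_push_def by (rule V.push_flow)
    have "(1/2) *\<^sub>R vdot (V_gradient \<alpha> p) (B p) = of_real (\<alpha> * tent_slope (p $ 1)) * B p $ 1"
    proof -
      have "V_gradient \<alpha> p $ j = (if j = 1 then 2 * \<alpha> * tent_slope (p $ 1) else 0)" for j
        by (simp add: V_gradient_def axis_def)
      then show ?thesis by (simp add: vdot_def sum_3 scaleR_conv_of_real)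
    qed
    then have "B1 (shear_map 2 (V_profile \<alpha>) (1/2) p) $ 2 = B p $ 2 + of_real (\<alpha> * tent_slope (p $ 1)) * B p $ 1"
      "B1 (shear_map 2 (V_profile \<alpha>) (1/2) p) $ 1 = B p $ 1"
      unfolding B1 by (simp_all add: axis_def)
    moreover have "shear_map 2 (V_profile \<alpha>) (1/2) p $ 2 = p $ 2 + \<alpha> * tent (p $ 1)"
      "shear_map 2 (V_profile \<alpha>) (1/2) p $ 1 = p $ 1" "shear_map 2 (V_profile \<alpha>) (1/2) p $ 3 = p $ 3"
      by (simp_all add: shear_map_def V_profile_def axis_def)
    ultimately show ?thesis unfolding f3_def by (simp del: pulled_form.simps)
  qed
  have "torus_integral f1 = torus_integral f2"
    using Z.torus_integral_flow[OF f1b, of 1] unfolding 1 by simp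
  also have "\<dots> = torus_integral f3"
    using H.torus_integral_flow[OF f2b, of \<alpha> "1/2"] unfolding 2 by simp
  also have "\<dots> = torus_integral (\<lambda>p. cis (- (2 * pi * p $ 3)) *
        pulled_form \<alpha> (Suc n) (p $ 1) (p $ 2 + \<alpha> * tent (p $ 1)) (B p $ 1)
          (B p $ 2 + of_real (\<alpha> * tent_slope (p $ 1)) * B p $ 1))"
    using V.torus_integral_flow[OF f3b, of \<alpha> "1/2"] unfolding 3 by simp
  finally show ?thesis
    unfolding f1_def B3_def B2_def B1_def period_map_def .
qed

lemma torus_integral_period_power:
  assumes "bounded_borel B" "torus_periodic B"
  shows "torus_integral (\<lambda>x. cis (- (2 * pi * x $ 3)) * (period_map \<alpha> ^^ k) B x $ 1)
    = torus_integral (\<lambda>x. cis (- (2 * pi * x $ 3)) * (cnj (twist (x $ 1)) *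
        pulled_form \<alpha> (2 * k) (x $ 2) (x $ 1) (B x $ 2) (B x $ 1)))"
  using assms
proof (induction k arbitrary: B)
  case 0
  have "cnj (twist y) * (twist y * z) = z" for y z
    by (simp only: mult.assoc[symmetric] cnj_twist_mult mult_1)
  then show ?case by (simp only: funpow.simps(1) id_apply mult_0_right pulled_form.simps(1))
next
  case (Suc k)
  have pm: "bounded_borel (period_map \<alpha> B)" "torus_periodic (period_map \<alpha> B)"
    unfolding period_map_def V_push_def H_push_def Z_push_def
    by (intro V.bounded_borel_push V.torus_periodic_push H.bounded_borel_push H.torus_periodic_push
        Z.bounded_borel_push Z.torus_periodic_push Suc.prems)+
  have "torus_integral (\<lambda>x. cis (- (2 * pi * x $ 3)) * (period_map \<alpha> ^^ Suc k) B x $ 1)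
      = torus_integral (\<lambda>x. cis (- (2 * pi * x $ 3)) * (period_map \<alpha> ^^ k) (period_map \<alpha> B) x $ 1)"
    by (simp only: funpow_Suc_right o_apply)
  also note Suc.IH[OF pm]
  also note torus_integral_period_step[OF Suc.prems]
  also have "torus_integral (\<lambda>x. cis (- (2 * pi * x $ 3)) *
        pulled_form \<alpha> (Suc (2 * k)) (x $ 1) (x $ 2 + \<alpha> * tent (x $ 1)) (B x $ 1)
          (B x $ 2 + of_real (\<alpha> * tent_slope (x $ 1)) * B x $ 1))
      = torus_integral (\<lambda>x. cis (- (2 * pi * x $ 3)) * (cnj (twist (x $ 1)) *
        pulled_form \<alpha> (Suc (Suc (2 * k))) (x $ 2) (x $ 1) (B x $ 2) (B x $ 1)))"
  proof (rule arg_cong[where f=torus_integral], rule ext)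
    fix x :: "real ^ 3"
    have c: "cnj (twist y) * (twist y * z) = z" for y z
      by (simp only: mult.assoc[symmetric] cnj_twist_mult mult_1)
    show "cis (- (2 * pi * x $ 3)) *
        pulled_form \<alpha> (Suc (2 * k)) (x $ 1) (x $ 2 + \<alpha> * tent (x $ 1)) (B x $ 1)
          (B x $ 2 + of_real (\<alpha> * tent_slope (x $ 1)) * B x $ 1)
      = cis (- (2 * pi * x $ 3)) * (cnj (twist (x $ 1)) *
        pulled_form \<alpha> (Suc (Suc (2 * k))) (x $ 2) (x $ 1) (B x $ 2) (B x $ 1))"
      unfolding pulled_form.simps(2)[of \<alpha> "Suc (2 * k)"] c ..
  qed
  finally show ?case by simp
qed

text \<open>
  A vertical field is left alone by the first shear, and the second one turns it into a
  horizontal field to which the bias of the twist applies; a constant field in the first direction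
  would average out to leading order.
\<close>

definition seed_field :: "real ^ 3 \<Rightarrow> complex ^ 3" where
  "seed_field x = axis 2 (cis (2 * pi * x $ 3))"

lemma regular_seed_field: "regular_field seed_field"
proof -
  have c: "bounded_borel (\<lambda>x::real ^ 3. cis (2 * pi * x $ 3))"
    by (rule bounded_borelI[where K=1]) (auto intro!: borel_measurable_continuous_onI continuous_intros)
  have "strong_div_free seed_field"
    unfolding seed_field_def[abs_def] by (rule strong_div_free_axis[OF c]) (simp add: axis_def)
  moreover have "bounded_borel seed_field"
    unfolding seed_field_def[abs_def] by (rule bounded_borel_axis[OF c])
  moreover have "torus_periodic seed_field"
  proof -
    show ?thesis by (auto simp: torus_periodic_def seed_field_def axis_def vec_eq_iff cis_add_one)
  qed
  ultimately show ?thesis by (simp add: regular_field_def)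
qed

lemma first_mode_seed_field: "first_mode seed_field"
  by (auto simp: first_mode_def seed_field_def axis_def distrib_left cis_mult add.commute)

text \<open>
  After the reduction, averaging over translations in the second coordinate makes the integrand a line
  integral over a vertical unit circle at every point, and all of these are within \<open>D\<close> of the mean.
\<close>

lemma weak_pairing_seed:
  assumes lb: "line_bounds \<alpha> (2 * k + 1) A D" and \<alpha>: "\<alpha> \<ge> 4"
  shows "norm (2 * weak_pairing (wave 1 0) ((period_map \<alpha> ^^ Suc k) seed_field) - mean_integral \<alpha> (2 * k + 1)) \<le> D"
proof -
  let ?n = "2 * k + 1"
  have reg: "regular_field ((period_map \<alpha> ^^ Suc k) seed_field)"
    by (rule regular_period_map[OF regular_seed_field])
  have s: "bounded_borel seed_field" "torus_periodic seed_field"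
    using regular_seed_field by (simp_all add: regular_field_def)
  have pm: "bounded_borel (period_map \<alpha> seed_field)" "torus_periodic (period_map \<alpha> seed_field)"
    using regular_period_map[OF regular_seed_field, where \<alpha>=\<alpha> and k=1] by (simp_all add: regular_field_def)
  define F where "F x = pulled_form \<alpha> ?n (x $ 1) (x $ 2 + \<alpha> * tent (x $ 1)) 0 1" for x :: "real ^ 3"
  have "2 * weak_pairing (wave 1 0) ((period_map \<alpha> ^^ Suc k) seed_field)
      = torus_integral (\<lambda>x. cis (- (2 * pi * x $ 3)) * (period_map \<alpha> ^^ Suc k) seed_field x $ 1)"
  proof -
    have "bounded_borel ((period_map \<alpha> ^^ Suc k) seed_field)" "torus_periodic ((period_map \<alpha> ^^ Suc k) seed_field)"
      using reg by (simp_all only: regular_field_def)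
    note weak_pairing_wave[OF first_mode_period_map[OF first_mode_seed_field] this]
    then show ?thesis by (simp only:) simp
  qed
  also have "\<dots> = torus_integral (\<lambda>x. cis (- (2 * pi * x $ 3)) * (period_map \<alpha> ^^ k) (period_map \<alpha> seed_field) x $ 1)"
    by (simp only: funpow_Suc_right o_apply)
  also note torus_integral_period_power[OF pm]
  also note torus_integral_period_step[OF s]
  also have "torus_integral (\<lambda>x. cis (- (2 * pi * x $ 3)) *
        pulled_form \<alpha> (Suc (2 * k)) (x $ 1) (x $ 2 + \<alpha> * tent (x $ 1)) (seed_field x $ 1)
          (seed_field x $ 2 + of_real (\<alpha> * tent_slope (x $ 1)) * seed_field x $ 1)) = torus_integral F"
  proof (rule arg_cong[where f=torus_integral], rule ext)
    fix x :: "real ^ 3"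
    have "pulled_form \<alpha> (Suc (2 * k)) (x $ 1) (x $ 2 + \<alpha> * tent (x $ 1)) 0 (cis (2 * pi * x $ 3))
        = cis (2 * pi * x $ 3) * F x"
      using pulled_form_scale[of \<alpha> "Suc (2 * k)" "x $ 1" "x $ 2 + \<alpha> * tent (x $ 1)" "cis (2 * pi * x $ 3)" 0 1]
      by (simp add: F_def del: pulled_form.simps)
    moreover have "cis (- (2 * pi * x $ 3)) * (cis (2 * pi * x $ 3) * z) = z" for z
      by (simp add: cis_mult flip: mult.assoc)
    ultimately show "cis (- (2 * pi * x $ 3)) *
        pulled_form \<alpha> (Suc (2 * k)) (x $ 1) (x $ 2 + \<alpha> * tent (x $ 1)) (seed_field x $ 1)
          (seed_field x $ 2 + of_real (\<alpha> * tent_slope (x $ 1)) * seed_field x $ 1) = F x"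
      by (simp add: seed_field_def axis_def del: pulled_form.simps)
  qed
  finally have pair: "2 * weak_pairing (wave 1 0) ((period_map \<alpha> ^^ Suc k) seed_field) = torus_integral F" .
  have tm: "(\<lambda>x::real ^ 3. x $ 2 + \<alpha> * tent (x $ 1)) \<in> borel_measurable borel"
    by (intro borel_measurable_continuous_onI continuous_intros continuous_on_compose2[OF continuous_on_tent[of UNIV]]) auto
  have Fb: "bounded_borel F"
    unfolding F_def[abs_def] by (intro bounded_borel_pulled_form_compose nth_measurable tm bounded_borel_const)
  have Fp: "F (x + axis 2 1) = F x" for x
    using pulled_form_add_one(2)[of \<alpha> ?n "x $ 1" "x $ 2 + \<alpha> * tent (x $ 1)" 0 1]
    by (simp add: F_def axis_def algebra_simps del: pulled_form.simps)
  have inner: "(LINT h:{0..1}|lborel. F (x + h *\<^sub>R axis 2 1)) = line_integral \<alpha> ?n (x $ 1) 0 0 1" for x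
  proof -
    let ?p = "\<lambda>h. pulled_form \<alpha> ?n (x $ 1) h 0 1"
    have bp: "bounded_borel ?p"
      using bounded_borel_on_line[of \<alpha> ?n "x $ 1" 0 0 1] by simp
    have "(LINT h:{0..1}|lborel. F (x + h *\<^sub>R axis 2 1)) = (LINT h:{0..1}|lborel. ?p (h + (x $ 2 + \<alpha> * tent (x $ 1))))"
      by (simp add: F_def axis_def algebra_simps del: pulled_form.simps)
    also have "\<dots> = (LINT h:{0..1}|lborel. ?p h)"
      by (rule interval_integral_translate[OF bp]) (rule pulled_form_add_one(2))
    also have "\<dots> = line_integral \<alpha> ?n (x $ 1) 0 0 1"
      using set_lebesgue_eq_integral[OF bp] by (simp add: line_integral_def del: pulled_form.simps)
    finally show ?thesis .
  qed
  have "norm (torus_integral (\<lambda>x. LINT h:{0..1}|lborel. F (x + h *\<^sub>R axis 2 1)) - mean_integral \<alpha> ?n) \<le> D"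
  proof (rule norm_torus_integral_diff_le[OF torus_integral_average(2)[OF Fb Fp]])
    fix x
    show "norm ((LINT h:{0..1}|lborel. F (x + h *\<^sub>R axis 2 1)) - mean_integral \<alpha> ?n) \<le> D"
      unfolding inner using line_integral_unit_close[OF lb \<alpha>, of 0 "x $ 1" 0] \<alpha> by simp
  qed
  then show ?thesis unfolding pair torus_integral_average(1)[OF Fb Fp] .
qed

theorem corollary2p10:
  shows "\<exists>(g :: real ^ 2 \<Rightarrow> real) (\<alpha>\<^sub>0 :: real). torus_lipschitz g \<and> \<alpha>\<^sub>0 \<ge> 1 \<and>
    (\<forall>(\<alpha> :: nat) (N :: nat). even \<alpha> \<and> real \<alpha> \<ge> \<alpha>\<^sub>0 \<longrightarrow>
       perfect_dynamo (velocity (real \<alpha>) N g))"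
proof -
  obtain \<alpha>0 where \<alpha>0: "\<alpha>0 \<ge> 4" and
    growth: "\<And>\<alpha> n. \<alpha> \<ge> \<alpha>0 \<Longrightarrow> \<exists>A D. line_bounds \<alpha> n A D \<and> D \<le> norm (mean_integral \<alpha> n) / 2
        \<and> 3 ^ n / 2 \<le> norm (mean_integral \<alpha> n)"
    using mean_integral_growth by blast
  have "perfect_dynamo (velocity \<alpha> N twist_phase)" if \<alpha>: "\<alpha> \<ge> \<alpha>0" for \<alpha> :: real and N
  proof -
    define T where "T = real N + 3"
    have T: "T > 0" by (simp add: T_def)
    define q where "q t = cmod (torus_integral (\<lambda>x. vdot (wave 1 0 x) (solution \<alpha> N seed_field t x)))" for t
    define r where "r t = ereal (1 / t) * elog (q t)" for t
    have large: "ereal (1 / (2 * T)) \<le> r (real (Suc k) * T)" if k: "k \<ge> 1" for k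
    proof -
      obtain A D where lb: "line_bounds \<alpha> (2 * k + 1) A D" and D: "D \<le> norm (mean_integral \<alpha> (2 * k + 1)) / 2"
        and J: "3 ^ (2 * k + 1) / 2 \<le> norm (mean_integral \<alpha> (2 * k + 1))"
        using growth[OF \<alpha>] by blast
      have "solution \<alpha> N seed_field (real (Suc k) * T) = (period_map \<alpha> ^^ Suc k) seed_field"
        using solution_stage[of 0 N \<alpha> seed_field "Suc k"] by (simp add: stage_0 T_def)
      then have q: "q (real (Suc k) * T) = norm (weak_pairing (wave 1 0) ((period_map \<alpha> ^^ Suc k) seed_field))"
        by (simp add: q_def weak_pairing_def)
      have "norm (mean_integral \<alpha> (2 * k + 1)) \<le> 2 * q (real (Suc k) * T) + D"
        using weak_pairing_seed[OF lb] \<alpha> \<alpha>0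
          norm_triangle_sub[of "mean_integral \<alpha> (2 * k + 1)" "2 * weak_pairing (wave 1 0) ((period_map \<alpha> ^^ Suc k) seed_field)"]
        unfolding q by (simp add: norm_minus_commute norm_mult)
      then have "3 ^ (2 * k + 1) / 8 \<le> q (real (Suc k) * T)" using D J by linarith
      moreover have "exp (real k) \<le> 3 ^ (2 * k + 1) / 8"
      proof -
        have "exp (real k) = exp 1 ^ k" by (simp flip: exp_of_nat_mult)
        also have "\<dots> \<le> 3 ^ k" using exp_le by (intro power_mono) auto
        also have "\<dots> \<le> 3 ^ k * (3 ^ k * 3 / 8)"
        proof -
          have "(3::real) ^ 1 \<le> 3 ^ k" using k by (intro power_increasing) auto
          then show ?thesis by simp
        qed
        also have "\<dots> = 3 ^ (2 * k + 1) / 8" by (simp add: mult_2 power_add)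
        finally show ?thesis .
      qed
      ultimately have e: "exp (real k) \<le> q (real (Suc k) * T)" by linarith
      then have qpos: "q (real (Suc k) * T) > 0" using exp_gt_zero less_le_trans by blast
      have "real k \<le> ln (q (real (Suc k) * T))" using e qpos by (simp add: ln_ge_iff)
      moreover have "1 / (2 * T) \<le> (1 / (real (Suc k) * T)) * real k"
      proof -
        have "1 / (2 * T) * (real (Suc k) * T) = real (Suc k) / 2" using T by simp
        also have "\<dots> \<le> real k" using k by simp
        finally show ?thesis
          using pos_le_divide_eq[of "real (Suc k) * T" "1 / (2 * T)" "real k"] T by simp
      qed
      moreover have "(1 / (real (Suc k) * T)) * real k \<le> (1 / (real (Suc k) * T)) * ln (q (real (Suc k) * T))"
        using calculation(1) T by (intro mult_left_mono) auto
      ultimately show ?thesis using qpos by (simp add: r_def elog_def)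
    qed
    have "ereal (1 / (2 * T)) \<le> Limsup at_top r"
    proof (rule ccontr)
      assume "\<not> ?thesis"
      then have "Limsup at_top r < ereal (1 / (2 * T))" by simp
      then have "eventually (\<lambda>t. r t < ereal (1 / (2 * T))) at_top" by (rule Limsup_lessD)
      then obtain t0 where t0: "\<And>t. t \<ge> t0 \<Longrightarrow> r t < ereal (1 / (2 * T))"
        unfolding eventually_at_top_linorder by blast
      obtain k :: nat where k: "max 1 (t0 / T) \<le> real k" using real_arch_simple by blast
      then have "t0 \<le> real k * T" using T by (simp add: pos_divide_le_eq)
      also have "\<dots> \<le> real (Suc k) * T" using T by (intro mult_right_mono) auto
      finally have "r (real (Suc k) * T) < ereal (1 / (2 * T))" by (rule t0)
      then show False using large[of k] k by simp
    qed
    also have "Limsup at_top r \<le> growth_rate (velocity \<alpha> N twist_phase) (wave 1 0)"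
      unfolding growth_rate_def r_def q_def
    proof (rule Sup_upper, rule CollectI, intro exI conjI)
      show "torus_L2 seed_field" by (rule regular_field_L2[OF regular_seed_field])
      show "div_free seed_field"
        using regular_seed_field strong_div_free_imp_div_free unfolding regular_field_def by blast
      show "ideal_solution (velocity \<alpha> N twist_phase) seed_field (solution \<alpha> N seed_field)"
        by (rule ideal_solution_solution[OF regular_seed_field])
    qed (rule refl)
    finally have "ereal (1 / (2 * T)) \<le> growth_rate (velocity \<alpha> N twist_phase) (wave 1 0)" .
    moreover have "(0::ereal) < ereal (1 / (2 * T))" using T by simp
    ultimately have "growth_rate (velocity \<alpha> N twist_phase) (wave 1 0) > 0" by (rule less_le_trans[rotated])
    then show ?thesis
      unfolding perfect_dynamo_def using admissible_velocity_twist torus_smooth_wave by blast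
  qed
  then show ?thesis
    using torus_lipschitz_twist_phase \<alpha>0 by (intro exI[of _ twist_phase] exI[of _ \<alpha>0]) auto
qed

end
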